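(* The group $H_1(C_{k,n},\mathbb{Z})$ is generated by the images, under the homomorphism $\iota_*:H_1(C_{k,n}',\mathbb{Z})\to H_1(C_{k,n},\mathbb{Z})$ induced by the inclusion $\iota:C_{k,n}'\hookrightarrow C_{k,n}$, of the classes in $H_1(C_{k,n}',\mathbb{Z})\cong\mathrm{Deck}(q)/[\mathrm{Deck}(q),\mathrm{Deck}(q)]$ of the elements $$\phi_i^k\quad(1\le i\le n)$$ and $$\Big(\prod_{d=1}^n\phi_d^{g_d}\Big)[\phi_j,\phi_l]\Big(\prod_{d=1}^n\phi_d^{g_d}\Big)^{-1}\quad(1\le j<l\le n,\ 0\le g_d\le k-1 \text{ for } 1\le d\le n).$$
   Context: Let $k,n\ge 2$ be integers and let $\lambda_1,\dots,\lambda_{n-2}\in\mathbb{C}\setminus\{0,1\}$ be pairwise distinct. Put $r_1=0$, $r_2=\lambda_0=1$, $r_i=\lambda_{i-2}$ for $3\le i\le n$, and $R=\{r_1,\dots,r_n\}$. The generalized Fermat curve $C_{k,n}\subset\mathbb{P}^n\mathbb{C}$ is the smooth projective curve (compact Riemann surface) defined by the $n-1$ equations $r_i x_0^k+x_1^k+x_i^k=0$, $2\le i\le n$. Let $\pi:C_{k,n}\to\hat{\mathbb{C}}$, $\pi([x_0,\dots,x_n])=-(x_1/x_0)^k$, and $C_{k,n}'=C_{k,n}\setminus\pi^{-1}(R\cup\{\infty\})$. Let $p:U\to\mathbb{C}\setminus R$ be a universal covering (holomorphic) with group of covering transformations $\mathrm{Deck}(p)$. Put $p_1=-p$ and $p_i=p-r_i$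 for $2\le i\le n$. These functions do not vanish on $U$; fix holomorphic logarithms $\log p_i$ on $U$ and set $\hat{x}_i=\exp(\frac1k\log p_i)$. For $\phi\in\mathrm{Deck}(p)$, $L(p_i,\phi)\in\mathbb{Z}$ denotes the constant value of $\frac{1}{2\pi i}(\log p_i\circ\phi-\log p_i)$. Let $q:U\to C_{k,n}'$, $q(u)=[1,\hat{x}_1(u),\dots,\hat{x}_n(u)]$, a universal covering of $C_{k,n}'$, with group of covering transformations $\mathrm{Deck}(q)\le \mathrm{Deck}(p)$, so that $\pi_1(C_{k,n}')\cong\mathrm{Deck}(q)$; the homology class of $\phi\in\mathrm{Deck}(q)$ is that of the loop $q\circ l_\phi$, where $l_\phi$ is a path in $U$ from a fixed point $u$ to $\phi(u)$. The group $\mathrm{Deck}(p)\cong\pi_1(\mathbb{C}\setminus R)$ is free of rank $n$; $\phi_1,\dots,\phi_n$ denote free generators of $\mathrm{Deck}(p)$ corresponding to free generators of $\pi_1(\mathbb{C}\setminus R)$, the $i$-th being freely homotopic to a small positively oriented circle around $r_i$; in particular $L(p_i,\phi_j)=\delta_{ij}$ for $1\le i,j\le n$. Products $\prod_{d=1}^n\phi_d^{g_d}$ are taken in the order $d=1,\dots,n$, and $[a,b]=aba^{-1}b^{-1}$. *)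

theory Defs
  imports
    "HOL-Algebra.Bij"
    "HOL-Algebra.Generated_Groups"
    "HOL-Complex_Analysis.Complex_Analysis"
    "HOL-Homology.Homology"
begin

section \<open>Riemann surfaces and covering transformations\<close>

text \<open>A complex atlas is a set of pairs \<open>(V, z)\<close>: a coordinate patch and its chart.\<close>

definition complex_atlas ::
  "'u::topological_space set \<Rightarrow> ('u set \<times> ('u \<Rightarrow> complex)) set \<Rightarrow> bool" where
  "complex_atlas U A \<longleftrightarrow>
     \<Union>(fst ` A) = U \<and>
     (\<forall>(V, z)\<in>A. openin (top_of_set U) V \<and> open (z ` V) \<and> (\<exists>w. homeomorphism V (z ` V) z w)) \<and>
     (\<forall>(V, z)\<in>A. \<forall>(V', z')\<in>A. (z' \<circ> inv_into V z) holomorphic_on z ` (V \<inter> V'))"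

definition riemann_surface ::
  "'u::t2_space set \<Rightarrow> ('u set \<times> ('u \<Rightarrow> complex)) set \<Rightarrow> bool" where
  "riemann_surface U A \<longleftrightarrow> U \<noteq> {} \<and> connected U \<and> complex_atlas U A"

definition holomorphic_wrt ::
  "('u set \<times> ('u \<Rightarrow> complex)) set \<Rightarrow> ('u \<Rightarrow> complex) \<Rightarrow> bool" where
  "holomorphic_wrt A f \<longleftrightarrow> (\<forall>(V, z)\<in>A. (f \<circ> inv_into V z) holomorphic_on z ` V)"

text \<open>
  Elements are extensional functions (undefined off \<open>U\<close>), as in \<^const>\<open>BijGroup\<close>;
  the product of \<open>\<phi>\<close> and \<open>\<psi>\<close> is \<open>\<phi>\<close> after \<open>\<psi>\<close>.
\<close>

definition deck_group :: "'u::topological_space set \<Rightarrow> ('u \<Rightarrow> 'b) \<Rightarrow> ('u \<Rightarrow> 'u) monoid" where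
  "deck_group U p = (BijGroup U)
     \<lparr>carrier := {\<phi> \<in> Bij U. (\<exists>\<psi>. homeomorphism U U \<phi> \<psi>) \<and> (\<forall>u\<in>U. p (\<phi> u) = p u)}\<rparr>"

lemma homeomorphism_cong_left:
  assumes "homeomorphism S T f g" "\<And>x. x \<in> S \<Longrightarrow> f' x = f x"
  shows "homeomorphism S T f' g"
  by (rule homeomorphism_cong[OF assms(1) refl refl]) (use assms in auto)

lemma group_deck_group: "group (deck_group U p)"
proof -
  let ?D = "{\<phi> \<in> Bij U. (\<exists>\<psi>. homeomorphism U U \<phi> \<psi>) \<and> (\<forall>u\<in>U. p (\<phi> u) = p u)}"
  have "subgroup ?D (BijGroup U)"
  proof (rule group.subgroupI[OF group_BijGroup])
    show "?D \<subseteq> carrier (BijGroup U)"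
      by (auto simp: BijGroup_def)
    have "(\<lambda>u\<in>U. u) \<in> ?D"
      by (auto simp: id_Bij intro!: exI[of _ "\<lambda>x. x"] homeomorphism_cong_left[OF homeomorphism_ident])
    then show "?D \<noteq> {}" by blast
  next
    fix \<phi> assume \<phi>: "\<phi> \<in> ?D"
    then obtain \<psi> where \<psi>: "homeomorphism U U \<phi> \<psi>" by blast
    have eq: "inv_into U \<phi> u = \<psi> u" if "u \<in> U" for u
    proof (rule inv_into_f_eq)
      show "inj_on \<phi> U" using \<phi> by (auto simp: Bij_def bij_betw_def)
    qed (use \<psi> that in \<open>auto simp: homeomorphism_def\<close>)
    have "homeomorphism U U (restrict (inv_into U \<phi>) U) \<phi>"
      by (rule homeomorphism_cong_left[OF homeomorphism_symD[OF \<psi>]]) (auto simp: eq)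
    moreover have "p (restrict (inv_into U \<phi>) U u) = p u" if "u \<in> U" for u
    proof -
      have "\<psi> u \<in> U" "\<phi> (\<psi> u) = u" using \<psi> that by (auto simp: homeomorphism_def)
      then show ?thesis using \<phi> that eq by (metis (mono_tags, lifting) mem_Collect_eq restrict_apply')
    qed
    ultimately show "inv\<^bsub>BijGroup U\<^esub> \<phi> \<in> ?D"
      using \<phi> by (auto simp: inv_BijGroup restrict_inv_into_Bij)
  next
    fix \<phi> \<phi>' assume a: "\<phi> \<in> ?D" "\<phi>' \<in> ?D"
    then obtain \<psi> \<psi>' where h: "homeomorphism U U \<phi> \<psi>" "homeomorphism U U \<phi>' \<psi>'" by blast
    have "homeomorphism U U (compose U \<phi> \<phi>') (\<psi>' \<circ> \<psi>)"
      by (rule homeomorphism_cong_left[OF homeomorphism_compose[OF h(2,1)]])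
         (auto simp: compose_def)
    moreover have "\<phi>' u \<in> U" if "u \<in> U" for u
      using h(2) that by (auto simp: homeomorphism_def)
    then have "p (compose U \<phi> \<phi>' u) = p u" if "u \<in> U" for u
      using a that by (simp add: compose_def)
    ultimately show "\<phi> \<otimes>\<^bsub>BijGroup U\<^esub> \<phi>' \<in> ?D"
      using a by (auto simp: BijGroup_def compose_Bij)
  qed
  from group.subgroup_imp_group[OF group_BijGroup this] show ?thesis
    by (simp add: deck_group_def)
qed


section \<open>Free generators and ordered products in a group\<close>

text \<open>A word is a list of letters \<open>(i, b)\<close>, standing for \<open>x i\<close> if \<open>b\<close> and for its inverse otherwise.\<close>

definition word_eval :: "('a, 'm) monoid_scheme \<Rightarrow> ('i \<Rightarrow> 'a) \<Rightarrow> ('i \<times> bool) list \<Rightarrow> 'a" where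
  "word_eval G x w =
     foldr (\<lambda>(i, b) a. (if b then x i else inv\<^bsub>G\<^esub> x i) \<otimes>\<^bsub>G\<^esub> a) w \<one>\<^bsub>G\<^esub>"

definition reduced_word :: "('i \<times> bool) list \<Rightarrow> bool" where
  "reduced_word w \<longleftrightarrow>
     (\<forall>m. Suc m < length w \<longrightarrow> \<not> (fst (w ! m) = fst (w ! Suc m) \<and> snd (w ! m) \<noteq> snd (w ! Suc m)))"

definition free_generators :: "('a, 'm) monoid_scheme \<Rightarrow> 'i set \<Rightarrow> ('i \<Rightarrow> 'a) \<Rightarrow> bool" where
  "free_generators G I x \<longleftrightarrow>
     x ` I \<subseteq> carrier G \<and> generate G (x ` I) = carrier G \<and>
     (\<forall>w. w \<noteq> [] \<and> fst ` set w \<subseteq> I \<and> reduced_word w \<longrightarrow> word_eval G x w \<noteq> \<one>\<^bsub>G\<^esub>)"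

definition group_commutator :: "('a, 'm) monoid_scheme \<Rightarrow> 'a \<Rightarrow> 'a \<Rightarrow> 'a" where
  "group_commutator G a b = a \<otimes>\<^bsub>G\<^esub> b \<otimes>\<^bsub>G\<^esub> inv\<^bsub>G\<^esub> a \<otimes>\<^bsub>G\<^esub> inv\<^bsub>G\<^esub> b"

definition power_product :: "('a, 'm) monoid_scheme \<Rightarrow> nat \<Rightarrow> (nat \<Rightarrow> 'a) \<Rightarrow> (nat \<Rightarrow> nat) \<Rightarrow> 'a" where
  "power_product G n x g = foldr (\<lambda>d a. (x d [^]\<^bsub>G\<^esub> g d) \<otimes>\<^bsub>G\<^esub> a) [1..<Suc n] \<one>\<^bsub>G\<^esub>"


section \<open>Homology class of a loop\<close>

text \<open>
  A loop parametrised by \<open>[0, 1]\<close> is read as a singular 1-simplex through the barycentric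
  coordinate \<open>t 1\<close>, so that it runs from vertex 0 to vertex 1.
\<close>

definition loop_class :: "'a topology \<Rightarrow> (real \<Rightarrow> 'a) \<Rightarrow> 'a chain set" where
  "loop_class X \<gamma> =
     homologous_rel_set 1 X {} (frag_of (restrict (\<lambda>t. \<gamma> (t 1)) (standard_simplex 1)))"

lemma loop_class_in_homology_group:
  assumes "pathin X \<gamma>" "\<gamma> 0 = \<gamma> 1"
  shows "loop_class X \<gamma> \<in> carrier (homology_group 1 X)"
proof -
  let ?f = "restrict (\<lambda>t. \<gamma> (t 1)) (standard_simplex 1)"
  have proj: "continuous_map (subtopology (powertop_real UNIV) (standard_simplex 1))
      (top_of_set {0..1}) (\<lambda>t. t 1)"
    unfolding continuous_map_in_subtopology
    by (auto intro!: continuous_map_from_subtopology continuous_map_product_projection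
        simp: standard_simplex_def)
  have "continuous_map (subtopology (powertop_real UNIV) (standard_simplex 1)) X (\<lambda>t. \<gamma> (t 1))"
    using continuous_map_compose[OF proj, of X \<gamma>] assms(1) by (simp add: pathin_def o_def)
  then have f: "singular_simplex 1 X ?f"
    unfolding singular_simplex_def
    by (auto elim!: continuous_map_eq simp: topspace_standard_simplex)
  have "singular_face 1 0 ?f = singular_face 1 1 ?f"
    using assms(2)
    by (auto simp: singular_face_def fun_eq_iff standard_simplex_0 restrict_def
        simplical_face_def standard_simplex_def)
  then have "chain_boundary 1 (frag_of ?f) = 0"
    by (simp add: chain_boundary_of)
  with f have "singular_relcycle 1 X {} (frag_of ?f)"
    by (simp add: singular_cycle singular_chain_of)
  then show ?thesis
    using carrier_relative_homology_group[of 1 X "{}"] unfolding loop_class_def by auto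
qed


section \<open>Complex projective space\<close>

definition punctured_space :: "nat \<Rightarrow> (nat \<Rightarrow> complex) topology" where
  "punctured_space n =
     subtopology (product_topology (\<lambda>_. euclidean) {..n}) (- {\<lambda>i\<in>{..n}. 0})"

text \<open>
  The point \<open>[x\<^sub>0, \<dots>, x\<^sub>n]\<close> is the set of all representatives, and projective space
  carries the quotient topology.
\<close>

definition proj_point :: "nat \<Rightarrow> (nat \<Rightarrow> complex) \<Rightarrow> (nat \<Rightarrow> complex) set" where
  "proj_point n x = {\<lambda>i\<in>{..n}. c * x i | c. c \<noteq> 0}"

definition proj_space :: "nat \<Rightarrow> (nat \<Rightarrow> complex) set topology" where
  "proj_space n = topology (\<lambda>V. V \<subseteq> proj_point n ` topspace (punctured_space n) \<and>
     openin (punctured_space n) {x \<in> topspace (punctured_space n). proj_point n x \<in> V})"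

lemma openin_proj_space:
  "openin (proj_space n) V \<longleftrightarrow> V \<subseteq> proj_point n ` topspace (punctured_space n) \<and>
     openin (punctured_space n) {x \<in> topspace (punctured_space n). proj_point n x \<in> V}"
proof -
  let ?X = "punctured_space n" and ?f = "proj_point n"
  have "istopology (\<lambda>V. V \<subseteq> ?f ` topspace ?X \<and> openin ?X {x \<in> topspace ?X. ?f x \<in> V})"
    unfolding istopology_def
  proof (intro conjI allI impI)
    fix S T
    assume a: "S \<subseteq> ?f ` topspace ?X \<and> openin ?X {x \<in> topspace ?X. ?f x \<in> S}"
      "T \<subseteq> ?f ` topspace ?X \<and> openin ?X {x \<in> topspace ?X. ?f x \<in> T}"
    then show "S \<inter> T \<subseteq> ?f ` topspace ?X" by blast
    have "{x \<in> topspace ?X. ?f x \<in> S \<inter> T} =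
        {x \<in> topspace ?X. ?f x \<in> S} \<inter> {x \<in> topspace ?X. ?f x \<in> T}" by blast
    then show "openin ?X {x \<in> topspace ?X. ?f x \<in> S \<inter> T}" using a by auto
  next
    fix K assume a: "\<forall>S\<in>K. S \<subseteq> ?f ` topspace ?X \<and> openin ?X {x \<in> topspace ?X. ?f x \<in> S}"
    then show "\<Union>K \<subseteq> ?f ` topspace ?X" by blast
    have "{x \<in> topspace ?X. ?f x \<in> \<Union>K} = \<Union>((\<lambda>S. {x \<in> topspace ?X. ?f x \<in> S}) ` K)" by blast
    then show "openin ?X {x \<in> topspace ?X. ?f x \<in> \<Union>K}" using a by auto
  qed
  then show ?thesis by (simp add: proj_space_def)
qed

lemma topspace_proj_space: "topspace (proj_space n) = proj_point n ` topspace (punctured_space n)"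
proof -
  have "openin (proj_space n) (proj_point n ` topspace (punctured_space n))"
    by (auto simp: openin_proj_space intro: back_subst[of "openin _", OF openin_topspace])
  then show ?thesis
    by (metis openin_proj_space openin_subset openin_topspace subset_antisym)
qed

lemma quotient_map_proj_point: "quotient_map (punctured_space n) (proj_space n) (proj_point n)"
  by (auto simp: quotient_map_def topspace_proj_space openin_proj_space)


section \<open>Generalized Fermat curves\<close>

definition branch_pt :: "(nat \<Rightarrow> complex) \<Rightarrow> nat \<Rightarrow> complex" where
  "branch_pt lam i = (if i = 1 then 0 else if i = 2 then 1 else lam (i - 2))"

definition branch_set :: "nat \<Rightarrow> (nat \<Rightarrow> complex) \<Rightarrow> complex set" where
  "branch_set n lam = branch_pt lam ` {1..n}"

definition fermat_curve :: "nat \<Rightarrow> nat \<Rightarrow> (nat \<Rightarrow> complex) \<Rightarrow> (nat \<Rightarrow> complex) set topology" where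
  "fermat_curve k n lam = subtopology (proj_space n)
     {proj_point n x | x. x \<in> topspace (punctured_space n) \<and>
        (\<forall>i\<in>{2..n}. branch_pt lam i * x 0 ^ k + x 1 ^ k + x i ^ k = 0)}"

text \<open>The Riemann sphere is \<open>complex option\<close>, with \<open>None\<close> for the point at infinity.\<close>

definition fermat_map :: "nat \<Rightarrow> (nat \<Rightarrow> complex) set \<Rightarrow> complex option" where
  "fermat_map k P =
     (let x = SOME x. x \<in> P in if x 0 = 0 then None else Some (- ((x 1 / x 0) ^ k)))"

lemma fermat_map_proj_point:
  assumes "1 \<le> n"
  shows "fermat_map k (proj_point n x) = (if x 0 = 0 then None else Some (- ((x 1 / x 0) ^ k)))"
proof -
  have "(\<lambda>i\<in>{..n}. 1 * x i) \<in> proj_point n x"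
    unfolding proj_point_def by (rule CollectI, rule exI[of _ 1]) simp
  then have "(SOME y. y \<in> proj_point n x) \<in> proj_point n x"
    by (rule someI[of "\<lambda>y. y \<in> proj_point n x"])
  then obtain c where "c \<noteq> 0" "(SOME y. y \<in> proj_point n x) = (\<lambda>i\<in>{..n}. c * x i)"
    by (auto simp: proj_point_def)
  then show ?thesis
    using assms by (simp add: fermat_map_def)
qed

definition fermat_curve' :: "nat \<Rightarrow> nat \<Rightarrow> (nat \<Rightarrow> complex) \<Rightarrow> (nat \<Rightarrow> complex) set topology" where
  "fermat_curve' k n lam = subtopology (fermat_curve k n lam)
     (- (fermat_map k -` (insert None (Some ` branch_set n lam))))"

definition branch_fun :: "(nat \<Rightarrow> complex) \<Rightarrow> ('u \<Rightarrow> complex) \<Rightarrow> nat \<Rightarrow> 'u \<Rightarrow> complex" where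
  "branch_fun lam p i u = (if i = 1 then - p u else p u - branch_pt lam i)"

definition fermat_cover ::
  "nat \<Rightarrow> nat \<Rightarrow> (nat \<Rightarrow> 'u \<Rightarrow> complex) \<Rightarrow> 'u \<Rightarrow> (nat \<Rightarrow> complex) set" where
  "fermat_cover k n logp u =
     proj_point n (\<lambda>i\<in>{..n}. if i = 0 then 1 else exp (1 / of_nat k * logp i u))"

definition fermat_generators ::
  "('a, 'm) monoid_scheme \<Rightarrow> nat \<Rightarrow> nat \<Rightarrow> (nat \<Rightarrow> 'a) \<Rightarrow> 'a set" where
  "fermat_generators G k n \<phi> =
     {\<phi> i [^]\<^bsub>G\<^esub> k | i. 1 \<le> i \<and> i \<le> n} \<union>
     {power_product G n \<phi> g \<otimes>\<^bsub>G\<^esub> group_commutator G (\<phi> j) (\<phi> l) \<otimes>\<^bsub>G\<^esub> inv\<^bsub>G\<^esub> (power_product G n \<phi> g)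
       | g j l. 1 \<le> j \<and> j < l \<and> l \<le> n \<and> (\<forall>d\<in>{1..n}. g d \<le> k - 1)}"

end

(* Homology. H_1(C) is generated by classes of small paths, corrected at their endpoints by fixed paths
from the base point. A small path either avoids the points with a vanishing coordinate or lies in a
disc around one of them, out of whose centre it can be moved; so loops in C' suffice. Such loops lift
to U, and since the deck transformations of p act transitively on its fibres, a lifted path joins the
base point to a translate of it under Deck(q). Hence H_1(C) is the image of Deck(q).

Algebra. The integers L(p_i, w) are the exponent sums of w in the generators, and Deck(q) consists of
the w in Deck(p) whose exponent sums are divisible by k. For a homomorphism from Deck(q) to an abelian
group, let M be the preimage of the subgroup generated by the images of the listed elements. M is
invariant under conjugation by Deck(q), and every h in Deck(p) is s * prod phi_d^{g_d} with s in Deck(q)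
and 0 <= g_d < k, so M contains all conjugates of the commutators [phi_j, phi_l], thus the commutator
subgroup of Deck(p). Modulo the latter an element of Deck(q) is a product of powers of the phi_i^k.
*)
theory Submission
  imports Defs
begin

section \<open>Exponent sums in a group\<close>

text \<open>The covering used for lifting is \<open>p\<close>; that \<open>q\<close> is a covering
  is nowhere derived. A path in the punctured curve is lifted by lifting its coordinate -x_1^k
  through \<open>p\<close>. The other coordinates then differ from those of \<open>q\<close> by k-th
  roots of unity that vary continuously, hence are constant. Surjectivity of \<open>q\<close> also
  comes from correcting roots of unity, by deck transformations of \<open>p\<close>. Transitivity of
  Deck(p) needs a construction: the transformation taking u to u' sends v to the end of the lift,
  started at u', of the projection of a path from u to v. Simple connectivity makes this independent
  of the path. All homology relations come from triangles of paths in a simply connected space.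
  Since q o \<psi> = q for \<psi> in Deck(q), translating a side by \<psi> does not change its
  image. So \<psi> |-> class in H_1(C) is a homomorphism, and the algebra is applied to it directly,
  without computing H_1(C'). In the algebra, the step from conjugates of commutators to the
  commutator subgroup is made in the quotient by the normal core of M, a group generated by
  commuting elements.\<close>

lemma (in group) commute_generate:
  assumes "x \<in> generate G S" "S \<subseteq> carrier G" "y \<in> carrier G" "\<And>s. s \<in> S \<Longrightarrow> s \<otimes> y = y \<otimes> s"
  shows "x \<otimes> y = y \<otimes> x"
  using assms(1)
proof (induction rule: generate.induct)
  case one
  then show ?case using assms(3) by simp
next
  case (incl h)
  then show ?case using assms(4) by blast
next
  case (inv h)
  then have h: "h \<in> carrier G" "h \<otimes> y = y \<otimes> h" using assms by auto
  have "inv h \<otimes> y = inv h \<otimes> (y \<otimes> h) \<otimes> inv h"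
    using h(1) assms(3) by (simp add: m_assoc)
  also have "\<dots> = y \<otimes> inv h"
    using h(1) assms(3) by (simp add: h(2)[symmetric] m_assoc[symmetric])
  finally show ?case .
next
  case (eng h1 h2)
  then have c: "h1 \<in> carrier G" "h2 \<in> carrier G"
    using assms(2) generate_in_carrier by auto
  have "h1 \<otimes> h2 \<otimes> y = h1 \<otimes> (y \<otimes> h2)"
    using c assms(3) eng by (simp add: m_assoc)
  also have "\<dots> = y \<otimes> (h1 \<otimes> h2)"
    using c assms(3) eng by (simp add: m_assoc[symmetric])
  finally show ?case .
qed

text \<open>Centralizers are subgroups, so generators are replaced by arbitrary elements in one
  argument at a time, by two uses of \<open>commute_generate\<close>.\<close>

lemma (in group) comm_group_if_generators_commute:
  assumes "S \<subseteq> carrier G" "generate G S = carrier G"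
    and "\<And>s t. s \<in> S \<Longrightarrow> t \<in> S \<Longrightarrow> s \<otimes> t = t \<otimes> s"
  shows "comm_group G"
proof (rule group_comm_groupI)
  fix x y assume xy: "x \<in> carrier G" "y \<in> carrier G"
  have "y \<otimes> s = s \<otimes> y" if "s \<in> S" for s
    using commute_generate[of y S s] assms that xy by auto
  then show "x \<otimes> y = y \<otimes> x"
    using commute_generate[of x S y] assms xy by auto
qed

text \<open>Exponent sums may be negative, hence integer exponents. The index list fixes the order
  of the factors and carries the inductions.\<close>

definition int_power_product :: "('a, 'm) monoid_scheme \<Rightarrow> (nat \<Rightarrow> 'a) \<Rightarrow> (nat \<Rightarrow> int) \<Rightarrow> nat list \<Rightarrow> 'a" where
  "int_power_product G x a ds = foldr (\<lambda>d y. (x d [^]\<^bsub>G\<^esub> a d) \<otimes>\<^bsub>G\<^esub> y) ds \<one>\<^bsub>G\<^esub>"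

lemma int_power_product_simps [simp]:
  "int_power_product G x a [] = \<one>\<^bsub>G\<^esub>"
  "int_power_product G x a (d # ds) = (x d [^]\<^bsub>G\<^esub> a d) \<otimes>\<^bsub>G\<^esub> int_power_product G x a ds"
  by (simp_all add: int_power_product_def)

lemma power_product_eq_int_power_product:
  "power_product G n x g = int_power_product G x (\<lambda>d. int (g d)) [1..<Suc n]"
  by (simp add: power_product_def int_power_product_def int_pow_int)

lemma (in group) int_power_product_closed:
  assumes "\<And>d. d \<in> set ds \<Longrightarrow> x d \<in> carrier G"
  shows "int_power_product G x a ds \<in> carrier G"
  using assms by (induction ds) auto

lemma (in group) int_power_product_subgroup:
  assumes "subgroup M G" "\<And>d. d \<in> set ds \<Longrightarrow> x d [^] a d \<in> M"
  shows "int_power_product G x a ds \<in> M"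
  using assms(2) by (induction ds) (auto intro: subgroup.m_closed[OF assms(1)] subgroup.one_closed[OF assms(1)])

lemma (in group_hom) hom_int_power_product:
  assumes "\<And>d. d \<in> set ds \<Longrightarrow> x d \<in> carrier G"
  shows "h (int_power_product G x a ds) = int_power_product H (h \<circ> x) a ds"
  using assms by (induction ds) (auto simp: G.int_power_product_closed hom_int_pow)

lemma (in comm_group) int_power_product_add:
  fixes a b :: "nat \<Rightarrow> int"
  assumes "\<And>d. d \<in> set ds \<Longrightarrow> x d \<in> carrier G"
  shows "int_power_product G x (\<lambda>d. a d + b d) ds =
     int_power_product G x a ds \<otimes> int_power_product G x b ds"
  using assms
proof (induction ds)
  case (Cons d ds)
  then have c: "x d \<in> carrier G" "int_power_product G x a ds \<in> carrier G" "int_power_product G x b ds \<in> carrier G"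
    by (auto intro: int_power_product_closed)
  with Cons show ?case
    by (simp add: int_pow_mult m_ac)
qed simp

lemma (in group) int_power_product_zero: "int_power_product G x (\<lambda>d. 0) ds = \<one>"
  by (induction ds) auto

lemma (in comm_group) int_power_product_neg:
  assumes "\<And>d. d \<in> set ds \<Longrightarrow> x d \<in> carrier G"
  shows "int_power_product G x (\<lambda>d. - a d) ds = inv (int_power_product G x a ds)"
proof -
  have "int_power_product G x (\<lambda>d. - a d) ds \<otimes> int_power_product G x a ds = \<one>"
    using int_power_product_add[of ds x "\<lambda>d. - a d" a] int_power_product_zero assms by simp
  then show ?thesis
    using assms by (simp add: inv_equality int_power_product_closed)
qed

lemma (in group) int_power_product_delta:
  assumes "distinct ds" "j \<in> set ds" "\<And>d. d \<in> set ds \<Longrightarrow> x d \<in> carrier G"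
  shows "int_power_product G x (\<lambda>d. if d = j then 1 else 0) ds = x j"
proof -
  have 0: "int_power_product G x (\<lambda>d. if d = j then 1 else 0) es = \<one>"
    if "j \<notin> set es" "\<And>d. d \<in> set es \<Longrightarrow> x d \<in> carrier G" for es
    using that by (induction es) auto
  show ?thesis
    using assms by (induction ds) (auto simp: 0)
qed

text \<open>This is the normal core of \<open>M\<close>, the intersection of its conjugates: since
  \<open>h\<close> ranges over the whole group, a further conjugation is absorbed.\<close>

lemma (in group) subgroup_core:
  assumes "subgroup M G"
  shows "{x \<in> carrier G. \<forall>h\<in>carrier G. h \<otimes> x \<otimes> inv h \<in> M} \<lhd> G" (is "?K \<lhd> G")
proof -
  have "subgroup ?K G"
  proof (rule subgroupI)
    have "\<one> \<in> ?K" using subgroup.one_closed[OF assms] by simp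
    then show "?K \<noteq> {}" by blast
  next
    fix a assume a: "a \<in> ?K"
    have "h \<otimes> inv a \<otimes> inv h \<in> M" if "h \<in> carrier G" for h
    proof -
      have "inv (h \<otimes> a \<otimes> inv h) \<in> M" using a that subgroup.m_inv_closed[OF assms] by auto
      then show ?thesis using a that by (simp add: inv_mult_group m_assoc)
    qed
    then show "inv a \<in> ?K" using a by simp
  next
    fix a b assume ab: "a \<in> ?K" "b \<in> ?K"
    have "h \<otimes> (a \<otimes> b) \<otimes> inv h \<in> M" if h: "h \<in> carrier G" for h
    proof -
      have "(h \<otimes> a \<otimes> inv h) \<otimes> (h \<otimes> b \<otimes> inv h) \<in> M"
        using ab h subgroup.m_closed[OF assms] by auto
      moreover have "(h \<otimes> a \<otimes> inv h) \<otimes> (h \<otimes> b \<otimes> inv h) = h \<otimes> (a \<otimes> b) \<otimes> inv h"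
        using ab h by (simp add: inv_solve_left' m_assoc inv_solve_left)
      ultimately show ?thesis by simp
    qed
    then show "a \<otimes> b \<in> ?K" using ab by simp
  qed auto
  moreover have "g \<otimes> x \<otimes> inv g \<in> ?K" if "g \<in> carrier G" "x \<in> ?K" for g x
  proof -
    have "h \<otimes> (g \<otimes> x \<otimes> inv g) \<otimes> inv h \<in> M" if h: "h \<in> carrier G" for h
    proof -
      have "(h \<otimes> g) \<otimes> x \<otimes> inv (h \<otimes> g) \<in> M" using \<open>x \<in> ?K\<close> \<open>g \<in> carrier G\<close> h by auto
      then show ?thesis using \<open>x \<in> ?K\<close> \<open>g \<in> carrier G\<close> h by (simp add: inv_mult_group m_assoc)
    qed
    then show ?thesis using that by simp
  qed
  ultimately show ?thesis by (simp add: normal_inv_iff)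
qed

text \<open>\<open>ex d w\<close> stands for the integer L(p_d, w). As the \<open>x j\<close>
  generate \<open>G\<close>, additivity and the values on them determine it; this separates the
  group theory from the logarithms.\<close>

locale exponent_sum_group = group G for G (structure) +
  fixes n k :: nat and x :: "nat \<Rightarrow> 'a" and ex :: "nat \<Rightarrow> 'a \<Rightarrow> int"
  assumes x_closed: "\<And>d. d \<in> {1..n} \<Longrightarrow> x d \<in> carrier G"
    and generated: "generate G (x ` {1..n}) = carrier G"
    and ex_mult: "\<And>d a b. d \<in> {1..n} \<Longrightarrow> a \<in> carrier G \<Longrightarrow> b \<in> carrier G \<Longrightarrow> ex d (a \<otimes> b) = ex d a + ex d b"
    and ex_gen: "\<And>d j. d \<in> {1..n} \<Longrightarrow> j \<in> {1..n} \<Longrightarrow> ex d (x j) = (if d = j then 1 else 0)"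
    and k_pos: "0 < k"
begin

text \<open>For the covering this set is Deck(q), by \<open>carrier_deck_group_q\<close>.\<close>

definition exponent_kernel :: "'a set" where
  "exponent_kernel = {w \<in> carrier G. \<forall>d\<in>{1..n}. int k dvd ex d w}"

lemma ex_one: "d \<in> {1..n} \<Longrightarrow> ex d \<one> = 0"
  using ex_mult[of d \<one> \<one>] by simp

lemma ex_inv: "d \<in> {1..n} \<Longrightarrow> a \<in> carrier G \<Longrightarrow> ex d (inv a) = - ex d a"
  using ex_mult[of d "inv a" a] ex_one[of d] by simp

lemma ex_nat_pow: "d \<in> {1..n} \<Longrightarrow> a \<in> carrier G \<Longrightarrow> ex d (a [^] (m::nat)) = int m * ex d a"
  by (induction m) (auto simp: ex_one ex_mult algebra_simps)

lemma power_product_closed: "power_product G n x g \<in> carrier G"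
  unfolding power_product_eq_int_power_product
  by (rule int_power_product_closed) (auto intro: x_closed)

lemma ex_power_product:
  assumes "d \<in> {1..n}"
  shows "ex d (power_product G n x g) = int (g d)"
proof -
  have "ex d (int_power_product G x (\<lambda>d. int (g d)) ds) = (if d \<in> set ds then int (g d) else 0)"
    if "set ds \<subseteq> {1..n}" "distinct ds" for ds
    using that
  proof (induction ds)
    case (Cons e ds)
    have "int_power_product G x (\<lambda>d. int (g d)) ds \<in> carrier G"
      using Cons.prems by (intro int_power_product_closed x_closed) auto
    then show ?case
      using Cons assms x_closed[of e] by (auto simp: ex_mult int_pow_int ex_nat_pow ex_gen)
  qed (use assms in \<open>simp add: ex_one\<close>)
  from this[of "[1..<Suc n]"] have "ex d (int_power_product G x (\<lambda>d. int (g d)) [1..<Suc n]) = int (g d)"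
    using assms by (simp del: upt_Suc add: atLeastLessThanSuc_atLeastAtMost)
  then show ?thesis
    by (simp add: power_product_eq_int_power_product del: upt_Suc)
qed

lemma commutator_closed:
  "a \<in> carrier G \<Longrightarrow> b \<in> carrier G \<Longrightarrow> group_commutator G a b \<in> carrier G"
  by (simp add: group_commutator_def)

lemma ex_commutator:
  "d \<in> {1..n} \<Longrightarrow> a \<in> carrier G \<Longrightarrow> b \<in> carrier G \<Longrightarrow> ex d (group_commutator G a b) = 0"
  by (simp add: group_commutator_def ex_mult ex_inv)

lemma ex_conj:
  "d \<in> {1..n} \<Longrightarrow> h \<in> carrier G \<Longrightarrow> a \<in> carrier G \<Longrightarrow> ex d (h \<otimes> a \<otimes> inv h) = ex d a"
  by (simp add: ex_mult ex_inv)

lemma subgroup_exponent_kernel: "subgroup exponent_kernel G"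
  by (rule subgroupI) (auto simp: exponent_kernel_def ex_mult ex_inv ex_one intro: exI[of _ \<one>])

lemma fermat_generators_subset: "fermat_generators G k n x \<subseteq> exponent_kernel"
  unfolding fermat_generators_def exponent_kernel_def
  using x_closed commutator_closed power_product_closed
  by (auto simp: ex_nat_pow ex_gen ex_conj ex_commutator)

text \<open>Stating the generation result for a homomorphism into any commutative group, instead of
  for the abelianization of the kernel, allows its direct use for \<open>deck_class\<close>.\<close>

lemma hom_exponent_kernel_subset:
  assumes A: "comm_group A" and f: "f \<in> hom (G\<lparr>carrier := exponent_kernel\<rparr>) A"
  shows "f ` exponent_kernel \<subseteq> generate A (f ` fermat_generators G k n x)"
proof -
  interpret A: comm_group A by (rule A)
  let ?N = exponent_kernel
  let ?F = "fermat_generators G k n x"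
  interpret N: group "G\<lparr>carrier := ?N\<rparr>"
    by (rule subgroup_imp_group[OF subgroup_exponent_kernel])
  interpret f: group_hom "G\<lparr>carrier := ?N\<rparr>" A f
    by (unfold_locales) (rule f)
  have NG: "a \<in> carrier G" if "a \<in> ?N" for a
    using that by (simp add: exponent_kernel_def)
  have f_mult: "f (a \<otimes> b) = f a \<otimes>\<^bsub>A\<^esub> f b" if "a \<in> ?N" "b \<in> ?N" for a b
    using f.hom_mult that by simp
  have f_closed: "f a \<in> carrier A" if "a \<in> ?N" for a
    using f.hom_closed that by simp
  have f_inv: "f (inv\<^bsub>G\<^esub> a) = inv\<^bsub>A\<^esub> f a" if "a \<in> ?N" for a
    using f.hom_inv[of a] that m_inv_consistent[OF subgroup_exponent_kernel that] by (simp del: f.hom_inv)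
  have f_one: "f \<one> = \<one>\<^bsub>A\<^esub>"
    using f.hom_one by simp
  define H where "H = generate A (f ` ?F)"
  have H: "subgroup H A"
    unfolding H_def using fermat_generators_subset f_closed by (intro A.generate_is_subgroup) auto
  define M where "M = {w \<in> ?N. f w \<in> H}"
  have N_sub: "subgroup ?N G" by (rule subgroup_exponent_kernel)
  have M: "subgroup M G"
  proof (rule subgroupI)
    show "M \<noteq> {}" 
      using subgroup.one_closed[OF N_sub] subgroup.one_closed[OF H] f_one by (auto simp: M_def intro!: exI[of _ \<one>])
  qed (auto simp: M_def NG f_mult f_inv subgroup.m_closed[OF N_sub] subgroup.m_inv_closed[OF N_sub]
      subgroup.m_closed[OF H] subgroup.m_inv_closed[OF H])
  have F_M: "?F \<subseteq> M"
    using fermat_generators_subset by (auto simp: M_def H_def intro: generate.incl)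
  have conj_M: "s \<otimes> c \<otimes> inv s \<in> M" if s: "s \<in> ?N" and c: "c \<in> M" for s c
  proof -
    have c': "c \<in> ?N" "f c \<in> H" using c by (auto simp: M_def)
    have "f (s \<otimes> c \<otimes> inv s) = f s \<otimes>\<^bsub>A\<^esub> f c \<otimes>\<^bsub>A\<^esub> inv\<^bsub>A\<^esub> f s"
      using s c' by (simp add: f_mult f_inv subgroup.m_closed[OF N_sub] subgroup.m_inv_closed[OF N_sub])
    also have "\<dots> = f c"
      using f_closed[OF s] f_closed[OF c'(1)] by (simp add: A.m_comm[of "f s" "f c"] A.m_assoc)
    finally show ?thesis
      using s c' by (simp add: M_def subgroup.m_closed[OF N_sub] subgroup.m_inv_closed[OF N_sub])
  qed
  \<comment> \<open>So far \<open>M\<close> is known to be invariant under conjugation by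
    \<open>?N\<close> only. Its core is normal in \<open>G\<close>, so a quotient can be
    formed.\<close>
  define K where "K = {y \<in> carrier G. \<forall>h\<in>carrier G. h \<otimes> y \<otimes> inv h \<in> M}"
  have K: "K \<lhd> G" unfolding K_def by (rule subgroup_core[OF M])
  have K_M: "K \<subseteq> M" unfolding K_def by (force dest: bspec[of _ _ \<one>])
  have comm_K': "group_commutator G (x j) (x l) \<in> K" if jl: "1 \<le> j" "j < l" "l \<le> n" for j l
  proof -
    have c: "x j \<in> carrier G" "x l \<in> carrier G" using jl x_closed by auto
    have "h \<otimes> group_commutator G (x j) (x l) \<otimes> inv h \<in> M" if h: "h \<in> carrier G" for h
    proof -
      \<comment> \<open>Reducing the exponents of \<open>h\<close> modulo \<open>k\<close> puts
        \<open>h \<otimes> inv P\<close> into \<open>?N\<close> and keeps \<open>g d\<close> within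
        the range of the listed generators. Conjugation by \<open>h\<close> is then conjugation by
        \<open>P\<close> followed by one from \<open>?N\<close>.\<close>
      define g where "g d = nat (ex d h mod int k)" for d
      define P where "P = power_product G n x g"
      have P: "P \<in> carrier G" by (simp add: P_def power_product_closed)
      have gb: "g d \<le> k - 1" for d
      proof -
        have "ex d h mod int k < int k" using k_pos by simp
        then show ?thesis unfolding g_def using k_pos by linarith
      qed
      have "int k dvd ex d (h \<otimes> inv P)" if "d \<in> {1..n}" for d
      proof -
        have "ex d (h \<otimes> inv P) = ex d h - ex d h mod int k"
          using that h P k_pos by (simp add: ex_mult ex_inv P_def[symmetric] ex_power_product[OF that, of g, folded P_def] g_def)
        then show ?thesis by (simp add: minus_mod_eq_mult_div)
      qed
      then have s: "h \<otimes> inv P \<in> ?N" using h P by (simp add: exponent_kernel_def)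
      have "P \<otimes> group_commutator G (x j) (x l) \<otimes> inv P \<in> ?F"
        unfolding fermat_generators_def P_def using jl gb by blast
      then have "(h \<otimes> inv P) \<otimes> (P \<otimes> group_commutator G (x j) (x l) \<otimes> inv P) \<otimes> inv (h \<otimes> inv P) \<in> M"
        using conj_M[OF s] F_M by blast
      moreover have "(h \<otimes> inv P) \<otimes> (P \<otimes> z \<otimes> inv P) \<otimes> inv (h \<otimes> inv P) = h \<otimes> z \<otimes> inv h"
        if z: "z \<in> carrier G" for z
      proof -
        have "inv P \<otimes> (P \<otimes> y) = y" if "y \<in> carrier G" for y
          using P that by (simp add: m_assoc[symmetric])
        then show ?thesis using z h P by (simp add: inv_mult_group m_assoc)
      qed
      ultimately show ?thesis using c commutator_closed by simp
    qed
    then show ?thesis using c commutator_closed by (simp add: K_def)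
  qed
  \<comment> \<open>The generators commute in this quotient, so the image of a word depends only on
    its exponent sums; this takes the place of collecting letters in words.\<close>
  let ?Q = "G Mod K"
  interpret Q: group ?Q by (rule normal.factorgroup_is_group[OF K])
  define \<pi> where "\<pi> = (\<lambda>a. K #> a)"
  interpret \<pi>: group_hom G ?Q \<pi>
    unfolding \<pi>_def group_hom_def group_hom_axioms_def
    using normal.r_coset_hom_Mod[OF K] Q.is_group is_group by simp
  have K_sub: "subgroup K G" using K by (rule normal_imp_subgroup)
  have \<pi>_eq: "\<pi> a = \<pi> b \<longleftrightarrow> a \<otimes> inv b \<in> K" if "a \<in> carrier G" "b \<in> carrier G" for a b
    unfolding \<pi>_def using that K_sub
    by (metis coset_join1 coset_join2 coset_mult_inv1 coset_mult_inv2 inv_closed m_closed subgroup.subset)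
  have comm_gen: "\<pi> (x j) \<otimes>\<^bsub>?Q\<^esub> \<pi> (x l) = \<pi> (x l) \<otimes>\<^bsub>?Q\<^esub> \<pi> (x j)"
    if jl: "j \<in> {1..n}" "l \<in> {1..n}" for j l
  proof -
    have *: "\<pi> (x j) \<otimes>\<^bsub>?Q\<^esub> \<pi> (x l) = \<pi> (x l) \<otimes>\<^bsub>?Q\<^esub> \<pi> (x j)"
      if "1 \<le> j" "j < l" "l \<le> n" for j l
    proof -
      have c: "x j \<in> carrier G" "x l \<in> carrier G" using that x_closed by auto
      have "group_commutator G (x j) (x l) = (x j \<otimes> x l) \<otimes> inv (x l \<otimes> x j)"
        using c by (simp add: group_commutator_def inv_mult_group m_assoc)
      then have "\<pi> (x j \<otimes> x l) = \<pi> (x l \<otimes> x j)"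
        using \<pi>_eq[of "x j \<otimes> x l" "x l \<otimes> x j"] c comm_K'[OF that] by simp
      then show ?thesis using c by simp
    qed
    show ?thesis
      using *[of j l] *[of l j] jl by (cases j l rule: linorder_cases) auto
  qed
  have "\<pi> ` carrier G = carrier ?Q"
    by (auto simp: \<pi>_def carrier_FactGroup)
  then have gen_Q: "generate ?Q (\<pi> ` (x ` {1..n})) = carrier ?Q"
    using \<pi>.generate_img[of "x ` {1..n}"] image_subsetI[of "{1..n}" x "carrier G"] x_closed generated
    by (metis (no_types))
  interpret Q: comm_group ?Q
    by (rule Q.comm_group_if_generators_commute[OF _ gen_Q]) (use comm_gen x_closed in auto)
  define ds where "ds = [1..<Suc n]"
  have ds: "set ds = {1..n}" "distinct ds" by (auto simp: ds_def)
  let ?e = "\<lambda>w d. ex d w"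
  have \<pi>x: "(\<pi> \<circ> x) d \<in> carrier ?Q" if "d \<in> set ds" for d
    using that x_closed[of d] ds by auto
  have cong: "int_power_product ?Q (\<pi> \<circ> x) a ds = int_power_product ?Q (\<pi> \<circ> x) b ds"
    if "\<And>d. d \<in> {1..n} \<Longrightarrow> a d = b d" for a b
    unfolding int_power_product_def by (rule foldr_cong) (use that ds in auto)
  \<comment> \<open>Both sides are homomorphisms in \<open>w\<close>, the right one because
    \<open>?Q\<close> is commutative, and they agree on the generators.\<close>
  have main: "\<pi> w = int_power_product ?Q (\<pi> \<circ> x) (?e w) ds" if "w \<in> generate G (x ` {1..n})" for w
    using that
  proof (induction rule: generate.induct)
    case one
    have "int_power_product ?Q (\<pi> \<circ> x) (?e \<one>) ds = int_power_product ?Q (\<pi> \<circ> x) (\<lambda>d. 0) ds"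
      by (rule cong) (use ex_one in auto)
    also have "\<dots> = \<one>\<^bsub>?Q\<^esub>" by (rule Q.int_power_product_zero)
    finally show ?case by (simp only: \<pi>.hom_one)
  next
    case (incl h)
    then obtain j where j: "j \<in> {1..n}" "h = x j" by blast
    have "int_power_product ?Q (\<pi> \<circ> x) (?e h) ds = int_power_product ?Q (\<pi> \<circ> x) (\<lambda>d. if d = j then 1 else 0) ds"
      by (rule cong) (use j ex_gen in auto)
    also have "\<dots> = \<pi> h"
      using Q.int_power_product_delta[of ds j "\<pi> \<circ> x"] \<pi>x j ds by auto
    finally show ?case by (rule sym)
  next
    case (inv h)
    then obtain j where j: "j \<in> {1..n}" "h = x j" by blast
    have h: "h \<in> carrier G" using j x_closed by simp
    have "int_power_product ?Q (\<pi> \<circ> x) (?e (inv h)) ds = int_power_product ?Q (\<pi> \<circ> x) (\<lambda>d. - (if d = j then 1 else 0)) ds"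
      by (rule cong) (use j h ex_gen ex_inv in auto)
    also have "\<dots> = inv\<^bsub>?Q\<^esub> \<pi> h"
      using Q.int_power_product_neg[of ds "\<pi> \<circ> x" "\<lambda>d. if d = j then 1 else 0"]
        Q.int_power_product_delta[of ds j "\<pi> \<circ> x"] \<pi>x j ds by auto
    finally show ?case using h by (simp only: \<pi>.hom_inv)
  next
    case (eng h1 h2)
    have c: "h1 \<in> carrier G" "h2 \<in> carrier G" using eng generated by auto
    have "int_power_product ?Q (\<pi> \<circ> x) (?e (h1 \<otimes> h2)) ds = int_power_product ?Q (\<pi> \<circ> x) (\<lambda>d. ?e h1 d + ?e h2 d) ds"
      by (rule cong) (use c ex_mult in auto)
    also have "\<dots> = \<pi> h1 \<otimes>\<^bsub>?Q\<^esub> \<pi> h2"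
      unfolding eng.IH by (rule Q.int_power_product_add[OF \<pi>x])
    finally show ?case using c by (simp only: \<pi>.hom_mult)
  qed
  have "w \<in> M" if w: "w \<in> ?N" for w
  proof -
    have wG: "w \<in> carrier G" using w NG by simp
    \<comment> \<open>The ordered word with the exponent sums of \<open>w\<close>: it equals
      \<open>w\<close> modulo \<open>K\<close>, and each of its factors is a power of some
      \<open>x d [^] k\<close>.\<close>
    define y where "y = int_power_product G x (?e w) ds"
    have y: "y \<in> carrier G" unfolding y_def using ds by (intro int_power_product_closed x_closed) auto
    have "\<pi> w = \<pi> y"
      using main[of w] wG generated \<pi>.hom_int_power_product[of ds x "?e w"] x_closed ds by (simp add: y_def)
    then have wy: "w \<otimes> inv y \<in> M" using \<pi>_eq[OF wG y] K_M by auto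
    have "y \<in> M"
      unfolding y_def
    proof (rule int_power_product_subgroup[OF M])
      fix d assume "d \<in> set ds"
      then have d: "d \<in> {1..n}" using ds by auto
      then have "int k dvd ex d w" using w by (simp add: exponent_kernel_def)
      then obtain b where b: "ex d w = int k * b" by (rule dvdE)
      have "x d [^] k \<in> M" using F_M d by (auto simp: fermat_generators_def)
      then have "(x d [^] k) [^] b \<in> M" by (rule subgroup_int_pow_closed[OF M])
      then show "x d [^] ex d w \<in> M"
        using x_closed[OF d] by (simp add: b int_pow_pow int_pow_int[symmetric])
    qed
    then have "w \<otimes> inv y \<otimes> y \<in> M" using wy subgroup.m_closed[OF M] by blast
    then show ?thesis using wG y by (simp add: m_assoc)
  qed
  then show ?thesis by (auto simp: M_def H_def)
qed

end

section \<open>Singular 1-chains of paths\<close>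

text \<open>\<open>simply_connected\<close> speaks of free homotopies of loops. The base point
  therefore moves, along \<open>h (s, 0)\<close>, and the last clause records that every stage is
  closed.\<close>

lemma simply_connected_null_homotopy:
  fixes U :: "'u::topological_space set"
  assumes "simply_connected U" "path l" "path_image l \<subseteq> U" "l 0 = l 1"
  obtains h :: "real \<times> real \<Rightarrow> 'u" where "continuous_on ({0..1} \<times> {0..1}) h"
    "h \<in> ({0..1} \<times> {0..1}) \<rightarrow> U" "\<And>t. t \<in> {0..1} \<Longrightarrow> h (0, t) = l t"
    "\<And>t. t \<in> {0..1} \<Longrightarrow> h (1, t) = l 0" "\<And>s. s \<in> {0..1} \<Longrightarrow> h (s, 1) = h (s, 0)"
proof -
  have "l 0 \<in> U" using assms(3) by (auto simp: path_image_def)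
  then have "path (\<lambda>_. l 0) \<and> path_image (\<lambda>_::real. l 0) \<subseteq> U"
    by (auto simp: path_def path_image_def)
  then have "homotopic_loops U l (\<lambda>_. l 0)"
    using assms unfolding simply_connected_def
    by (metis (no_types, lifting) pathfinish_def pathstart_def)
  then show ?thesis
    using that unfolding homotopic_loops by (auto simp: pathfinish_def pathstart_def)
qed

text \<open>A free homotopy between two constant loops traces out a path between the two
  points.\<close>

lemma simply_connected_path_connected:
  fixes U :: "'u::topological_space set"
  assumes "simply_connected U"
  shows "path_connected U"
  unfolding path_connected_def
proof (intro ballI)
  fix a b assume ab: "a \<in> U" "b \<in> U"
  have c: "path (\<lambda>_. x) \<and> path_image (\<lambda>_::real. x) \<subseteq> U \<and> pathfinish (\<lambda>_. x) = pathstart (\<lambda>_. x)"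
    if "x \<in> U" for x
    using that by (auto simp: path_def path_image_def pathstart_def pathfinish_def)
  have "homotopic_loops U (\<lambda>_. a) (\<lambda>_. b)"
    using assms c[OF ab(1)] c[OF ab(2)] unfolding simply_connected_def by blast
  then obtain h :: "real \<times> real \<Rightarrow> 'u" where h: "continuous_on ({0..1} \<times> {0..1}) h"
      "h \<in> ({0..1} \<times> {0..1}) \<rightarrow> U"
    and h0: "\<And>t. t \<in> {0..1} \<Longrightarrow> h (0, t) = a" and h1: "\<And>t. t \<in> {0..1} \<Longrightarrow> h (1, t) = b"
    unfolding homotopic_loops by auto
  have "path (\<lambda>s. h (s, 0))"
    unfolding path_def by (rule continuous_on_compose2[OF h(1)]) (auto intro!: continuous_intros)
  then show "\<exists>g. path g \<and> path_image g \<subseteq> U \<and> pathstart g = a \<and> pathfinish g = b"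
    using h(2) h0[of 0] h1[of 0]
    by (intro exI[of _ "\<lambda>s. h (s, 0)"]) (auto simp: path_image_def pathstart_def pathfinish_def)
qed

text \<open>The parametrisation is that of \<open>loop_class\<close>, now also for paths that do not
  close up.\<close>

definition path_simplex :: "(real \<Rightarrow> 'a) \<Rightarrow> (nat \<Rightarrow> real) \<Rightarrow> 'a" where
  "path_simplex \<gamma> = restrict (\<lambda>t. \<gamma> (t 1)) (standard_simplex 1)"

definition point_simplex :: "'a \<Rightarrow> (nat \<Rightarrow> real) \<Rightarrow> 'a" where
  "point_simplex a = restrict (\<lambda>_. a) (standard_simplex 0)"

definition path_chain :: "(real \<Rightarrow> 'a) \<Rightarrow> 'a chain" where
  "path_chain \<gamma> = frag_of (path_simplex \<gamma>)"

lemma loop_class_path_chain: "loop_class X \<gamma> = homologous_rel_set 1 X {} (path_chain \<gamma>)"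
  by (simp add: loop_class_def path_chain_def path_simplex_def)

lemma standard_simplex_1_coord: "t \<in> standard_simplex 1 \<Longrightarrow> t 1 \<in> {0..1}"
  by (simp add: standard_simplex_def)

lemma standard_simplex_1_eq:
  assumes "t \<in> standard_simplex 1"
  shows "t = (\<lambda>i. if i = 0 then 1 - t 1 else if i = 1 then t 1 else 0)"
proof
  fix i
  from assms show "t i = (if i = 0 then 1 - t 1 else if i = 1 then t 1 else 0)"
    by (cases "i > 1"; cases "i = 0"; cases "i = 1") (auto simp: standard_simplex_def)
qed

lemma path_simplex_cong:
  assumes "\<And>s. s \<in> {0..1} \<Longrightarrow> \<alpha> s = \<beta> s"
  shows "path_simplex \<alpha> = path_simplex \<beta>"
  unfolding path_simplex_def using assms standard_simplex_1_coord by (auto intro!: restrict_ext)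

lemma path_chain_cong:
  "(\<And>s. s \<in> {0..1} \<Longrightarrow> \<alpha> s = \<beta> s) \<Longrightarrow> path_chain \<alpha> = path_chain \<beta>"
  unfolding path_chain_def by (rule arg_cong[OF path_simplex_cong])

lemma singular_simplex_path_simplex:
  assumes "pathin X \<gamma>"
  shows "singular_simplex 1 X (path_simplex \<gamma>)"
proof -
  have proj: "continuous_map (subtopology (powertop_real UNIV) (standard_simplex 1))
      (top_of_set {0..1}) (\<lambda>t. t 1)"
    unfolding continuous_map_in_subtopology
    by (auto intro!: continuous_map_from_subtopology continuous_map_product_projection
        simp: standard_simplex_def)
  have "continuous_map (subtopology (powertop_real UNIV) (standard_simplex 1)) X (\<lambda>t. \<gamma> (t 1))"
    using continuous_map_compose[OF proj, of X \<gamma>] assms(1) by (simp add: pathin_def o_def)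
  then show ?thesis
    unfolding singular_simplex_def path_simplex_def
    by (auto elim!: continuous_map_eq simp: topspace_standard_simplex)
qed

text \<open>This reduces statements on 1-simplices to paths; the clause on images transfers
  smallness with respect to an open cover.\<close>

lemma singular_simplex_1_path:
  assumes "singular_simplex 1 X f"
  obtains \<gamma> where "pathin X \<gamma>" "f = path_simplex \<gamma>" "\<gamma> ` {0..1} = f ` standard_simplex 1"
proof -
  \<comment> \<open>The inverse of the barycentric coordinate \<open>t 1\<close> on the standard
    1-simplex.\<close>
  define v where "v s = (\<lambda>i::nat. if i = 0 then 1 - s else if i = 1 then s else (0::real))" for s
  have v: "v s \<in> standard_simplex 1" if "s \<in> {0..1}" for s
    using that by (auto simp: v_def standard_simplex_def)
  have "continuous_on {0..1} (\<lambda>s. v s i)" for i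
    by (cases "i = 0"; cases "i = 1") (auto simp: v_def intro!: continuous_intros)
  then have "continuous_map (top_of_set {0..1}) (powertop_real UNIV) v"
    unfolding continuous_map_componentwise_UNIV by simp
  then have "continuous_map (top_of_set {0..1}) (subtopology (powertop_real UNIV) (standard_simplex 1)) v"
    using v by (auto simp: continuous_map_in_subtopology)
  then have pin: "pathin X (f \<circ> v)"
    unfolding pathin_def using assms continuous_map_compose by (auto simp: singular_simplex_def)
  have vt: "v (t 1) = t" if "t \<in> standard_simplex 1" for t
    using standard_simplex_1_eq[OF that] unfolding v_def by (rule sym)
  have "f = path_simplex (f \<circ> v)"
  proof
    show "f t = path_simplex (f \<circ> v) t" for t
      using assms vt[of t]
      by (cases "t \<in> standard_simplex 1")
         (simp_all add: path_simplex_def singular_simplex_def extensional_def del: One_nat_def)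
  qed
  moreover have "(f \<circ> v) ` {0..1} = f ` standard_simplex 1"
    using v vt standard_simplex_1_coord by (force simp: image_iff)
  ultimately show ?thesis using that pin by blast
qed

lemma boundary_path_chain:
  "chain_boundary 1 (path_chain \<gamma>) = frag_of (point_simplex (\<gamma> 1)) - frag_of (point_simplex (\<gamma> 0))"
proof -
  have "singular_face 1 0 (path_simplex \<gamma>) = point_simplex (\<gamma> 1)"
    "singular_face 1 1 (path_simplex \<gamma>) = point_simplex (\<gamma> 0)"
    by (auto simp: singular_face_def fun_eq_iff standard_simplex_0 restrict_def point_simplex_def
        path_simplex_def simplical_face_def standard_simplex_def)
  then show ?thesis
    by (simp add: path_chain_def chain_boundary_of)
qed

lemma chain_map_path_chain: "chain_map 1 f (path_chain \<gamma>) = path_chain (f \<circ> \<gamma>)"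
  by (auto simp: path_chain_def simplex_map_def path_simplex_def o_def intro!: arg_cong[of _ _ frag_of])

lemma singular_chain_path_chain: "pathin X \<gamma> \<Longrightarrow> singular_chain 1 X (path_chain \<gamma>)"
  unfolding path_chain_def singular_chain_of by (rule singular_simplex_path_simplex)

text \<open>Reduced homology of a contractible space vanishes, and in degree 1 it is ordinary
  homology.\<close>

lemma contractible_cycle_boundary:
  assumes "contractible_space X" "singular_relcycle 1 X {} c"
  shows "singular_relboundary 1 X {} c"
proof -
  have "trivial_group (reduced_homology_group 1 X)"
    by (rule trivial_reduced_homology_group_contractible_space[OF assms(1)])
  then have "trivial_group (homology_group (int 1) X)"
    by (simp add: un_reduced_homology_group)
  moreover have "homologous_rel_set 1 X {} c \<in> carrier (homology_group (int 1) X)"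
    using assms(2) by (subst carrier_relative_homology_group) blast
  ultimately have "homologous_rel_set 1 X {} c = singular_relboundary_set 1 X {}"
    using one_relative_homology_group[of 1 X "{}"] by (metis singletonD trivial_group_def)
  then show ?thesis
    by (simp add: homologous_rel_set_eq_relboundary)
qed

text \<open>A constant path is a nonzero chain. It bounds because the three faces of a constant
  2-simplex enter with signs +, -, +; the proof works in the one-point subspace.\<close>

lemma path_chain_const_boundary:
  assumes "a \<in> topspace X"
  shows "singular_relboundary 1 X {} (path_chain (\<lambda>_. a))"
proof -
  let ?Y = "subtopology X {a}"
  have "topspace ?Y = {a}" using assms by auto
  moreover have "singular_chain 1 ?Y (path_chain (\<lambda>_. a))"
    by (rule singular_chain_path_chain) (use assms in \<open>simp add: pathin_def\<close>)
  ultimately have "singular_relboundary 1 ?Y {} (path_chain (\<lambda>_. a))"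
    by (simp add: singular_boundary_singleton)
  then show ?thesis
    using singular_boundary_mono[of "{a}" "topspace X" 1 X] assms by simp
qed

text \<open>
  A free null homotopy of the loop made of the three paths is a map of the unit square, in which
  every cycle bounds.
\<close>

lemma triangle_boundary:
  fixes U :: "'u::topological_space set"
  assumes U: "simply_connected U"
    and \<alpha>: "path \<alpha>" "path_image \<alpha> \<subseteq> U" and \<beta>: "path \<beta>" "path_image \<beta> \<subseteq> U"
    and \<gamma>: "path \<gamma>" "path_image \<gamma> \<subseteq> U"
    and ends: "pathfinish \<alpha> = pathstart \<beta>" "pathstart \<alpha> = pathstart \<gamma>" "pathfinish \<beta> = pathfinish \<gamma>"
  shows "singular_relboundary 1 (top_of_set U) {} (path_chain \<alpha> + path_chain \<beta> - path_chain \<gamma>)"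
proof -
  define l where "l = (\<alpha> +++ \<beta>) +++ reversepath \<gamma>"
  define a where "a = l 0"
  have l: "path l" "path_image l \<subseteq> U" "l 0 = l 1"
    unfolding l_def using assms
    by (simp_all add: path_image_join le_supI) (simp add: joinpaths_def reversepath_def pathstart_def)
  have aU: "a \<in> U" using l(2) by (auto simp: a_def path_image_def)
  obtain h :: "real \<times> real \<Rightarrow> 'u" where h: "continuous_on ({0..1} \<times> {0..1}) h"
      "h \<in> ({0..1} \<times> {0..1}) \<rightarrow> U"
    and h0: "\<And>t. t \<in> {0..1} \<Longrightarrow> h (0, t) = l t" and h1: "\<And>t. t \<in> {0..1} \<Longrightarrow> h (1, t) = a"
    and hloop: "\<And>s. s \<in> {0..1} \<Longrightarrow> h (s, 1) = h (s, 0)"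
    using simply_connected_null_homotopy[OF U l] unfolding a_def by metis
  let ?Q = "{0..1::real} \<times> {0..1::real}"
  have "contractible ?Q"
    by (intro convex_imp_contractible convex_Times) auto
  then have cQ: "contractible_space (top_of_set ?Q)"
    by simp
  have hQ: "continuous_map (top_of_set ?Q) (top_of_set U) h"
    using h by (simp add: Pi_iff image_subset_iff)
  have pq: "pathin (top_of_set ?Q) \<delta>" if "continuous_on {0..1} \<delta>" "\<delta> \<in> {0..1} \<rightarrow> ?Q" for \<delta>
    using that by (simp add: pathin_def Pi_iff image_subset_iff)
  \<comment> \<open>The first three edges divide the left side of the square at 1/4 and 1/2, where
    \<open>l\<close> passes from \<alpha> to \<beta> and from \<beta> to the reverse of \<gamma>.
    The other three are the top, right and bottom sides. Under \<open>h\<close>, top and bottom have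
    the same image, since the stages are closed, and cancel; the right side becomes the point
    \<open>a\<close>.\<close>
  define e where "e = [\<lambda>t. (0, t / 4), \<lambda>t. (0, 1/4 + t / 4), \<lambda>t. (0::real, 1 - t / 2),
     \<lambda>t. (t, 1), \<lambda>t. (1, t), \<lambda>t::real. (t, 0::real)]"
  define z where "z = path_chain (e!0) + path_chain (e!1) - path_chain (e!2)
     + path_chain (e!3) - path_chain (e!4) - path_chain (e!5)"
  have "singular_relcycle 1 (top_of_set ?Q) {} z"
    unfolding singular_cycle
  proof
    show "singular_chain 1 (top_of_set ?Q) z"
      unfolding z_def
      by (intro singular_chain_add singular_chain_diff singular_chain_path_chain pq)
         (auto simp: e_def intro!: continuous_intros)
    show "chain_boundary 1 z = 0"
      unfolding z_def chain_boundary_add chain_boundary_diff boundary_path_chain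
      by (simp add: e_def)
  qed
  then have "singular_relboundary 1 (top_of_set ?Q) {} z"
    by (rule contractible_cycle_boundary[OF cQ])
  then have b: "singular_relboundary 1 (top_of_set U) {} (chain_map 1 h z)"
    by (rule singular_relboundary_chain_map[OF _ hQ]) simp
  have eqs: "path_chain (h \<circ> (e!0)) = path_chain \<alpha>" "path_chain (h \<circ> (e!1)) = path_chain \<beta>"
    "path_chain (h \<circ> (e!2)) = path_chain \<gamma>" "path_chain (h \<circ> (e!3)) = path_chain (h \<circ> (e!5))"
    "path_chain (h \<circ> (e!4)) = path_chain (\<lambda>_. a)"
    using ends
    by (auto intro!: path_chain_cong simp: e_def h0 h1 hloop l_def joinpaths_def reversepath_def
        pathfinish_def pathstart_def field_simps)
  have "chain_map 1 h z = path_chain \<alpha> + path_chain \<beta> - path_chain \<gamma> - path_chain (\<lambda>_. a)"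
    unfolding z_def chain_map_add chain_map_diff chain_map_path_chain eqs by simp
  with b path_chain_const_boundary[of a "top_of_set U"] aU
  have "singular_relboundary 1 (top_of_set U) {}
     ((path_chain \<alpha> + path_chain \<beta> - path_chain \<gamma> - path_chain (\<lambda>_. a)) + path_chain (\<lambda>_. a))"
    by (intro singular_relboundary_add) auto
  then show ?thesis by simp
qed

lemma triangle_boundary_image:
  fixes U :: "'u::topological_space set"
  assumes "simply_connected U" "continuous_map (top_of_set U) X f"
    and "path \<alpha>" "path_image \<alpha> \<subseteq> U" "path \<beta>" "path_image \<beta> \<subseteq> U" "path \<gamma>" "path_image \<gamma> \<subseteq> U"
    and "pathfinish \<alpha> = pathstart \<beta>" "pathstart \<alpha> = pathstart \<gamma>" "pathfinish \<beta> = pathfinish \<gamma>"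
  shows "singular_relboundary 1 X {} (path_chain (f \<circ> \<alpha>) + path_chain (f \<circ> \<beta>) - path_chain (f \<circ> \<gamma>))"
  using singular_relboundary_chain_map[OF triangle_boundary[OF assms(1) assms(3-11)] assms(2), of "{}"]
  unfolding chain_map_add chain_map_diff chain_map_path_chain by simp

text \<open>Working with cycles instead of classes allows relations to be verified as identities in
  the free abelian group of chains, even if the single summands there are not cycles.\<close>

definition class_chains :: "'a topology \<Rightarrow> 'a chain set set \<Rightarrow> 'a chain set" where
  "class_chains X H = {c. singular_relcycle 1 X {} c \<and> homologous_rel_set 1 X {} c \<in> H}"

lemma mult_homology_class:
  assumes "singular_relcycle p X {} a" "singular_relcycle p X {} b"
  shows "homologous_rel_set p X {} a \<otimes>\<^bsub>homology_group (int p) X\<^esub> homologous_rel_set p X {} b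
     = homologous_rel_set p X {} (a + b)"
proof -
  have *: "a' + b' \<in> homologous_rel_set p X {} (a + b)"
    if "homologous_rel p X {} a a'" "homologous_rel p X {} b b'" for a' b'
    using that homologous_rel_add by fastforce
  have **: "\<exists>a'. homologous_rel p X {} a a' \<and> (\<exists>b'. homologous_rel p X {} b b' \<and> c = a' + b')"
    if "homologous_rel p X {} (a + b) c" for c
    by (rule exI[of _ a]) (use that in \<open>auto simp: homologous_rel_def algebra_simps intro!: exI[of _ "c - a"]\<close>)
  show ?thesis
    unfolding mult_relative_homology_group using * ** by blast
qed

lemma mult_homology_class_1:
  assumes "singular_relcycle 1 X {} a" "singular_relcycle 1 X {} b"
  shows "homologous_rel_set 1 X {} a \<otimes>\<^bsub>homology_group 1 X\<^esub> homologous_rel_set 1 X {} b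
     = homologous_rel_set 1 X {} (a + b)"
  using mult_homology_class[OF assms] by (simp only: of_nat_1)

lemma class_chains_add:
  assumes "subgroup H (homology_group 1 X)" "a \<in> class_chains X H" "b \<in> class_chains X H"
  shows "a + b \<in> class_chains X H"
proof -
  have cyc: "singular_relcycle 1 X {} a" "singular_relcycle 1 X {} b"
    using assms by (simp_all add: class_chains_def)
  have "homologous_rel_set 1 X {} a \<otimes>\<^bsub>homology_group 1 X\<^esub> homologous_rel_set 1 X {} b \<in> H"
    by (rule subgroup.m_closed[OF assms(1)]) (use assms in \<open>simp_all add: class_chains_def\<close>)
  then show ?thesis
    unfolding class_chains_def mult_homology_class_1[OF cyc] using singular_relcycle_add[OF cyc] by simp
qed

lemma class_chains_boundary:
  assumes "subgroup H (homology_group 1 X)" "singular_relboundary 1 X {} c"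
  shows "c \<in> class_chains X H"
proof -
  have "homologous_rel_set 1 X {} c = singular_relboundary_set 1 X {}"
    using assms(2) by (simp add: homologous_rel_set_eq_relboundary)
  then have "homologous_rel_set 1 X {} c \<in> H"
    using subgroup.one_closed[OF assms(1)] one_relative_homology_group[of 1 X "{}"] by simp
  then show ?thesis
    using assms(2) singular_relboundary_imp_relcycle by (auto simp: class_chains_def)
qed

lemma class_chains_minus:
  assumes H: "subgroup H (homology_group 1 X)" and a: "a \<in> class_chains X H"
  shows "- a \<in> class_chains X H"
proof -
  interpret group "homology_group 1 X" by simp
  let ?c = "\<lambda>x. homologous_rel_set 1 X {} x"
  have cyc: "singular_relcycle 1 X {} a" "singular_relcycle 1 X {} (- a)"
    using a by (auto simp: class_chains_def singular_relcycle_minus)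
  then have car: "?c a \<in> carrier (homology_group 1 X)" "?c (- a) \<in> carrier (homology_group 1 X)"
    using carrier_relative_homology_group[of 1 X "{}"] by auto
  have "?c (- a) \<otimes>\<^bsub>homology_group 1 X\<^esub> ?c a = \<one>\<^bsub>homology_group 1 X\<^esub>"
    using mult_homology_class_1[OF cyc(2,1)] one_relative_homology_group[of 1 X "{}"]
      homologous_rel_set_eq_relboundary[of 1 X "{}" "0 :: 'a chain"] by simp
  then have "?c (- a) = inv\<^bsub>homology_group 1 X\<^esub> ?c a"
    using car by (metis inv_equality)
  then show ?thesis
    using cyc(2) a subgroup.m_inv_closed[OF H] by (simp add: class_chains_def)
qed

lemma class_chains_diff:
  assumes "subgroup H (homology_group 1 X)" "a \<in> class_chains X H" "b \<in> class_chains X H"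
  shows "a - b \<in> class_chains X H"
  using class_chains_add[OF assms(1,2) class_chains_minus[OF assms(1,3)]] by simp

text \<open>
  The correction \<open>e\<close> is extended linearly to 0-chains, so it vanishes on the boundary of a cycle.
\<close>

lemma homology_group_1_from_small_paths:
  assumes H: "subgroup H (homology_group 1 X)"
    and opn: "\<And>V. V \<in> \<C> \<Longrightarrow> openin X V" and cov: "topspace X \<subseteq> \<Union>\<C>"
    and small: "\<And>\<gamma> V. V \<in> \<C> \<Longrightarrow> pathin X \<gamma> \<Longrightarrow> \<gamma> ` {0..1} \<subseteq> V \<Longrightarrow>
       path_chain \<gamma> + e (\<gamma> 0) - e (\<gamma> 1) \<in> class_chains X H"
  shows "H = carrier (homology_group 1 X)"
proof
  show "H \<subseteq> carrier (homology_group 1 X)" by (rule subgroup.subset[OF H])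
next
  show "carrier (homology_group 1 X) \<subseteq> H"
  proof
    fix x assume "x \<in> carrier (homology_group 1 X)"
    then obtain c where c: "singular_relcycle 1 X {} c" "x = homologous_rel_set 1 X {} c"
      using carrier_relative_homology_group[of 1 X "{}"] by auto
    obtain c' where c': "singular_relcycle 1 X {} c'" "homologous_rel 1 X {} c c'"
      and c'_small: "\<And>f. f \<in> Poly_Mapping.keys c' \<Longrightarrow> \<exists>V\<in>\<C>. f \<in> standard_simplex 1 \<rightarrow> V"
      using small_homologous_rel_relcycle_exists[OF opn cov c(1)] by blast
    \<comment> \<open>A singular 0-simplex is a function on a one-point simplex; it is evaluated at
      that point to obtain the point of \<open>X\<close> it represents.\<close>
    define e0 where "e0 f = e (f (\<lambda>j. if j = 0 then 1 else 0))" for f :: "(nat \<Rightarrow> real) \<Rightarrow> 'a"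
    define T where "T c = c - frag_extend e0 (chain_boundary 1 c)" for c
    have e0: "e0 (point_simplex a) = e a" for a
      by (simp add: e0_def point_simplex_def)
    have T_diff: "T (a - b) = T a - T b" for a b
      by (simp add: T_def chain_boundary_diff frag_extend_diff)
    have "T c' \<in> class_chains X H \<and> singular_chain 1 X c'"
    proof (rule frag_induction[of c' "{f. singular_simplex 1 X f \<and> (\<exists>V\<in>\<C>. f \<in> standard_simplex 1 \<rightarrow> V)}"])
      show "Poly_Mapping.keys c' \<subseteq> {f. singular_simplex 1 X f \<and> (\<exists>V\<in>\<C>. f \<in> standard_simplex 1 \<rightarrow> V)}"
        using c'(1) c'_small by (auto simp: singular_cycle singular_chain_def)
      show "T 0 \<in> class_chains X H \<and> singular_chain 1 X 0"
        by (simp add: T_def class_chains_boundary[OF H])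
    next
      fix f assume "f \<in> {f. singular_simplex 1 X f \<and> (\<exists>V\<in>\<C>. f \<in> standard_simplex 1 \<rightarrow> V)}"
      then obtain V where f: "singular_simplex 1 X f" and V: "V \<in> \<C>" "f \<in> standard_simplex 1 \<rightarrow> V" by blast
      obtain \<gamma> where \<gamma>: "pathin X \<gamma>" "f = path_simplex \<gamma>" "\<gamma> ` {0..1} = f ` standard_simplex 1"
        using singular_simplex_1_path[OF f] .
      have "T (frag_of f) = path_chain \<gamma> + e (\<gamma> 0) - e (\<gamma> 1)"
        unfolding T_def \<gamma>(2) path_chain_def[symmetric] boundary_path_chain
        by (simp add: frag_extend_diff e0)
      then show "T (frag_of f) \<in> class_chains X H \<and> singular_chain 1 X (frag_of f)"
        using small[OF V(1) \<gamma>(1)] V(2) \<gamma>(3) f by (auto simp: singular_chain_of)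
    next
      fix a b
      assume "T a \<in> class_chains X H \<and> singular_chain 1 X a" "T b \<in> class_chains X H \<and> singular_chain 1 X b"
      then show "T (a - b) \<in> class_chains X H \<and> singular_chain 1 X (a - b)"
        by (simp add: T_diff class_chains_diff[OF H] singular_chain_diff)
    qed
    moreover have "T c' = c'" using c'(1) by (simp add: T_def singular_cycle)
    ultimately have "homologous_rel_set 1 X {} c' \<in> H" by (simp add: class_chains_def)
    then show "x \<in> H" using c(2) c'(2) homologous_rel_set_eq by metis
  qed
qed

section \<open>Lifts to a simply connected covering space\<close>

text \<open>The set where two lifts agree is open by local injectivity of \<open>p\<close> and
  closed because \<open>U\<close> is Hausdorff.\<close>

lemma covering_lifts_eq:
  fixes U :: "'u::t2_space set" and p :: "'u \<Rightarrow> 'b::topological_space"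
  assumes cov: "covering_space U p S" and "connected Q"
    and k1: "continuous_on Q k1" "k1 \<in> Q \<rightarrow> U" and k2: "continuous_on Q k2" "k2 \<in> Q \<rightarrow> U"
    and pk: "\<And>x. x \<in> Q \<Longrightarrow> p (k1 x) = p (k2 x)"
    and z: "z \<in> Q" "k1 z = k2 z" and "x \<in> Q"
  shows "k1 x = k2 x"
proof -
  let ?E = "{x \<in> Q. k1 x = k2 x}"
  have "openin (top_of_set Q) ?E"
  proof (subst openin_subopen, clarify)
    fix y assume y: "y \<in> Q" "k1 y = k2 y"
    have "k1 y \<in> U" using funcset_mem[OF k1(2) y(1)] .
    then obtain T u q where T: "k1 y \<in> T" "openin (top_of_set U) T" "homeomorphism T u p q"
      using covering_space_local_homeomorphism[OF cov] by metis
    let ?N = "(Q \<inter> k1 -` T) \<inter> (Q \<inter> k2 -` T)"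
    have "openin (top_of_set Q) ?N"
      using continuous_openin_preimage[OF k1 T(2)] continuous_openin_preimage[OF k2 T(2)] by (rule openin_Int)
    moreover have "?N \<subseteq> ?E"
      using T(3) pk unfolding homeomorphism_def by (smt (verit) IntE mem_Collect_eq subsetI vimage_eq)
    ultimately show "\<exists>T. openin (top_of_set Q) T \<and> y \<in> T \<and> T \<subseteq> ?E"
      using y T(1) by (intro exI[of _ ?N]) auto
  qed
  moreover have "openin (top_of_set Q) (Q - ?E)"
  proof (subst openin_subopen, intro ballI)
    fix y assume "y \<in> Q - ?E"
    then have y: "y \<in> Q" "k1 y \<noteq> k2 y" by auto
    then obtain A B where AB: "open A" "open B" "k1 y \<in> A" "k2 y \<in> B" "A \<inter> B = {}"
      using hausdorff by meson
    let ?N = "(Q \<inter> k1 -` A) \<inter> (Q \<inter> k2 -` B)"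
    have "openin (top_of_set Q) ?N"
      using continuous_openin_preimage_gen[OF k1(1) AB(1)] continuous_openin_preimage_gen[OF k2(1) AB(2)] by (rule openin_Int)
    then show "\<exists>T. openin (top_of_set Q) T \<and> y \<in> T \<and> T \<subseteq> Q - ?E"
      using y AB by (intro exI[of _ ?N]) auto
  qed
  then have "closedin (top_of_set Q) ?E" by (simp add: closedin_def)
  ultimately have "?E = {} \<or> ?E = Q"
    using \<open>connected Q\<close> unfolding connected_clopen by blast
  then show ?thesis using z \<open>x \<in> Q\<close> by blast
qed

text \<open>Allowing every starting point \<open>z\<close> and every point \<open>a\<close> above
  \<open>h z\<close> is what makes the property glue: a lift on one piece can be continued from any
  point of the overlap.\<close>

definition liftable :: "'u::topological_space set \<Rightarrow> ('u \<Rightarrow> 'b::topological_space) \<Rightarrow>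
    ('q::topological_space \<Rightarrow> 'b) \<Rightarrow> 'q set \<Rightarrow> bool" where
  "liftable U p h Q \<longleftrightarrow> (\<forall>z\<in>Q. \<forall>a\<in>U. p a = h z \<longrightarrow>
     (\<exists>k. continuous_on Q k \<and> k \<in> Q \<rightarrow> U \<and> k z = a \<and> (\<forall>x\<in>Q. p (k x) = h x)))"

text \<open>A lift on one piece prescribes the value of a lift on the other at one common point;
  connectedness of the overlap forces them to agree on all of it.\<close>

lemma liftable_Un:
  fixes U :: "'u::t2_space set" and p :: "'u \<Rightarrow> 'b::topological_space"
  assumes cov: "covering_space U p S" and "closed A" "closed B" "connected (A \<inter> B)" "A \<inter> B \<noteq> {}"
    and A: "liftable U p h A" and B: "liftable U p h B"
  shows "liftable U p h (A \<union> B)"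
proof -
  have *: "\<exists>k. continuous_on (A \<union> B) k \<and> k \<in> A \<union> B \<rightarrow> U \<and> k z = a \<and> (\<forall>x\<in>A \<union> B. p (k x) = h x)"
    if za: "z \<in> A" "a \<in> U" "p a = h z" and cl: "closed A" "closed B"
      and AB: "connected (A \<inter> B)" "A \<inter> B \<noteq> {}" and A: "liftable U p h A" and B: "liftable U p h B"
    for A B z a
  proof -
    obtain k where k: "continuous_on A k" "k \<in> A \<rightarrow> U" "k z = a" "\<forall>x\<in>A. p (k x) = h x"
      using A za unfolding liftable_def by blast
    obtain w where w: "w \<in> A" "w \<in> B" using AB by blast
    then have "k w \<in> U" "p (k w) = h w" using k by auto
    then obtain l where l: "continuous_on B l" "l \<in> B \<rightarrow> U" "l w = k w" "\<forall>x\<in>B. p (l x) = h x"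
      using B w unfolding liftable_def by blast
    have eq: "k x = l x" if "x \<in> A \<inter> B" for x
      by (rule covering_lifts_eq[OF cov AB(1), of k l w])
         (use k l w that in \<open>auto simp: Pi_iff intro: continuous_on_subset\<close>)
    let ?m = "\<lambda>x. if x \<in> A then k x else l x"
    have "continuous_on (A \<union> B) ?m"
      by (rule continuous_on_cases) (use cl k l eq in auto)
    then show ?thesis
      using k l za by (intro exI[of _ ?m]) (auto simp: Pi_iff)
  qed
  show ?thesis
    unfolding liftable_def
  proof (intro ballI impI)
    fix z a assume "z \<in> A \<union> B" "a \<in> U" "p a = h z"
    then show "\<exists>k. continuous_on (A \<union> B) k \<and> k \<in> A \<union> B \<rightarrow> U \<and> k z = a \<and> (\<forall>x\<in>A \<union> B. p (k x) = h x)"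
      using *[of z A a B] *[of z B a A] assms by (auto simp: Int_commute Un_commute)
  qed
qed

lemma liftable_evenly_covered:
  assumes sheets: "\<Union>\<V> = U \<inter> p -` T" "\<And>V. V \<in> \<V> \<Longrightarrow> \<exists>q. homeomorphism V T p q"
    and h: "continuous_on Q h" "h \<in> Q \<rightarrow> T"
  shows "liftable U p h Q"
  unfolding liftable_def
proof (intro ballI impI)
  fix z a assume za: "z \<in> Q" "a \<in> U" "p a = h z"
  then have "a \<in> \<Union>\<V>" using h sheets by auto
  then obtain V q where V: "V \<in> \<V>" "a \<in> V" "homeomorphism V T p q" using sheets by blast
  then have "V \<subseteq> U" using sheets by blast
  then show "\<exists>k. continuous_on Q k \<and> k \<in> Q \<rightarrow> U \<and> k z = a \<and> (\<forall>x\<in>Q. p (k x) = h x)"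
  proof (intro exI[of _ "q \<circ> h"] conjI)
    have "continuous_on (h ` Q) q"
      using V(3) h(2) unfolding homeomorphism_def by (auto intro: continuous_on_subset)
    then show "continuous_on Q (q \<circ> h)" using h(1) by (rule continuous_on_compose[rotated])
  qed (use V za h in \<open>auto simp: homeomorphism_def Pi_iff\<close>)
qed

text \<open>Two nested bisections with \<open>Bolzano\<close> in place of a Lebesgue number: small
  rectangles lie over evenly covered sets, they are stacked to thin vertical strips, and the strips
  are joined.\<close>

lemma liftable_rectangle:
  fixes U :: "'u::t2_space set" and p :: "'u \<Rightarrow> 'b::topological_space"
    and h :: "real \<times> real \<Rightarrow> 'b"
  assumes cov: "covering_space U p S" and ab: "a \<le> b" "c \<le> d"
    and h: "continuous_on ({a..b} \<times> {c..d}) h" "h \<in> ({a..b} \<times> {c..d}) \<rightarrow> S"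
  shows "liftable U p h ({a..b} \<times> {c..d})"
proof -
  \<comment> \<open>The guards make the property vacuous for rectangles that leave the given one,
    since \<open>Bolzano\<close> asks for all short intervals around a point.\<close>
  define P where "P s t u v \<longleftrightarrow> (s \<le> t \<longrightarrow> u \<le> v \<longrightarrow> a \<le> s \<longrightarrow> t \<le> b \<longrightarrow> c \<le> u \<longrightarrow> v \<le> d \<longrightarrow>
     liftable U p h ({s..t} \<times> {u..v}))" for s t u v
  have vert: "P s t u w" if "P s t u v" "P s t v w" "u \<le> v" "v \<le> w" for s t u v w
    unfolding P_def
  proof (intro impI)
    assume *: "s \<le> t" "u \<le> w" "a \<le> s" "t \<le> b" "c \<le> u" "w \<le> d"
    have eq: "{s..t} \<times> {u..w} = {s..t} \<times> {u..v} \<union> {s..t} \<times> {v..w}"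
      "({s..t} \<times> {u..v}) \<inter> ({s..t} \<times> {v..w}) = {s..t} \<times> {v..v}"
      using that(3,4) by auto
    have "connected ({s..t} \<times> {v..v})" by (intro connected_Times) auto
    then show "liftable U p h ({s..t} \<times> {u..w})"
      using liftable_Un[OF cov, of "{s..t} \<times> {u..v}" "{s..t} \<times> {v..w}" h] that * eq
      by (auto intro!: closed_Times simp: P_def)
  qed
  have horiz: "P s w u v" if "P s t u v" "P t w u v" "s \<le> t" "t \<le> w" for s t u v w
    unfolding P_def
  proof (intro impI)
    assume *: "s \<le> w" "u \<le> v" "a \<le> s" "w \<le> b" "c \<le> u" "v \<le> d"
    have eq: "{s..w} \<times> {u..v} = {s..t} \<times> {u..v} \<union> {t..w} \<times> {u..v}"
      "({s..t} \<times> {u..v}) \<inter> ({t..w} \<times> {u..v}) = {t..t} \<times> {u..v}"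
      using that(3,4) by auto
    have "connected ({t..t} \<times> {u..v})" by (intro connected_Times) auto
    then show "liftable U p h ({s..w} \<times> {u..v})"
      using liftable_Un[OF cov, of "{s..t} \<times> {u..v}" "{t..w} \<times> {u..v}" h] that * eq
      by (auto intro!: closed_Times simp: P_def)
  qed
  have local: "\<exists>\<delta>>0. \<forall>s t u v. s \<le> x \<and> x \<le> t \<and> t - s < \<delta> \<longrightarrow> u \<le> y \<and> y \<le> v \<and> v - u < \<delta> \<longrightarrow> P s t u v"
    if xy: "x \<in> {a..b}" "y \<in> {c..d}" for x y
  proof -
    have "h (x, y) \<in> S" using h xy by auto
    then obtain T \<V> where T: "h (x, y) \<in> T" "openin (top_of_set S) T"
      and \<V>: "\<Union>\<V> = U \<inter> p -` T" "\<And>V. V \<in> \<V> \<Longrightarrow> \<exists>q. homeomorphism V T p q"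
      using cov unfolding covering_space_def by meson
    have "openin (top_of_set ({a..b} \<times> {c..d})) (({a..b} \<times> {c..d}) \<inter> h -` T)"
      by (rule continuous_openin_preimage[OF h T(2)])
    then obtain e where e: "e > 0"
      "ball (x, y) e \<inter> ({a..b} \<times> {c..d}) \<subseteq> ({a..b} \<times> {c..d}) \<inter> h -` T"
      using T(1) xy by (force simp: openin_contains_ball)
    show ?thesis
      unfolding P_def
    \<comment> \<open>The distance is at most the sum of the two coordinate differences, each below
      \<open>e / 2\<close>.\<close>
    proof (intro exI[of _ "e / 2"] conjI allI impI)
      fix s t u v assume *: "s \<le> x \<and> x \<le> t \<and> t - s < e / 2" "u \<le> y \<and> y \<le> v \<and> v - u < e / 2"
        "s \<le> t" "u \<le> v" "a \<le> s" "t \<le> b" "c \<le> u" "v \<le> d"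
      have "{s..t} \<times> {u..v} \<subseteq> ball (x, y) e"
      proof
        fix w assume w: "w \<in> {s..t} \<times> {u..v}"
        have "dist (x, y) w \<le> \<bar>x - fst w\<bar> + \<bar>y - snd w\<bar>"
          using norm_Pair_le[of "x - fst w" "y - snd w"] by (cases w) (simp add: dist_norm)
        also have "\<dots> < e" using w * by auto
        finally show "w \<in> ball (x, y) e" by simp
      qed
      then have sub: "{s..t} \<times> {u..v} \<subseteq> ({a..b} \<times> {c..d}) \<inter> h -` T"
        using e(2) * by fastforce
      then show "liftable U p h ({s..t} \<times> {u..v})"
        by (intro liftable_evenly_covered[OF \<V>] continuous_on_subset[OF h(1)]) auto
    qed (use e in auto)
  qed
  have strip: "\<exists>\<delta>>0. \<forall>s t. s \<le> x \<and> x \<le> t \<and> t - s < \<delta> \<longrightarrow> P s t c d" if x: "x \<in> {a..b}" for x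
  proof -
    \<comment> \<open>The width \<delta> may depend on the vertical interval; stacking two intervals
      takes the smaller width.\<close>
    define R where "R u v \<longleftrightarrow> (c \<le> u \<longrightarrow> v \<le> d \<longrightarrow> (\<exists>\<delta>>0. \<forall>s t. s \<le> x \<and> x \<le> t \<and> t - s < \<delta> \<longrightarrow> P s t u v))" for u v
    have "R c d"
    proof (rule Bolzano[OF ab(2), of R])
      fix u v w assume uvw: "R u v" "R v w" "u \<le> v" "v \<le> w"
      show "R u w"
        unfolding R_def
      proof (intro impI)
        assume "c \<le> u" "w \<le> d"
        then have cd: "c \<le> v" "v \<le> d" using uvw by auto
        obtain \<delta>1 where 1: "\<delta>1 > 0" "\<forall>s t. s \<le> x \<and> x \<le> t \<and> t - s < \<delta>1 \<longrightarrow> P s t u v"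
          using uvw(1) cd \<open>c \<le> u\<close> unfolding R_def by blast
        obtain \<delta>2 where 2: "\<delta>2 > 0" "\<forall>s t. s \<le> x \<and> x \<le> t \<and> t - s < \<delta>2 \<longrightarrow> P s t v w"
          using uvw(2) cd \<open>w \<le> d\<close> unfolding R_def by blast
        show "\<exists>\<delta>>0. \<forall>s t. s \<le> x \<and> x \<le> t \<and> t - s < \<delta> \<longrightarrow> P s t u w"
        proof (intro exI[of _ "min \<delta>1 \<delta>2"] conjI allI impI)
          fix s t assume "s \<le> x \<and> x \<le> t \<and> t - s < min \<delta>1 \<delta>2"
          then have "P s t u v" "P s t v w" using 1 2 by simp_all
          then show "P s t u w" using vert uvw(3,4) by blast
        qed (use 1 2 in auto)
      qed
    next
      fix y assume "c \<le> y" "y \<le> d"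
      then obtain \<delta> where \<delta>: "\<delta> > 0"
        "\<forall>s t u v. s \<le> x \<and> x \<le> t \<and> t - s < \<delta> \<longrightarrow> u \<le> y \<and> y \<le> v \<and> v - u < \<delta> \<longrightarrow> P s t u v"
        using local[OF x, of y] by auto
      show "\<exists>\<delta>>0. \<forall>u v. u \<le> y \<and> y \<le> v \<and> v - u < \<delta> \<longrightarrow> R u v"
      proof (intro exI[of _ \<delta>] conjI allI impI)
        fix u v assume "u \<le> y \<and> y \<le> v \<and> v - u < \<delta>"
        then have "\<forall>s t. s \<le> x \<and> x \<le> t \<and> t - s < \<delta> \<longrightarrow> P s t u v" using \<delta>(2) by blast
        then show "R u v" unfolding R_def using \<delta>(1) by blast
      qed (rule \<delta>(1))
    qed
    then show ?thesis by (simp add: R_def)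
  qed
  have "P a b c d"
  proof (rule Bolzano[OF ab(1), of "\<lambda>s t. P s t c d"])
    show "P s w c d" if "P s t c d" "P t w c d" "s \<le> t" "t \<le> w" for s t w
      by (rule horiz[OF that])
    show "\<exists>\<delta>>0. \<forall>s t. s \<le> x \<and> x \<le> t \<and> t - s < \<delta> \<longrightarrow> P s t c d" if "a \<le> x" "x \<le> b" for x
      using strip[of x] that by auto
  qed
  then show ?thesis using ab by (simp add: P_def)
qed

text \<open>A path is treated as a map on a rectangle of height zero.\<close>

lemma covering_path_lift:
  fixes U :: "'u::t2_space set" and p :: "'u \<Rightarrow> 'b::topological_space"
  assumes cov: "covering_space U p S" and g: "path g" "path_image g \<subseteq> S" and a: "a \<in> U" "p a = g 0"
  obtains k where "path k" "path_image k \<subseteq> U" "k 0 = a" "\<And>t. t \<in> {0..1} \<Longrightarrow> p (k t) = g t"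
proof -
  have "continuous_on ({0..1} \<times> {0..0::real}) (g \<circ> fst)"
    using g(1) by (intro continuous_on_compose continuous_intros) (simp add: path_def)
  then have "liftable U p (g \<circ> fst) ({0..1} \<times> {0..0::real})"
    by (intro liftable_rectangle[OF cov]) (use g(2) in \<open>auto simp: path_image_def\<close>)
  then obtain k where k: "continuous_on ({0..1} \<times> {0..0::real}) k" "k \<in> ({0..1} \<times> {0..0}) \<rightarrow> U"
    "k (0, 0) = a" "\<forall>x\<in>{0..1} \<times> {0..0}. p (k x) = g (fst x)"
    using a unfolding liftable_def by force
  show ?thesis
  proof
    show "path (\<lambda>t. k (t, 0))"
      unfolding path_def by (rule continuous_on_compose2[OF k(1)]) (auto intro!: continuous_intros)
  qed (use k in \<open>auto simp: path_image_def\<close>)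
qed

text \<open>The projection of a null homotopy of \<open>l\<close> lifts to a square \<open>K\<close>
  whose left side is \<open>k\<close>. Its right side lies over a point and is constant. Bottom and
  top lie over the same path and agree at their right ends, so they agree at their left ends, which
  are \<open>k 0\<close> and \<open>k 1\<close>.\<close>

lemma covering_loop_lift:
  fixes U :: "'u::t2_space set" and p :: "'u \<Rightarrow> 'b::topological_space"
  assumes cov: "covering_space U p S" and U: "simply_connected U"
    and l: "path l" "path_image l \<subseteq> U" "l 0 = l 1"
    and k: "path k" "path_image k \<subseteq> U" and pk: "\<And>t. t \<in> {0..1} \<Longrightarrow> p (k t) = p (l t)"
  shows "k 0 = k 1"
proof -
  let ?Q = "{0..1::real} \<times> {0..1::real}"
  have U_l: "l t \<in> U" "k t \<in> U" if "t \<in> {0..1}" for t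
    using l(2) k(2) that by (auto simp: path_image_def)
  define a where "a = l 0"
  obtain h :: "real \<times> real \<Rightarrow> 'u" where h: "continuous_on ?Q h" "h \<in> ?Q \<rightarrow> U"
    and h0: "\<And>t. t \<in> {0..1} \<Longrightarrow> h (0, t) = l t" and h1: "\<And>t. t \<in> {0..1} \<Longrightarrow> h (1, t) = a"
    and hloop: "\<And>s. s \<in> {0..1} \<Longrightarrow> h (s, 1) = h (s, 0)"
    using simply_connected_null_homotopy[OF U l] unfolding a_def by metis
  have cp: "continuous_on U p" "p ` U = S" using cov by (auto simp: covering_space_def)
  have "continuous_on ?Q (p \<circ> h)"
    by (rule continuous_on_compose[OF h(1) continuous_on_subset[OF cp(1)]]) (use h(2) in auto)
  then have "liftable U p (p \<circ> h) ?Q"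
    by (intro liftable_rectangle[OF cov]) (use h(2) cp in auto)
  moreover have "p (k 0) = (p \<circ> h) (0, 0)" using pk[of 0] h0[of 0] by simp
  ultimately obtain K where K: "continuous_on ?Q K" "K \<in> ?Q \<rightarrow> U" "K (0, 0) = k 0"
    "\<And>x. x \<in> ?Q \<Longrightarrow> p (K x) = p (h x)"
    using U_l(2)[of 0] unfolding liftable_def by force
  have cont: "continuous_on {0..1} (\<lambda>t. K (s, t))" "continuous_on {0..1} (\<lambda>t. K (t, s))" if "s \<in> {0..1}" for s
    using that by (auto intro!: continuous_on_compose2[OF K(1)] continuous_intros)
  have KU: "(\<lambda>t. K (s, t)) \<in> {0..1} \<rightarrow> U" "(\<lambda>t. K (t, s)) \<in> {0..1} \<rightarrow> U" if "s \<in> {0..1}" for s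
    using K(2) that by auto
  have left: "K (0, t) = k t" if t: "t \<in> {0..1}" for t
  proof (rule covering_lifts_eq[OF cov _ cont(1) KU(1)])
    show "continuous_on {0..1} k" using k(1) by (simp add: path_def)
    show "k \<in> {0..1} \<rightarrow> U" using U_l(2) by blast
    show "p (K (0, x)) = p (k x)" if "x \<in> {0..1}" for x
      using K(4)[of "(0, x)"] h0[OF that] pk[OF that] that by simp
    show "K (0, 0) = k 0" by (rule K(3))
  qed (use t in auto)
  have right: "K (1, t) = K (1, 0)" if t: "t \<in> {0..1}" for t
  proof (rule covering_lifts_eq[OF cov _ cont(1) KU(1)])
    show "continuous_on {0..1} (\<lambda>_::real. K (1, 0))" by (rule continuous_on_const)
    show "(\<lambda>_::real. K (1, 0)) \<in> {0..1} \<rightarrow> U" using K(2) by auto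
    show "p (K (1, x)) = p (K (1, 0))" if "x \<in> {0..1}" for x
      using K(4)[of "(1, x)"] K(4)[of "(1, 0)"] h1[OF that] h1[of 0] that by simp
    show "K (1, 0) = K (1, 0)" by (rule refl)
  qed (use t in auto)
  have "K (s, 1) = K (s, 0)" if s: "s \<in> {0..1}" for s
  proof (rule covering_lifts_eq[OF cov _ cont(2) KU(2) cont(2) KU(2)])
    show "p (K (x, 1)) = p (K (x, 0))" if "x \<in> {0..1}" for x
      using K(4)[of "(x, 1)"] K(4)[of "(x, 0)"] hloop[OF that] that by simp
    show "K (1, 1) = K (1, 0)" by (rule right) simp
  qed (use s in auto)
  from this[of 0] show ?thesis using left[of 0] left[of 1] by simp
qed

text \<open>The graph of the deck transformation that takes \<open>u\<close> to \<open>u'\<close>: a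
  path from \<open>u\<close> to \<open>v\<close> is projected and lifted again from
  \<open>u'\<close>, and \<open>w\<close> is the end of this lift.\<close>

definition lift_transport :: "'u::topological_space set \<Rightarrow> ('u \<Rightarrow> 'b) \<Rightarrow> 'u \<Rightarrow> 'u \<Rightarrow> 'u \<Rightarrow> 'u \<Rightarrow> bool" where
  "lift_transport U p u u' v w \<longleftrightarrow> (\<exists>g g'. path g \<and> path_image g \<subseteq> U \<and> path g' \<and> path_image g' \<subseteq> U \<and>
     g 0 = u \<and> g 1 = v \<and> g' 0 = u' \<and> g' 1 = w \<and> (\<forall>t\<in>{0..1}. p (g' t) = p (g t)))"

lemma lift_transport_sym: "lift_transport U p u u' v w \<Longrightarrow> lift_transport U p u' u w v"
  unfolding lift_transport_def by metis

lemma lift_transport_imp: "lift_transport U p u u' v w \<Longrightarrow> v \<in> U \<and> w \<in> U \<and> p w = p v"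
proof -
  assume "lift_transport U p u u' v w"
  then obtain g g' where g: "path_image g \<subseteq> U" "path_image g' \<subseteq> U" "g 1 = v" "g' 1 = w"
    "\<forall>t\<in>{0..1}. p (g' t) = p (g t)"
    unfolding lift_transport_def by blast
  have "g 1 \<in> path_image g" "g' 1 \<in> path_image g'" unfolding path_image_def by simp_all
  then show ?thesis using g by auto
qed

lemma lift_transport_join:
  assumes "lift_transport U p u u' v w"
    and "path g" "path_image g \<subseteq> U" "g 0 = v" "path g'" "path_image g' \<subseteq> U" "g' 0 = w"
    and "\<And>t. t \<in> {0..1} \<Longrightarrow> p (g' t) = p (g t)"
  shows "lift_transport U p u u' (g 1) (g' 1)"
proof -
  obtain f f' where f: "path f" "path_image f \<subseteq> U" "path f'" "path_image f' \<subseteq> U"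
    "f 0 = u" "f 1 = v" "f' 0 = u'" "f' 1 = w" "\<forall>t\<in>{0..1}. p (f' t) = p (f t)"
    using assms(1) unfolding lift_transport_def by blast
  have e: "pathfinish f = pathstart g" "pathfinish f' = pathstart g'"
    using f assms by (auto simp: pathfinish_def pathstart_def)
  show ?thesis
    unfolding lift_transport_def
  proof (rule exI[of _ "f +++ g"], rule exI[of _ "f' +++ g'"], intro conjI ballI)
    show "path (f +++ g)" "path (f' +++ g')" using e f assms by simp_all
    show "path_image (f +++ g) \<subseteq> U" "path_image (f' +++ g') \<subseteq> U"
      using e f assms by (simp_all add: path_image_join)
    show "p ((f' +++ g') t) = p ((f +++ g) t)" if "t \<in> {0..1}" for t
      using f(9) assms(8)[of "2 * t - 1"] that by (simp add: joinpaths_def)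
  qed (use f in \<open>simp_all add: joinpaths_def\<close>)
qed

text \<open>Two paths from \<open>u\<close> to \<open>v\<close> form a loop in \<open>U\<close>. By
  \<open>covering_loop_lift\<close> the lift from \<open>u'\<close> of its projection closes up, so
  its second half \<open>k\<close>, reversed, is the lift along the second path.\<close>

lemma lift_transport_unique:
  fixes U :: "'u::t2_space set"
  assumes cov: "covering_space U p S" and U: "simply_connected U"
    and "lift_transport U p u u' v w1" "lift_transport U p u u' v w2"
  shows "w1 = w2"
proof -
  obtain f f' where f: "path f" "path_image f \<subseteq> U" "path f'" "path_image f' \<subseteq> U"
    "f 0 = u" "f 1 = v" "f' 0 = u'" "f' 1 = w1" "\<forall>t\<in>{0..1}. p (f' t) = p (f t)"
    using assms(3) unfolding lift_transport_def by blast
  obtain g g' where g: "path g" "path_image g \<subseteq> U" "path g'" "path_image g' \<subseteq> U"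
    "g 0 = u" "g 1 = v" "g' 0 = u'" "g' 1 = w2" "\<forall>t\<in>{0..1}. p (g' t) = p (g t)"
    using assms(4) unfolding lift_transport_def by blast
  have cp: "continuous_on U p" "p ` U = S" using cov by (auto simp: covering_space_def)
  have w1: "w1 \<in> U" "p w1 = p v" using lift_transport_imp[OF assms(3)] by auto
  have "path (p \<circ> reversepath g)" "path_image (p \<circ> reversepath g) \<subseteq> S"
    using g(1,2) cp by (auto intro!: path_continuous_image intro: continuous_on_subset simp: path_image_compose)
  moreover have "p w1 = (p \<circ> reversepath g) 0" using w1 g by (simp add: reversepath_def)
  ultimately obtain k where k: "path k" "path_image k \<subseteq> U" "k 0 = w1"
    "\<And>t. t \<in> {0..1} \<Longrightarrow> p (k t) = (p \<circ> reversepath g) t"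
    by (rule covering_path_lift[OF cov _ _ w1(1)]) (rule that)
  have e: "pathfinish f = pathstart (reversepath g)" "pathfinish f' = pathstart k"
    using f g k by (auto simp: pathfinish_def pathstart_def reversepath_def)
  have "(f' +++ k) 0 = (f' +++ k) 1"
  proof (rule covering_loop_lift[OF cov U, of "f +++ reversepath g"])
    show "path (f +++ reversepath g)" "path_image (f +++ reversepath g) \<subseteq> U"
      "path (f' +++ k)" "path_image (f' +++ k) \<subseteq> U"
      using e f(1-4) g(1-4) k(1,2) by (simp_all add: path_image_join)
    show "(f +++ reversepath g) 0 = (f +++ reversepath g) 1"
      using f g by (simp add: joinpaths_def reversepath_def)
    show "p ((f' +++ k) t) = p ((f +++ reversepath g) t)" if "t \<in> {0..1}" for t
      using f(9) k(4)[of "2 * t - 1"] that by (simp add: joinpaths_def)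
  qed
  then have k1: "k 1 = g' 0" using f g by (simp add: joinpaths_def)
  have "k 0 = reversepath g' 0"
  proof (rule covering_lifts_eq[OF cov, of "{0..1}" k "reversepath g'" 1 0])
    show "continuous_on {0..1} k" using k(1) by (simp add: path_def)
    show "continuous_on {0..1} (reversepath g')"
      using g(3) path_reversepath[of g'] by (simp only: path_def)
    show "k \<in> {0..1} \<rightarrow> U" using k(2) by (auto simp: path_image_def)
    show "reversepath g' \<in> {0..1} \<rightarrow> U" using g(4) by (auto simp: path_image_def reversepath_def)
    show "p (k x) = p (reversepath g' x)" if "x \<in> {0..1}" for x
      using k(4)[OF that] g(9) that by (simp add: reversepath_def)
    show "k 1 = reversepath g' 1" using k1 by (simp add: reversepath_def)
  qed auto
  then show ?thesis using k g by (simp add: reversepath_def)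
qed

lemma lift_transport_exists:
  fixes U :: "'u::t2_space set"
  assumes cov: "covering_space U p S" and U: "simply_connected U"
    and u: "u \<in> U" "u' \<in> U" "p u' = p u" and v: "v \<in> U"
  shows "\<exists>w. lift_transport U p u u' v w"
proof -
  obtain g where g: "path g" "path_image g \<subseteq> U" "g 0 = u" "g 1 = v"
    using simply_connected_path_connected[OF U] u v unfolding path_connected_def pathstart_def pathfinish_def by blast
  have cp: "continuous_on U p" "p ` U = S" using cov by (auto simp: covering_space_def)
  have "path (p \<circ> g)" "path_image (p \<circ> g) \<subseteq> S"
    using g(1,2) cp by (auto intro!: path_continuous_image intro: continuous_on_subset simp: path_image_compose)
  then obtain k where k: "path k" "path_image k \<subseteq> U" "k 0 = u'" "\<And>t. t \<in> {0..1} \<Longrightarrow> p (k t) = (p \<circ> g) t"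
    by (rule covering_path_lift[OF cov _ _ u(2)]) (simp add: u(3) g(3), rule that)
  then have "\<forall>t\<in>{0..1}. p (k t) = p (g t)" by simp
  then show ?thesis using g k unfolding lift_transport_def by blast
qed

text \<open>Near \<open>v\<close> the transport is \<open>g2 \<circ> p\<close>, where
  \<open>g2\<close> inverts \<open>p\<close> on the sheet through \<open>w\<close>. Paths are
  prolonged by straight segments in the base, which is where an open \<open>S\<close> in a normed
  space enters.\<close>

lemma lift_transport_local:
  fixes U :: "'u::t2_space set" and p :: "'u \<Rightarrow> 'b::real_normed_vector"
  assumes cov: "covering_space U p S" and S: "open S" and tr: "lift_transport U p u u' v w"
  obtains N f where "openin (top_of_set U) N" "v \<in> N" "continuous_on N f"
    "\<And>v'. v' \<in> N \<Longrightarrow> lift_transport U p u u' v' (f v')"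
proof -
  have vw: "v \<in> U" "w \<in> U" "p w = p v" using lift_transport_imp[OF tr] by auto
  have cp: "continuous_on U p" "p ` U = S" using cov by (auto simp: covering_space_def)
  then have "p v \<in> S" using vw by auto
  then obtain T \<V> where T: "p v \<in> T" "openin (top_of_set S) T"
    and \<V>: "\<Union>\<V> = U \<inter> p -` T" "\<And>V. V \<in> \<V> \<Longrightarrow> openin (top_of_set U) V \<and> (\<exists>q. homeomorphism V T p q)"
    using cov unfolding covering_space_def by meson
  have "open T" using T(2) S openin_open_trans by blast
  then obtain r where r: "r > 0" "ball (p v) r \<subseteq> T" using T(1) open_contains_ball by blast
  have "v \<in> \<Union>\<V>" "w \<in> \<Union>\<V>" using \<V>(1) vw T(1) by auto
  then obtain V W g1 g2 where V: "V \<in> \<V>" "v \<in> V" "homeomorphism V T p g1"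
    and W: "W \<in> \<V>" "w \<in> W" "homeomorphism W T p g2" using \<V>(2) by blast
  have VU: "V \<subseteq> U" "W \<subseteq> U" using \<V>(1) V(1) W(1) by auto
  \<comment> \<open>Convexity of the ball keeps the segment from \<open>p v\<close> to
    \<open>p v'\<close> inside the evenly covered set \<open>T\<close>.\<close>
  define N where "N = (U \<inter> p -` ball (p v) r) \<inter> V"
  have N: "openin (top_of_set U) N"
    unfolding N_def using \<V>(2)[OF V(1)] by (intro openin_Int continuous_openin_preimage_gen cp) auto
  have lp: "path_image (linepath (p v) (p v')) \<subseteq> T" if "v' \<in> N" for v'
  proof -
    have "closed_segment (p v) (p v') \<subseteq> ball (p v) r"
      by (rule closed_segment_subset) (use that r in \<open>auto simp: N_def\<close>)
    then show ?thesis using r(2) by simp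
  qed
  show ?thesis
  proof
    show "openin (top_of_set U) N" by (rule N)
    show "v \<in> N" using vw V r by (simp add: N_def)
    have "continuous_on N p"
      by (rule continuous_on_subset[OF cp(1)]) (auto simp: N_def)
    moreover have "continuous_on (p ` N) g2"
      using W(3) r(2) unfolding homeomorphism_def N_def by (auto intro: continuous_on_subset)
    ultimately show "continuous_on N (g2 \<circ> p)"
      by (rule continuous_on_compose)
  next
    fix v' assume v': "v' \<in> N"
    let ?s = "linepath (p v) (p v')"
    have g12: "path (g \<circ> ?s)" "path_image (g \<circ> ?s) \<subseteq> Z" "\<And>t. t \<in> {0..1} \<Longrightarrow> p ((g \<circ> ?s) t) = ?s t"
      if "homeomorphism Z T p g" for g Z
    proof -
      have cg: "continuous_on T g" "g ` T = Z" "\<And>y. y \<in> T \<Longrightarrow> p (g y) = y"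
        using that by (simp_all add: homeomorphism_def)
      have s: "?s t \<in> T" if "t \<in> {0..1}" for t
        using lp[OF v'] that unfolding path_image_def by blast
      show "path (g \<circ> ?s)"
        by (intro path_continuous_image continuous_on_subset[OF cg(1) lp[OF v']]) simp
      show "path_image (g \<circ> ?s) \<subseteq> Z"
        using image_mono[OF lp[OF v'], of g] cg(2) unfolding path_image_compose by simp
      show "p ((g \<circ> ?s) t) = ?s t" if "t \<in> {0..1}" for t
        using cg(3)[OF s[OF that]] by simp
    qed
    have ends: "g1 (p v) = v" "g1 (p v') = v'" "g2 (p v) = w"
      using V W v' vw(3) unfolding homeomorphism_def N_def by auto
    have "lift_transport U p u u' ((g1 \<circ> ?s) 1) ((g2 \<circ> ?s) 1)"
    proof (rule lift_transport_join[OF tr g12(1)[OF V(3)] _ _ g12(1)[OF W(3)]])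
      show "path_image (g1 \<circ> ?s) \<subseteq> U" "path_image (g2 \<circ> ?s) \<subseteq> U"
        using g12(2)[OF V(3)] g12(2)[OF W(3)] VU by auto
      show "(g1 \<circ> ?s) 0 = v" "(g2 \<circ> ?s) 0 = w" using ends by (simp_all add: linepath_def)
      show "p ((g2 \<circ> ?s) t) = p ((g1 \<circ> ?s) t)" if "t \<in> {0..1}" for t
        using g12(3)[OF V(3) that] g12(3)[OF W(3) that] by simp
    qed
    then show "lift_transport U p u u' v' ((g2 \<circ> p) v')"
      using ends by (simp add: linepath_def)
  qed
qed

text \<open>Transport from \<open>u\<close> to \<open>u'\<close> is a well-defined map by uniqueness
  and continuous by its local form; exchanging \<open>u\<close> and \<open>u'\<close> gives its
  inverse.\<close>

lemma deck_group_transitive: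
  fixes U :: "'u::t2_space set" and p :: "'u \<Rightarrow> 'b::real_normed_vector"
  assumes cov: "covering_space U p S" and S: "open S" and U: "simply_connected U"
    and u: "u \<in> U" "u' \<in> U" "p u' = p u"
  obtains \<psi> where "\<psi> \<in> carrier (deck_group U p)" "\<psi> u = u'"
proof -
  let ?M = "lift_transport U p"
  define t where "t a b = (\<lambda>v\<in>U. THE w. ?M a b v w)" for a b
  have t: "?M a b v (t a b v)" if "a \<in> U" "b \<in> U" "p b = p a" "v \<in> U" for a b v
  proof -
    have "\<exists>!w. ?M a b v w"
      using lift_transport_exists[OF cov U that] lift_transport_unique[OF cov U] by blast
    then show ?thesis using that(4) by (simp add: t_def theI')
  qed
  have cont: "continuous_on U (t a b)" if ab: "a \<in> U" "b \<in> U" "p b = p a" for a b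
    unfolding continuous_on_eq_continuous_within
  proof
    fix v assume v: "v \<in> U"
    obtain N f where N: "openin (top_of_set U) N" "v \<in> N" "continuous_on N f"
      "\<And>v'. v' \<in> N \<Longrightarrow> ?M a b v' (f v')"
      by (rule lift_transport_local[OF cov S t[OF ab v]]) (rule that)
    have "N \<subseteq> U" using N(1) openin_imp_subset by blast
    then have "t a b v' = f v'" if "v' \<in> N" for v'
      by (intro lift_transport_unique[OF cov U t[OF ab] N(4)]) (use that \<open>N \<subseteq> U\<close> in auto)
    then have "continuous_on N (t a b)" using continuous_on_cong[OF refl, of N "t a b" f] N(3) by simp
    then have "continuous (at v within N) (t a b)"
      using N(2) by (simp add: continuous_on_eq_continuous_within)
    moreover obtain O' where "open O'" "N = U \<inter> O'" using N(1) openin_open by blast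
    then have "at v within N = at v within U"
      using N(2) by (intro at_within_nhd[of v O']) auto
    ultimately show "continuous (at v within U) (t a b)"
      by (simp only:)
  qed
  have tU: "t a b v \<in> U" "p (t a b v) = p v" if "a \<in> U" "b \<in> U" "p b = p a" "v \<in> U" for a b v
    using lift_transport_imp[OF t[OF that]] by auto
  have inv: "t b a (t a b v) = v" if "a \<in> U" "b \<in> U" "p b = p a" "v \<in> U" for a b v
    by (rule lift_transport_unique[OF cov U t[OF that(2,1) that(3)[symmetric] tU(1)[OF that]]
          lift_transport_sym[OF t[OF that]]])
  have hom: "homeomorphism U U (t u u') (t u' u)"
    unfolding homeomorphism_def
  proof (intro conjI ballI)
    note uu = u(1,2,3) and uu' = u(2,1) u(3)[symmetric]
    show "t u u' ` U = U"
    proof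
      show "U \<subseteq> t u u' ` U"
      proof
        fix v assume "v \<in> U"
        then show "v \<in> t u u' ` U" using image_eqI[of v "t u u'" "t u' u v" U] inv[OF uu'] tU(1)[OF uu'] by simp
      qed
    qed (use tU(1)[OF uu] in blast)
    show "t u' u ` U = U"
    proof
      show "U \<subseteq> t u' u ` U"
      proof
        fix v assume "v \<in> U"
        then show "v \<in> t u' u ` U" using image_eqI[of v "t u' u" "t u u' v" U] inv[OF uu] tU(1)[OF uu] by simp
      qed
    qed (use tU(1)[OF uu'] in blast)
    show "continuous_on U (t u u')" by (rule cont[OF uu])
    show "continuous_on U (t u' u)" by (rule cont[OF uu'])
    show "t u' u (t u u' v) = v" "t u u' (t u' u v) = v" if "v \<in> U" for v
      by (rule inv[OF uu that], rule inv[OF uu' that])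
  qed
  have "t u u' \<in> Bij U"
  proof -
    have "inj_on (t u u') U" using hom inj_on_inverseI[of U "t u' u" "t u u'"] by (auto simp: homeomorphism_def)
    moreover have "t u u' ` U = U" using hom by (simp add: homeomorphism_def)
    moreover have "t u u' \<in> extensional U" by (simp add: t_def)
    ultimately show ?thesis by (simp add: Bij_def bij_betw_def)
  qed
  then have "t u u' \<in> carrier (deck_group U p)"
    using hom tU(2)[OF u(1,2,3)] by (auto simp: deck_group_def)
  moreover have "?M u u' u u'"
    unfolding lift_transport_def
    by (rule exI[of _ "\<lambda>_. u"], rule exI[of _ "\<lambda>_. u'"]) (use u in \<open>auto simp: path_def path_image_def\<close>)
  then have "t u u' u = u'"
    by (intro lift_transport_unique[OF cov U t[OF u(1,2,3) u(1)]])
  ultimately show ?thesis using that by blast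
qed

section \<open>Coordinates on the generalized Fermat curve\<close>

text \<open>The quotient x_j / x_m does not depend on the chosen representative. As division by zero
  gives 0, \<open>proj_ratio m m P\<close> is 1 or 0, and \<open>proj_ratio m m P \<noteq> 0\<close>
  is used throughout to express that the m-th homogeneous coordinate does not vanish.\<close>

definition proj_ratio :: "nat \<Rightarrow> nat \<Rightarrow> (nat \<Rightarrow> complex) set \<Rightarrow> complex" where
  "proj_ratio m j P = (let x = SOME x. x \<in> P in x j / x m)"

lemma proj_ratio_proj_point:
  assumes "m \<le> n" "j \<le> n"
  shows "proj_ratio m j (proj_point n x) = x j / x m"
proof -
  have "(\<lambda>i\<in>{..n}. 1 * x i) \<in> proj_point n x"
    unfolding proj_point_def by (rule CollectI, rule exI[of _ 1]) simp
  then have "(SOME y. y \<in> proj_point n x) \<in> proj_point n x"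
    by (rule someI[of "\<lambda>y. y \<in> proj_point n x"])
  then obtain c where "c \<noteq> 0" "(SOME y. y \<in> proj_point n x) = (\<lambda>i\<in>{..n}. c * x i)"
    by (auto simp: proj_point_def)
  then show ?thesis
    using assms by (simp add: proj_ratio_def)
qed

lemma proj_point_scale:
  assumes "c \<noteq> 0" "\<And>i. i \<le> n \<Longrightarrow> y i = c * x i"
  shows "proj_point n y = proj_point n x"
proof -
  have sub: "proj_point n y \<subseteq> proj_point n x"
    if "c \<noteq> 0" "\<And>i. i \<le> n \<Longrightarrow> y i = c * x i" for c x y
  proof
    fix z assume "z \<in> proj_point n y"
    then obtain d where d: "d \<noteq> 0" "z = (\<lambda>i\<in>{..n}. d * y i)" by (auto simp: proj_point_def)
    have "z = (\<lambda>i\<in>{..n}. (d * c) * x i)"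
      unfolding d(2) by (rule restrict_ext) (simp add: that(2))
    moreover have "d * c \<noteq> 0" using d(1) that(1) by simp
    ultimately show "z \<in> proj_point n x" unfolding proj_point_def by blast
  qed
  show ?thesis
    using sub[of c y x] sub[of "1 / c" x y] assms by (simp add: subset_antisym)
qed

lemma proj_point_cong:
  assumes "\<And>i. i \<le> n \<Longrightarrow> y i = x i"
  shows "proj_point n y = proj_point n x"
  using proj_point_scale[of 1 n y x] assms by simp

lemma proj_point_restrict: "proj_point n (restrict x {..n}) = proj_point n x"
  by (rule proj_point_cong) simp

lemma topspace_punctured_space:
  "topspace (punctured_space n) = {x \<in> extensional {..n}. \<exists>i\<le>n. x i \<noteq> 0}"
proof -
  have "x = (\<lambda>i\<in>{..n}. 0) \<longleftrightarrow> \<not> (\<exists>i\<le>n. x i \<noteq> 0)" if "x \<in> extensional {..n}" for x :: "nat \<Rightarrow> complex"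
    using that by (auto simp: fun_eq_iff extensional_def)
  then show ?thesis
    by (auto simp: punctured_space_def PiE_def)
qed

lemma proj_point_in_proj_space:
  "\<exists>i\<le>n. x i \<noteq> 0 \<Longrightarrow> proj_point n x \<in> topspace (proj_space n)"
  unfolding topspace_proj_space topspace_punctured_space
  by (rule image_eqI[of _ "proj_point n" "restrict x {..n}", OF proj_point_restrict[symmetric]]) auto

lemma proj_space_cases:
  assumes "P \<in> topspace (proj_space n)"
  obtains x where "P = proj_point n x" "\<exists>i\<le>n. x i \<noteq> 0"
proof -
  obtain y where "y \<in> topspace (punctured_space n)" "P = proj_point n y"
    using assms unfolding topspace_proj_space by blast
  then show ?thesis using that[of y] by (simp add: topspace_punctured_space)
qed

lemma proj_space_normalize:
  assumes "P \<in> topspace (proj_space n)" "m \<le> n" "proj_ratio m m P \<noteq> 0"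
  shows "P = proj_point n (\<lambda>j. proj_ratio m j P)"
proof -
  obtain x where x: "P = proj_point n x" using assms(1) proj_space_cases by metis
  have r: "proj_ratio m j P = x j / x m" if "j \<le> n" for j
    unfolding x using proj_ratio_proj_point assms(2) that by blast
  then have "x m \<noteq> 0" using assms(2,3) by auto
  then have "proj_point n (\<lambda>j. proj_ratio m j P) = proj_point n x"
    by (intro proj_point_scale[of "1 / x m"]) (auto simp: r)
  then show ?thesis using x by simp
qed

lemma continuous_map_coordinate:
  "j \<le> n \<Longrightarrow> continuous_map (punctured_space n) euclidean (\<lambda>x. x j)"
  unfolding punctured_space_def
  using continuous_map_from_subtopology[OF continuous_map_product_projection[of j "{..n}" "\<lambda>_. euclidean :: complex topology"]]
  by simp

text \<open>Openness in the quotient topology is openness of the preimage in the punctured space,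
  where the condition concerns only the pair of coordinates \<open>(x m, x j)\<close>.\<close>

lemma openin_proj_ratio_vimage:
  assumes "m \<le> n" "j \<le> n" "open S"
  shows "openin (proj_space n) {P \<in> topspace (proj_space n). proj_ratio m m P \<noteq> 0 \<and> proj_ratio m j P \<in> S}"
    (is "openin _ ?V")
proof -
  let ?A = "{ab :: complex \<times> complex. fst ab \<noteq> 0 \<and> snd ab / fst ab \<in> S}"
  have "open (UNIV - {0::complex})" by auto
  then have o: "open ((UNIV - {0::complex}) \<times> (UNIV :: complex set))" by (intro open_Times) auto
  have "continuous_on ((UNIV - {0::complex}) \<times> (UNIV :: complex set)) (\<lambda>ab. snd ab / fst ab)"
    by (auto intro!: continuous_intros)
  then have "open (((UNIV - {0::complex}) \<times> UNIV) \<inter> (\<lambda>ab. snd ab / fst ab) -` S)"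
    by (rule continuous_open_preimage[OF _ o assms(3)])
  moreover have "?A = ((UNIV - {0::complex}) \<times> UNIV) \<inter> (\<lambda>ab. snd ab / fst ab) -` S" by auto
  ultimately have "open ?A" by simp
  moreover have "continuous_map (punctured_space n) euclidean (\<lambda>x. (x m, x j))"
    using continuous_map_coordinate[OF assms(1)] continuous_map_coordinate[OF assms(2)]
      continuous_map_paired[of "punctured_space n" euclidean euclidean "\<lambda>x. x m" "\<lambda>x. x j"] by simp
  ultimately have "openin (punctured_space n) {x \<in> topspace (punctured_space n). (x m, x j) \<in> ?A}"
    by (intro openin_continuous_map_preimage) auto
  moreover have "{x \<in> topspace (punctured_space n). proj_point n x \<in> ?V} =
      {x \<in> topspace (punctured_space n). (x m, x j) \<in> ?A}"
    using assms by (auto simp: topspace_proj_space proj_ratio_proj_point)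
  moreover have "?V \<subseteq> proj_point n ` topspace (punctured_space n)"
    by (auto simp: topspace_proj_space)
  ultimately show ?thesis unfolding openin_proj_space by simp
qed

lemma openin_proj_coordinate:
  assumes "m \<le> n"
  shows "openin (proj_space n) {P \<in> topspace (proj_space n). proj_ratio m m P \<noteq> 0}"
  using openin_proj_ratio_vimage[OF assms assms open_UNIV] by simp

lemma continuous_map_proj_ratio:
  assumes "m \<le> n" "j \<le> n"
  shows "continuous_map (subtopology (proj_space n) {P. proj_ratio m m P \<noteq> 0}) euclidean (proj_ratio m j)"
proof -
  have "openin (subtopology (proj_space n) {P. proj_ratio m m P \<noteq> 0})
     {P \<in> topspace (subtopology (proj_space n) {P. proj_ratio m m P \<noteq> 0}). proj_ratio m j P \<in> S}"
    if "open S" for S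
    unfolding openin_subtopology
    by (rule exI[of _ "{P \<in> topspace (proj_space n). proj_ratio m m P \<noteq> 0 \<and> proj_ratio m j P \<in> S}"])
       (use openin_proj_ratio_vimage[OF assms that] in auto)
  then show ?thesis by (auto simp: continuous_map_def)
qed

lemma continuous_map_proj_point:
  assumes f: "\<And>i. i \<le> n \<Longrightarrow> continuous_map X euclidean (\<lambda>u. f u i)"
    and nz: "\<And>u. u \<in> topspace X \<Longrightarrow> \<exists>i\<le>n. f u i \<noteq> 0"
  shows "continuous_map X (proj_space n) (\<lambda>u. proj_point n (f u))"
proof -
  have "continuous_map X (product_topology (\<lambda>_. euclidean) {..n}) (\<lambda>u. restrict (f u) {..n})"
    unfolding continuous_map_componentwise
    by (auto intro: continuous_map_eq[OF f])
  then have "continuous_map X (punctured_space n) (\<lambda>u. restrict (f u) {..n})"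
    unfolding punctured_space_def continuous_map_in_subtopology
  proof (intro conjI)
    show "(\<lambda>u. restrict (f u) {..n}) \<in> topspace X \<rightarrow> - {\<lambda>i\<in>{..n}. 0}"
    proof clarsimp
      fix u assume "u \<in> topspace X" and eq: "restrict (f u) {..n} = (\<lambda>i\<in>{..n}. 0)"
      then obtain i where "i \<le> n" "f u i \<noteq> 0" using nz by blast
      then show False using fun_cong[OF eq, of i] by simp
    qed
  qed
  then have "continuous_map X (proj_space n) (proj_point n \<circ> (\<lambda>u. restrict (f u) {..n}))"
    using quotient_imp_continuous_map[OF quotient_map_proj_point] by (rule continuous_map_compose)
  then show ?thesis by (simp add: o_def proj_point_restrict)
qed

text \<open>The sign in p_1 = -p, against p_i = p - r_i for the other indices.\<close>

definition branch_sign :: "nat \<Rightarrow> complex" where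
  "branch_sign i = (if i = 1 then -1 else 1)"

lemma branch_sign_square [simp]: "branch_sign i * branch_sign i = 1" "branch_sign i \<noteq> 0"
  by (auto simp: branch_sign_def)

definition fermat_solution :: "nat \<Rightarrow> nat \<Rightarrow> (nat \<Rightarrow> complex) \<Rightarrow> (nat \<Rightarrow> complex) \<Rightarrow> bool" where
  "fermat_solution k n lam x \<longleftrightarrow> (\<forall>i\<in>{2..n}. branch_pt lam i * x 0 ^ k + x 1 ^ k + x i ^ k = 0)"

text \<open>
  In the coordinate \<open>Y = - x\<^sub>1\<^sup>k\<close> all coordinates \<open>x\<^sub>i\<close> with \<open>i \<ge> 1\<close>
  enter in the same way, up to a sign.
\<close>

lemma fermat_solution_iff:
  assumes "1 \<le> n"
  shows "fermat_solution k n lam x \<longleftrightarrow>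
    (\<exists>Y. \<forall>i\<in>{1..n}. x i ^ k = branch_sign i * (Y - branch_pt lam i * x 0 ^ k))"
    (is "_ \<longleftrightarrow> (\<exists>Y. ?R Y)")
proof
  assume s: "fermat_solution k n lam x"
  have "?R (- (x 1 ^ k))"
  proof
    fix i assume "i \<in> {1..n}"
    then consider "i = 1" | "i \<in> {2..n}" "i \<noteq> 1" by force
    then show "x i ^ k = branch_sign i * (- (x 1 ^ k) - branch_pt lam i * x 0 ^ k)"
    proof cases
      case 1
      then show ?thesis by (simp add: branch_sign_def branch_pt_def)
    next
      case 2
      then have "branch_pt lam i * x 0 ^ k + x 1 ^ k + x i ^ k = 0"
        using s by (auto simp: fermat_solution_def)
      then have "x i ^ k = - (x 1 ^ k) - branch_pt lam i * x 0 ^ k"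
        by (simp add: add_eq_0_iff2 algebra_simps)
      then show ?thesis using 2 by (simp add: branch_sign_def)
    qed
  qed
  then show "\<exists>Y. ?R Y" by blast
next
  assume "\<exists>Y. ?R Y"
  then obtain Y where Y: "?R Y" by blast
  then have 1: "x 1 ^ k = - Y" using assms by (simp add: branch_sign_def branch_pt_def)
  show "fermat_solution k n lam x"
    unfolding fermat_solution_def
  proof
    fix i assume "i \<in> {2..n}"
    then have "x i ^ k = Y - branch_pt lam i * x 0 ^ k"
      using Y by (auto simp: branch_sign_def)
    then show "branch_pt lam i * x 0 ^ k + x 1 ^ k + x i ^ k = 0"
      using 1 by (simp add: algebra_simps)
  qed
qed

lemma fermat_solution_scale:
  assumes "\<And>i. i \<le> n \<Longrightarrow> y i = c * x i" "c \<noteq> 0" "1 \<le> n"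
  shows "fermat_solution k n lam y \<longleftrightarrow> fermat_solution k n lam x"
proof -
  have "branch_pt lam i * y 0 ^ k + y 1 ^ k + y i ^ k =
      c ^ k * (branch_pt lam i * x 0 ^ k + x 1 ^ k + x i ^ k)" if "i \<in> {2..n}" for i
    using that assms by (simp add: power_mult_distrib algebra_simps)
  then show ?thesis using assms(2) by (simp add: fermat_solution_def)
qed

lemma proj_point_eqE:
  assumes "proj_point n y = proj_point n x"
  obtains c where "c \<noteq> 0" "\<And>i. i \<le> n \<Longrightarrow> y i = c * x i"
proof -
  have "(\<lambda>i\<in>{..n}. 1 * y i) \<in> proj_point n x"
    unfolding assms[symmetric] by (unfold proj_point_def, rule CollectI, rule exI[of _ 1]) simp
  then obtain c where c: "c \<noteq> 0" "(\<lambda>i\<in>{..n}. 1 * y i) = (\<lambda>i\<in>{..n}. c * x i)"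
    by (auto simp: proj_point_def)
  have "y i = c * x i" if "i \<le> n" for i
    using fun_cong[OF c(2), of i] that by simp
  then show ?thesis using that c(1) by blast
qed

section \<open>Point sets of the curve and of the punctured curve\<close>

lemma topspace_fermat_curve:
  "topspace (fermat_curve k n lam) = {proj_point n x | x. (\<exists>i\<le>n. x i \<noteq> 0) \<and> fermat_solution k n lam x}"
    if "1 \<le> n"
proof -
  have "proj_point n x \<in> topspace (fermat_curve k n lam)" if x: "\<exists>i\<le>n. x i \<noteq> 0" "fermat_solution k n lam x" for x
  proof -
    have "fermat_solution k n lam (restrict x {..n})"
      using fermat_solution_scale[of n "restrict x {..n}" 1 x] x \<open>1 \<le> n\<close> by simp
    moreover have "restrict x {..n} \<in> topspace (punctured_space n)"
      using x by (auto simp: topspace_punctured_space)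
    ultimately show ?thesis
      using proj_point_in_proj_space[OF x(1)] proj_point_restrict[of n x, symmetric]
      unfolding fermat_curve_def fermat_solution_def by auto
  qed
  then show ?thesis
    by (auto simp: fermat_curve_def fermat_solution_def topspace_punctured_space)
qed

lemma proj_point_in_fermat_curve:
  assumes "1 \<le> n" "\<exists>i\<le>n. x i \<noteq> 0"
  shows "proj_point n x \<in> topspace (fermat_curve k n lam) \<longleftrightarrow> fermat_solution k n lam x"
proof
  assume "proj_point n x \<in> topspace (fermat_curve k n lam)"
  then obtain y where y: "proj_point n x = proj_point n y" "fermat_solution k n lam y"
    by (auto simp: topspace_fermat_curve[OF assms(1)])
  obtain c where "c \<noteq> 0" "\<And>i. i \<le> n \<Longrightarrow> x i = c * y i" using proj_point_eqE[OF y(1)] by metis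
  then show "fermat_solution k n lam x"
    using fermat_solution_scale[of n x c y] y(2) assms(1) by simp
next
  assume "fermat_solution k n lam x"
  then show "proj_point n x \<in> topspace (fermat_curve k n lam)"
    unfolding topspace_fermat_curve[OF assms(1)] using assms(2) by blast
qed

lemma fermat_curve_subset_proj_space: "topspace (fermat_curve k n lam) \<subseteq> topspace (proj_space n)"
  by (simp add: fermat_curve_def)

text \<open>Since \<pi>(P) = Y / x_0^k and x_i^k is, up to sign, Y - r_i x_0^k, the value infinity
  means x_0 = 0 and the value r_i means x_i = 0.\<close>

lemma topspace_fermat_curve':
  assumes "1 \<le> n" "0 < k"
  shows "topspace (fermat_curve' k n lam) =
    {P \<in> topspace (fermat_curve k n lam). \<forall>j\<le>n. proj_ratio j j P \<noteq> 0}"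
proof -
  have "fermat_map k P \<notin> insert None (Some ` branch_set n lam) \<longleftrightarrow> (\<forall>j\<le>n. proj_ratio j j P \<noteq> 0)"
    if P: "P \<in> topspace (fermat_curve k n lam)" for P
  proof -
    obtain x where x: "P = proj_point n x" "fermat_solution k n lam x"
      using P unfolding topspace_fermat_curve[OF assms(1)] by (auto intro: that)
    obtain Y where Y: "\<forall>i\<in>{1..n}. x i ^ k = branch_sign i * (Y - branch_pt lam i * x 0 ^ k)"
      using x(2) fermat_solution_iff[OF assms(1)] by blast
    have x1: "x 1 ^ k = - Y" using Y assms(1) by (simp add: branch_sign_def branch_pt_def)
    have xi: "x i \<noteq> 0 \<longleftrightarrow> Y / x 0 ^ k \<noteq> branch_pt lam i" if "x 0 \<noteq> 0" "i \<in> {1..n}" for i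
    proof -
      have "x i = 0 \<longleftrightarrow> x i ^ k = 0" using assms(2) by simp
      also have "\<dots> \<longleftrightarrow> Y - branch_pt lam i * x 0 ^ k = 0" using Y that by simp
      also have "\<dots> \<longleftrightarrow> Y / x 0 ^ k = branch_pt lam i" using that(1) by (simp add: field_simps)
      finally show ?thesis by blast
    qed
    have "fermat_map k P = (if x 0 = 0 then None else Some (Y / x 0 ^ k))"
      unfolding x(1) fermat_map_proj_point[OF assms(1)] using x1 by (simp add: power_divide)
    then have "fermat_map k P \<notin> insert None (Some ` branch_set n lam) \<longleftrightarrow>
        x 0 \<noteq> 0 \<and> (\<forall>i\<in>{1..n}. x i \<noteq> 0)"
      using xi by (auto simp: branch_set_def)
    also have "\<dots> \<longleftrightarrow> (\<forall>j\<le>n. x j \<noteq> 0)"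
      by (metis (no_types) atLeastAtMost_iff le0 less_one not_less)
    also have "\<dots> \<longleftrightarrow> (\<forall>j\<le>n. proj_ratio j j P \<noteq> 0)"
      unfolding x(1) by (auto simp: proj_ratio_proj_point)
    finally show ?thesis .
  qed
  then have "P \<in> topspace (fermat_curve k n lam) \<inter> - (fermat_map k -` insert None (Some ` branch_set n lam)) \<longleftrightarrow>
      P \<in> {P \<in> topspace (fermat_curve k n lam). \<forall>j\<le>n. proj_ratio j j P \<noteq> 0}" for P
    by blast
  then show ?thesis
    unfolding fermat_curve'_def topspace_subtopology by blast
qed

lemma openin_fermat_curve':
  assumes "1 \<le> n" "0 < k"
  shows "openin (fermat_curve k n lam) (topspace (fermat_curve' k n lam))"
proof -
  let ?C = "fermat_curve k n lam"
  have "openin ?C {P \<in> topspace ?C. proj_ratio j j P \<noteq> 0}" if "j \<le> n" for j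
  proof -
    have "{P \<in> topspace ?C. proj_ratio j j P \<noteq> 0} =
        {P \<in> topspace (proj_space n). proj_ratio j j P \<noteq> 0} \<inter> topspace ?C"
      using fermat_curve_subset_proj_space by blast
    moreover have "?C = subtopology (proj_space n) (topspace ?C)"
      by (simp only: fermat_curve_def topspace_subtopology subtopology_restrict)
    ultimately show ?thesis
      using openin_subtopology_Int[OF openin_proj_coordinate[OF that], of "topspace ?C"] by metis
  qed
  then have "openin ?C (\<Inter>j\<in>{..n}. {P \<in> topspace ?C. proj_ratio j j P \<noteq> 0})"
    by (intro openin_Inter) auto
  then show ?thesis
    unfolding topspace_fermat_curve'[OF assms] by (rule back_subst[of "openin _"]) auto
qed

lemma fermat_curve'_subtopology:
  "fermat_curve' k n lam = subtopology (fermat_curve k n lam) (topspace (fermat_curve' k n lam))"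
  unfolding fermat_curve'_def by (simp only: topspace_subtopology subtopology_restrict)

lemma fermat_curve'_proj_space:
  "fermat_curve' k n lam = subtopology (proj_space n) (topspace (fermat_curve' k n lam))"
  unfolding fermat_curve'_def fermat_curve_def subtopology_subtopology
  by (simp only: topspace_subtopology subtopology_restrict)

section \<open>The principal k-th root near 1\<close>

definition principal_root :: "nat \<Rightarrow> complex \<Rightarrow> complex" where
  "principal_root k w = exp (Ln (1 + w) / of_nat k)"

text \<open>The sector of arguments below pi/k in absolute value, on which y |-> y^k is injective.
  Leaving out the nonpositive axis keeps \<open>Ln\<close> continuous, so the sector is
  open.\<close>

definition root_sector :: "nat \<Rightarrow> complex set" where
  "root_sector k = - \<real>\<^sub>\<le>\<^sub>0 \<inter> (\<lambda>y. \<bar>Im (Ln y)\<bar>) -` {..<pi / of_nat k}"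

lemma open_root_sector: "open (root_sector k)"
  unfolding root_sector_def
  by (rule continuous_open_preimage) (auto intro!: continuous_intros simp: open_Compl)

lemma one_plus_small:
  fixes w :: complex
  assumes "norm w < 1"
  shows "1 + w \<noteq> 0" "1 + w \<notin> \<real>\<^sub>\<le>\<^sub>0" "0 < Re (1 + w)"
proof -
  have "\<bar>Re w\<bar> < 1" using abs_Re_le_cmod[of w] assms by linarith
  then show re: "0 < Re (1 + w)" by simp
  then show "1 + w \<noteq> 0" by (metis less_irrefl zero_complex.simps(1))
  show "1 + w \<notin> \<real>\<^sub>\<le>\<^sub>0" using re by (simp add: complex_nonpos_Reals_iff)
qed

lemma principal_root_0 [simp]: "principal_root k 0 = 1"
  by (simp add: principal_root_def)

lemma principal_root_nonzero: "principal_root k w \<noteq> 0"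
  by (simp add: principal_root_def)

lemma principal_root_power:
  assumes "norm w < 1" "0 < k"
  shows "principal_root k w ^ k = 1 + w"
proof -
  have "principal_root k w ^ k = exp (of_nat k * (Ln (1 + w) / of_nat k))"
    unfolding principal_root_def by (rule exp_of_nat_mult[symmetric])
  also have "\<dots> = 1 + w"
    using one_plus_small(1)[OF assms(1)] assms(2) by simp
  finally show ?thesis .
qed

lemma continuous_on_principal_root:
  assumes "0 < k"
  shows "continuous_on (ball 0 1) (principal_root k)"
  unfolding principal_root_def
  by (intro continuous_intros) (use one_plus_small(2) assms in auto)

text \<open>\<open>1 + w\<close> has positive real part, hence argument below pi/2, and the root has
  argument below pi/(2k).\<close>

lemma principal_root_in_sector:
  assumes "norm w < 1" "0 < k"
  shows "principal_root k w \<in> root_sector k"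
proof -
  let ?z = "Ln (1 + w) / of_nat k"
  have "\<bar>Im (Ln (1 + w))\<bar> < pi / 2"
    using Re_Ln_pos_lt[OF one_plus_small(1)] one_plus_small(3) assms(1) by blast
  then have "\<bar>Im (Ln (1 + w))\<bar> / k < pi / 2 / k"
    using assms(2) by (intro divide_strict_right_mono) auto
  then have im: "\<bar>Im ?z\<bar> < pi / 2 / k" by simp
  also have "\<dots> \<le> pi / 2" using assms(2) by (simp add: divide_le_eq)
  finally have im2: "\<bar>Im ?z\<bar> < pi / 2" .
  then have "0 < cos (Im ?z)" by (intro cos_gt_zero_pi) linarith+
  then have "0 < Re (exp ?z)" by (simp only: Re_exp mult_pos_pos exp_gt_zero)
  then have "exp ?z \<notin> \<real>\<^sub>\<le>\<^sub>0" by (simp add: complex_nonpos_Reals_iff)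
  moreover have "- pi < Im ?z" "Im ?z \<le> pi" using im2 pi_gt_zero by linarith+
  then have "Ln (exp ?z) = ?z" by (rule Ln_exp)
  moreover have "pi / 2 / k < pi / k"
    using assms(2) pi_gt_zero by (intro divide_strict_right_mono) auto
  ultimately show ?thesis
    using im unfolding root_sector_def principal_root_def by auto
qed

text \<open>In the sector \<open>of_nat k * Ln y\<close> has imaginary part between -pi and pi, so
  it is the principal logarithm of \<open>y ^ k\<close>.\<close>

lemma principal_root_unique:
  assumes y: "y \<in> root_sector k" "y ^ k = 1 + w" and "norm w < 1" "0 < k"
  shows "principal_root k w = y"
proof -
  have "y \<noteq> 0" using y(1) by (auto simp: root_sector_def)
  then have ey: "exp (Ln y) = y" by simp
  have "\<bar>Im (Ln y)\<bar> < pi / k" using y(1) by (simp add: root_sector_def)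
  then have "\<bar>Im (of_nat k * Ln y)\<bar> < pi"
    using assms(4) by (simp add: abs_mult field_simps)
  then have "Ln (exp (of_nat k * Ln y)) = of_nat k * Ln y"
    by (intro Ln_exp) linarith+
  moreover have "exp (of_nat k * Ln y) = y ^ k" by (simp only: exp_of_nat_mult ey)
  ultimately have "Ln (1 + w) = of_nat k * Ln y" using y(2) by simp
  then show ?thesis using assms(4) ey by (simp add: principal_root_def)
qed

text \<open>A local coordinate \<open>g\<close> around a point \<open>b\<close> with its
  parametrisation \<open>f\<close>. The one-sided law \<open>f (g P) = P\<close> suits the
  application: a path in \<open>D\<close> is sent to the disc by \<open>g\<close>, altered there,
  and compared through \<open>f\<close>.\<close>

definition fermat_disc ::
  "nat \<Rightarrow> nat \<Rightarrow> (nat \<Rightarrow> complex) \<Rightarrow> (nat \<Rightarrow> complex) set \<Rightarrow> real \<Rightarrow>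
    (complex \<Rightarrow> (nat \<Rightarrow> complex) set) \<Rightarrow> ((nat \<Rightarrow> complex) set \<Rightarrow> complex) \<Rightarrow> (nat \<Rightarrow> complex) set set \<Rightarrow> bool" where
  "fermat_disc k n lam b \<epsilon> f g D \<longleftrightarrow> 0 < \<epsilon> \<and> openin (fermat_curve k n lam) D \<and> b \<in> D \<and> f 0 = b \<and>
     continuous_map (top_of_set (ball 0 \<epsilon>)) (fermat_curve k n lam) f \<and>
     continuous_map (subtopology (fermat_curve k n lam) D) (top_of_set (ball 0 \<epsilon>)) g \<and>
     (\<forall>P\<in>D. f (g P) = P) \<and> f ` (ball 0 \<epsilon> - {0}) \<subseteq> topspace (fermat_curve' k n lam)"

text \<open>
  Near a point with \<open>x\<^sub>i = 0\<close>, normalised by \<open>x\<^sub>m = 1\<close>, the curve is the graph of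
  principal roots over the coordinate \<open>x\<^sub>i\<close>.
\<close>

lemma fermat_disc_normalized:
  assumes kn: "0 < k" "1 \<le> n" and im: "i \<le> n" "m \<le> n" "m \<noteq> i"
    and b: "b m = 1" "b i = 0" "\<And>j. j \<le> n \<Longrightarrow> j \<noteq> i \<Longrightarrow> b j \<noteq> 0" and \<gamma>m: "\<gamma> m = 0"
    and sol: "\<And>x. x m = 1 \<Longrightarrow> fermat_solution k n lam x \<longleftrightarrow>
      (\<forall>j\<in>{..n} - {i}. x j ^ k = b j ^ k * (1 + \<gamma> j * x i ^ k))"
  shows "\<exists>\<epsilon> f g D. fermat_disc k n lam (proj_point n b) \<epsilon> f g D"
proof -
  let ?C = "fermat_curve k n lam"
  \<comment> \<open>Then \<epsilon> \<le> 1 gives |t^k| \<le> |t| < \<epsilon>, and |\<gamma> j|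
    \<epsilon> < 1 for all \<open>j\<close> at once, so all principal roots of 1 + \<gamma> j t^k
    are defined on the disc.\<close>
  define \<epsilon> where "\<epsilon> = 1 / (1 + (\<Sum>j\<le>n. norm (\<gamma> j)))"
  have s0: "0 \<le> (\<Sum>j\<le>n. norm (\<gamma> j))" by (rule sum_nonneg) simp
  then have \<epsilon>: "0 < \<epsilon>" "\<epsilon> \<le> 1" by (simp_all add: \<epsilon>_def divide_le_eq)
  have small: "norm (\<gamma> j * t ^ k) < 1" if "t \<in> ball 0 \<epsilon>" "j \<le> n" for j t
  proof -
    have t: "norm t < \<epsilon>" "norm t \<le> 1" using that(1) \<epsilon>(2) by auto
    have "norm (t ^ k) \<le> norm t"
      using t(2) kn(1) power_decreasing[of 1 k "norm t"] by (simp add: norm_power)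
    then have "norm (\<gamma> j * t ^ k) \<le> norm (\<gamma> j) * \<epsilon>"
      using t by (simp add: norm_mult mult_left_mono)
    also have "\<dots> < 1"
    proof -
      have "norm (\<gamma> j) \<le> (\<Sum>j\<le>n. norm (\<gamma> j))"
        using that(2) by (intro member_le_sum) auto
      then show ?thesis using s0 by (simp add: \<epsilon>_def divide_less_eq)
    qed
    finally show ?thesis .
  qed
  define F where "F t j = (if j = i then t else b j * principal_root k (\<gamma> j * t ^ k))" for t j
  have Fm: "F t m = 1" for t using im b \<gamma>m by (simp add: F_def)
  have Fi: "F t i = t" for t by (simp add: F_def)
  have nz: "\<exists>j\<le>n. F t j \<noteq> 0" for t using Fm[of t] im(2) by (metis zero_neq_one)
  have F0: "F 0 j = b j" for j using b by (simp add: F_def zero_power[OF kn(1)])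
  have Fsol: "fermat_solution k n lam (F t)" if "t \<in> ball 0 \<epsilon>" for t
    using small[OF that] kn(1)
    by (subst sol[of "F t", OF Fm]) (auto simp: F_def power_mult_distrib principal_root_power)
  define f where "f t = proj_point n (F t)" for t
  define g where "g = proj_ratio m i"
  \<comment> \<open>Among the k solutions for each coordinate the sector selects the one near
    \<open>b j\<close>; this makes \<open>f (g P) = P\<close> hold on \<open>D\<close>.\<close>
  define S where "S j = (if j = i then ball 0 \<epsilon> else {z. z / b j \<in> root_sector k})" for j
  have S: "open (S j)" if "j \<le> n" for j
  proof (cases "j = i")
    case False
    have "open ((\<lambda>z. z / b j) -` root_sector k)"
      using b(3)[OF that False] by (intro open_vimage open_root_sector continuous_intros) auto
    then show ?thesis using False by (simp add: S_def vimage_def)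
  qed (simp add: S_def)
  define D where "D = {P \<in> topspace ?C. proj_ratio m m P \<noteq> 0 \<and> (\<forall>j\<le>n. proj_ratio m j P \<in> S j)}"
  have "openin ?C {P \<in> topspace ?C. proj_ratio m m P \<noteq> 0 \<and> proj_ratio m j P \<in> S j}" if "j \<le> n" for j
  proof -
    have "?C = subtopology (proj_space n) (topspace ?C)"
      by (simp only: fermat_curve_def topspace_subtopology subtopology_restrict)
    moreover have "openin (subtopology (proj_space n) (topspace ?C))
        ({P \<in> topspace (proj_space n). proj_ratio m m P \<noteq> 0 \<and> proj_ratio m j P \<in> S j} \<inter> topspace ?C)"
      by (intro openin_subtopology_Int openin_proj_ratio_vimage im that S)
    moreover have "{P \<in> topspace (proj_space n). proj_ratio m m P \<noteq> 0 \<and> proj_ratio m j P \<in> S j} \<inter> topspace ?C =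
        {P \<in> topspace ?C. proj_ratio m m P \<noteq> 0 \<and> proj_ratio m j P \<in> S j}"
      using fermat_curve_subset_proj_space by blast
    ultimately show ?thesis by simp
  qed
  then have "openin ?C (\<Inter>j\<in>{..n}. {P \<in> topspace ?C. proj_ratio m m P \<noteq> 0 \<and> proj_ratio m j P \<in> S j})"
    by (intro openin_Inter) auto
  moreover have "D = (\<Inter>j\<in>{..n}. {P \<in> topspace ?C. proj_ratio m m P \<noteq> 0 \<and> proj_ratio m j P \<in> S j})"
    by (auto simp: D_def)
  ultimately have D_open: "openin ?C D" by simp
  have rF: "proj_ratio m j (f t) = F t j" if "j \<le> n" for j t
    using proj_ratio_proj_point[OF im(2) that] Fm by (simp add: f_def)
  have fC: "f t \<in> topspace ?C" if "t \<in> ball 0 \<epsilon>" for t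
    unfolding f_def using Fsol[OF that] proj_point_in_fermat_curve[OF kn(2) nz] by simp
  have fD: "f t \<in> D" if t: "t \<in> ball 0 \<epsilon>" for t
  proof -
    have "F t j \<in> S j" if "j \<le> n" for j
      using t b(3)[OF that] small[OF t that] kn(1)
      by (auto simp: S_def F_def principal_root_in_sector)
    then show ?thesis using fC[OF t] rF Fm[of t] im(2) by (simp add: D_def)
  qed
  have fg: "f (g P) = P" if P: "P \<in> D" for P
  proof -
    let ?x = "\<lambda>j. proj_ratio m j P"
    have PC: "P \<in> topspace ?C" "proj_ratio m m P \<noteq> 0" and PS: "\<And>j. j \<le> n \<Longrightarrow> ?x j \<in> S j"
      using P by (auto simp: D_def)
    have Px: "P = proj_point n ?x"
      using proj_space_normalize[OF _ im(2) PC(2)] PC(1) fermat_curve_subset_proj_space by blast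
    have xm: "?x m = 1"
    proof -
      have "?x m = ?x m / ?x m"
        using proj_ratio_proj_point[OF im(2) im(2), of ?x] Px by simp
      then show ?thesis using PC(2) by simp
    qed
    then have "\<exists>j\<le>n. ?x j \<noteq> 0" using im(2) by (metis zero_neq_one)
    then have "fermat_solution k n lam ?x"
      using proj_point_in_fermat_curve[OF kn(2), of ?x] PC(1) Px by simp
    then have x: "?x j ^ k = b j ^ k * (1 + \<gamma> j * ?x i ^ k)" if "j \<le> n" "j \<noteq> i" for j
      using sol[of ?x, OF xm] that by simp
    have xi: "?x i \<in> ball 0 \<epsilon>" using PS[OF im(1)] by (simp add: S_def)
    have "F (g P) j = ?x j" if j: "j \<le> n" for j
    proof (cases "j = i")
      case True
      then show ?thesis by (simp add: F_def g_def)
    next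
      case False
      have bj: "b j \<noteq> 0" using b(3)[OF j False] .
      have "(?x j / b j) ^ k = 1 + \<gamma> j * ?x i ^ k"
        using x[OF j False] bj by (simp add: power_divide)
      moreover have "?x j / b j \<in> root_sector k" using PS[OF j] False by (simp add: S_def)
      ultimately have "principal_root k (\<gamma> j * ?x i ^ k) = ?x j / b j"
        using small[OF xi j] kn(1) by (intro principal_root_unique)
      then show ?thesis using False bj by (simp add: F_def g_def)
    qed
    then have "f (g P) = proj_point n ?x" unfolding f_def by (rule proj_point_cong)
    then show ?thesis using Px by simp
  qed
  have "continuous_map (top_of_set (ball 0 \<epsilon>)) (proj_space n) f"
    unfolding f_def
  proof (rule continuous_map_proj_point)
    fix j assume j: "j \<le> n"
    have "continuous_on (ball 0 \<epsilon>) (\<lambda>t. principal_root k (\<gamma> j * t ^ k))"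
      by (rule continuous_on_compose2[OF continuous_on_principal_root[OF kn(1)]])
         (use small j in \<open>auto intro!: continuous_intros\<close>)
    then show "continuous_map (top_of_set (ball 0 \<epsilon>)) euclidean (\<lambda>t. F t j)"
      by (cases "j = i") (auto simp: F_def intro!: continuous_intros)
  qed (use nz in auto)
  then have f_cont: "continuous_map (top_of_set (ball 0 \<epsilon>)) ?C f"
    using fC unfolding fermat_curve_def by (auto simp: continuous_map_in_subtopology)
  have "continuous_map (subtopology (proj_space n) {P. proj_ratio m m P \<noteq> 0}) euclidean g"
    unfolding g_def by (rule continuous_map_proj_ratio[OF im(2) im(1)])
  then have "continuous_map (subtopology (proj_space n) D) euclidean g"
    by (rule continuous_map_from_subtopology_mono) (auto simp: D_def)
  moreover have "subtopology ?C D = subtopology (proj_space n) D"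
  proof -
    have "topspace ?C \<inter> D = D" by (auto simp: D_def)
    moreover have "?C = subtopology (proj_space n) (topspace ?C)"
      by (simp only: fermat_curve_def topspace_subtopology subtopology_restrict)
    ultimately show ?thesis by (metis subtopology_subtopology)
  qed
  ultimately have "continuous_map (subtopology ?C D) euclidean g" by simp
  moreover have "g P \<in> ball 0 \<epsilon>" if "P \<in> D" for P
  proof -
    have "proj_ratio m i P \<in> S i" using that im(1) by (simp add: D_def)
    then show ?thesis by (simp add: S_def g_def)
  qed
  ultimately have g_cont: "continuous_map (subtopology ?C D) (top_of_set (ball 0 \<epsilon>)) g"
    by (auto simp: continuous_map_in_subtopology)
  have "f t \<in> topspace (fermat_curve' k n lam)" if t: "t \<in> ball 0 \<epsilon> - {0}" for t
  proof -
    have "F t j \<noteq> 0" if "j \<le> n" for j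
      using t b(3)[OF that] principal_root_nonzero by (auto simp: F_def)
    then have "proj_ratio j j (f t) \<noteq> 0" if "j \<le> n" for j
      using proj_ratio_proj_point[OF that that, of "F t"] that by (simp add: f_def)
    then show ?thesis
      using fC t by (simp add: topspace_fermat_curve'[OF kn(2,1)])
  qed
  moreover have f0: "f 0 = proj_point n b" unfolding f_def by (rule proj_point_cong) (rule F0)
  moreover have "proj_point n b \<in> D" using fD[of 0] \<epsilon>(1) f0 by simp
  ultimately have "fermat_disc k n lam (proj_point n b) \<epsilon> f g D"
    unfolding fermat_disc_def using \<epsilon>(1) D_open f_cont g_cont fg by blast
  then show ?thesis by blast
qed

text \<open>A missing point has a vanishing coordinate. If it is x_0, the point lies over infinity
  and is normalised by x_1 = 1; otherwise it lies over r_i and is normalised by x_0 = 1.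
  Distinctness of the branch points excludes a second vanishing coordinate.\<close>

lemma fermat_disc_exists:
  assumes kn: "0 < k" "1 \<le> n" and inj: "inj_on (branch_pt lam) {1..n}"
    and P: "P \<in> topspace (fermat_curve k n lam) - topspace (fermat_curve' k n lam)"
  shows "\<exists>\<epsilon> f g D. fermat_disc k n lam P \<epsilon> f g D"
proof -
  obtain x where x: "P = proj_point n x" "fermat_solution k n lam x" "\<exists>i\<le>n. x i \<noteq> 0"
    using P unfolding topspace_fermat_curve[OF kn(2)] by blast
  obtain Y where Y: "\<And>i. i \<in> {1..n} \<Longrightarrow> x i ^ k = branch_sign i * (Y - branch_pt lam i * x 0 ^ k)"
    using x(2) fermat_solution_iff[OF kn(2)] by blast
  have "\<exists>i\<le>n. proj_ratio i i P = 0"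
    using P unfolding topspace_fermat_curve'[OF kn(2,1)] by blast
  then obtain i where i: "i \<le> n" "x i = 0"
    by (auto simp: x(1) proj_ratio_proj_point split: if_splits)
  have r1: "branch_pt lam 1 = 0" by (simp add: branch_pt_def)
  have sq: "branch_sign a * (branch_sign a * z) = z" for a z
    by (simp add: mult.assoc[symmetric])
  show ?thesis
  proof (cases "i = 0")
    case True
    have x0: "x 0 = 0" using i True by simp
    have Y0: "Y \<noteq> 0"
    proof
      assume "Y = 0"
      then have "x j ^ k = 0" if "j \<in> {1..n}" for j using Y[OF that] x0 kn(1) by simp
      then have "x j = 0" if "j \<le> n" for j
        using that x0 by (cases "j = 0") auto
      then show False using x(3) by blast
    qed
    have x1: "x 1 ^ k = - Y" using Y[of 1] x0 kn by (simp add: branch_sign_def)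
    then have x1nz: "x 1 \<noteq> 0" using Y0 kn(1) by (metis neg_equal_0_iff_equal zero_power)
    define b where "b j = x j / x 1" for j
    have bk: "b j ^ k = - branch_sign j" if "j \<in> {1..n}" for j
    proof -
      have "x j ^ k = branch_sign j * Y" using Y[OF that] kn(1) by (simp add: x0 zero_power)
      then show ?thesis using x1 Y0 by (simp add: b_def power_divide)
    qed
    \<comment> \<open>With y_1 = 1 the parameter Y is -1, so y_j^k = - \<open>branch_sign j\<close>
      (1 + r_j y_0^k): the coefficients are the branch points themselves, and r_1 = 0 is the
      required value at the normalised index.\<close>
    have "\<exists>\<epsilon> f g D. fermat_disc k n lam (proj_point n b) \<epsilon> f g D"
    proof (rule fermat_disc_normalized[OF kn, of 0 1 b "branch_pt lam"])
      show "b 1 = 1" "b 0 = 0" using x1nz x0 by (simp_all add: b_def)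
      show "b j \<noteq> 0" if "j \<le> n" "j \<noteq> 0" for j
      proof -
        have "b j ^ k \<noteq> 0" using bk[of j] that by (simp add: branch_sign_def)
        then show ?thesis using kn(1) by auto
      qed
      fix y :: "nat \<Rightarrow> complex" assume y1: "y 1 = 1"
      have eq: "b j ^ k * (1 + branch_pt lam j * y 0 ^ k) = branch_sign j * (- 1 - branch_pt lam j * y 0 ^ k)"
        if "j \<in> {1..n}" for j
        using bk[OF that] by (simp add: algebra_simps)
      have "fermat_solution k n lam y \<longleftrightarrow>
          (\<forall>j\<in>{1..n}. y j ^ k = branch_sign j * (- 1 - branch_pt lam j * y 0 ^ k))"
      proof
        assume "fermat_solution k n lam y"
        then obtain Z where Z: "\<forall>j\<in>{1..n}. y j ^ k = branch_sign j * (Z - branch_pt lam j * y 0 ^ k)"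
          using fermat_solution_iff[OF kn(2)] by blast
        have "1 \<in> {1..n}" using kn(2) by simp
        with Z have "y 1 ^ k = branch_sign 1 * (Z - branch_pt lam 1 * y 0 ^ k)" by blast
        then have "1 = - Z" using y1 r1 by (simp add: branch_sign_def)
        then have "Z = - 1" by (metis minus_minus)
        with Z show "\<forall>j\<in>{1..n}. y j ^ k = branch_sign j * (- 1 - branch_pt lam j * y 0 ^ k)"
          using Z by simp
      qed (use fermat_solution_iff[OF kn(2)] in blast)
      also have "\<dots> \<longleftrightarrow> (\<forall>j\<in>{..n} - {0}. y j ^ k = b j ^ k * (1 + branch_pt lam j * y 0 ^ k))"
        using eq by (auto simp: Suc_le_eq)
      finally show "fermat_solution k n lam y \<longleftrightarrow>
          (\<forall>j\<in>{..n} - {0}. y j ^ k = b j ^ k * (1 + branch_pt lam j * y 0 ^ k))" .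
    qed (use kn r1 in auto)
    moreover have "proj_point n b = P"
      unfolding x(1) by (rule proj_point_scale[of "1 / x 1"]) (use x1nz in \<open>simp_all add: b_def\<close>)
    ultimately show ?thesis by simp
  next
    case False
    then have i1: "i \<in> {1..n}" using i by simp
    define r where "r = branch_pt lam i"
    have Yi: "Y = r * x 0 ^ k"
      using Y[OF i1] zero_power[OF kn(1), where 'a = complex] by (simp add: r_def i(2))
    have x0: "x 0 \<noteq> 0"
    proof
      assume x0: "x 0 = 0"
      then have "x j ^ k = 0" if "j \<in> {1..n}" for j
        using Y[OF that] Yi zero_power[OF kn(1), where 'a = complex] by simp
      then have "x j = 0" if "j \<le> n" for j
        using that x0 by (cases "j = 0") auto
      then show False using x(3) by blast
    qed
    define b where "b j = x j / x 0" for j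
    have bk: "b j ^ k = branch_sign j * (r - branch_pt lam j)" if "j \<in> {1..n}" for j
      using Y[OF that] Yi x0 by (simp add: b_def power_divide field_simps)
    \<comment> \<open>With y_0 = 1 the equation for y_i gives Y = r + \<open>branch_sign i\<close>
      y_i^k. Inserted into the equation for y_j, whose value at y_i = 0 is b_j^k, this yields the
      coefficient after division by b_j^k.\<close>
    define \<gamma> where "\<gamma> j = (if j = 0 then 0 else branch_sign j * branch_sign i / b j ^ k)" for j
    have bnz: "b j \<noteq> 0" if "j \<le> n" "j \<noteq> i" for j
    proof (cases "j = 0")
      case True
      then show ?thesis using x0 by (simp add: b_def)
    next
      case False
      then have j: "j \<in> {1..n}" using that by simp
      have "r \<noteq> branch_pt lam j"
        using inj_onD[OF inj, of i j] i1 j that(2) by (auto simp: r_def)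
      then have "b j ^ k \<noteq> 0" using bk[OF j] by simp
      then show ?thesis using kn(1) by auto
    qed
    have "\<exists>\<epsilon> f g D. fermat_disc k n lam (proj_point n b) \<epsilon> f g D"
    proof (rule fermat_disc_normalized[OF kn, of i 0 b \<gamma>])
      show "b 0 = 1" "b i = 0" using x0 i by (simp_all add: b_def)
      fix y :: "nat \<Rightarrow> complex" assume y0: "y 0 = 1"
      have eq: "b j ^ k * (1 + \<gamma> j * y i ^ k) =
          branch_sign j * (r + branch_sign i * y i ^ k - branch_pt lam j)" if "j \<in> {1..n}" "j \<noteq> i" for j
      proof -
        have "b j ^ k * (1 + \<gamma> j * y i ^ k) = b j ^ k + branch_sign j * branch_sign i * y i ^ k"
          using bnz[of j] that by (simp add: \<gamma>_def field_simps)
        then show ?thesis unfolding bk[OF that(1)] by (simp add: algebra_simps)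
      qed
      have "fermat_solution k n lam y \<longleftrightarrow>
          (\<forall>j\<in>{1..n}. y j ^ k = branch_sign j * (r + branch_sign i * y i ^ k - branch_pt lam j))"
      proof
        assume "fermat_solution k n lam y"
        then obtain Z where Z: "\<forall>j\<in>{1..n}. y j ^ k = branch_sign j * (Z - branch_pt lam j * y 0 ^ k)"
          using fermat_solution_iff[OF kn(2)] by blast
        then have "branch_sign i * y i ^ k = Z - r"
          using i1 y0 by (simp add: r_def sq)
        then have "Z = r + branch_sign i * y i ^ k" by simp
        then show "\<forall>j\<in>{1..n}. y j ^ k = branch_sign j * (r + branch_sign i * y i ^ k - branch_pt lam j)"
          using Z y0 by simp
      next
        assume "\<forall>j\<in>{1..n}. y j ^ k = branch_sign j * (r + branch_sign i * y i ^ k - branch_pt lam j)"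
        then have "\<forall>j\<in>{1..n}. y j ^ k =
            branch_sign j * ((r + branch_sign i * y i ^ k) - branch_pt lam j * y 0 ^ k)"
          using y0 by simp
        then show "fermat_solution k n lam y"
          using fermat_solution_iff[OF kn(2)] by blast
      qed
      also have "\<dots> \<longleftrightarrow> (\<forall>j\<in>{..n} - {i}. y j ^ k = b j ^ k * (1 + \<gamma> j * y i ^ k))" (is "?L \<longleftrightarrow> ?R")
      proof
        assume L: ?L
        show ?R
        proof
          fix j assume "j \<in> {..n} - {i}"
          then consider "j = 0" | "j \<in> {1..n}" "j \<noteq> i" by force
          then show "y j ^ k = b j ^ k * (1 + \<gamma> j * y i ^ k)"
          proof cases
            case 1
            then show ?thesis using y0 x0 by (simp add: \<gamma>_def b_def)
          next
            case 2
            then show ?thesis using L eq by simp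
          qed
        qed
      next
        assume R: ?R
        show ?L
        proof
          fix j assume j: "j \<in> {1..n}"
          show "y j ^ k = branch_sign j * (r + branch_sign i * y i ^ k - branch_pt lam j)"
          proof (cases "j = i")
            case True
            then show ?thesis by (simp add: r_def sq)
          next
            case False
            then show ?thesis using R eq[OF j False] j by simp
          qed
        qed
      qed
      finally show "fermat_solution k n lam y \<longleftrightarrow>
          (\<forall>j\<in>{..n} - {i}. y j ^ k = b j ^ k * (1 + \<gamma> j * y i ^ k))" .
    qed (use i False bnz in \<open>auto simp: \<gamma>_def\<close>)
    moreover have "proj_point n b = P"
      unfolding x(1) by (rule proj_point_scale[of "1 / x 0"]) (use x0 in \<open>simp_all add: b_def\<close>)
    ultimately show ?thesis by simp
  qed
qed

section \<open>The covering of the punctured curve\<close>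

text \<open>The difference divided by 2 pi \<i> is continuous and integer valued, and distinct
  integers are at least 1 apart.\<close>

lemma exp_eq_imp_constant_difference:
  fixes f g :: "'a::topological_space \<Rightarrow> complex"
  assumes S: "connected S" "continuous_on S f" "continuous_on S g"
    and eq: "\<And>x. x \<in> S \<Longrightarrow> exp (f x) = exp (g x)"
  shows "\<exists>m::int. \<forall>x\<in>S. f x = g x + 2 * of_real pi * \<i> * of_int m"
proof (cases "S = {}")
  case False
  define h where "h x = (f x - g x) / (2 * of_real pi * \<i>)" for x
  have h_int: "\<exists>m::int. h x = of_int m" if x: "x \<in> S" for x
  proof -
    obtain m :: int where "f x = g x + (of_int (2 * m) * pi) * \<i>"
      using eq[OF x] exp_eq by blast
    then have "h x = of_int m" by (simp add: h_def)
    then show ?thesis by blast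
  qed
  have "h constant_on S"
  proof (rule continuous_discrete_range_constant[OF S(1)])
    show "continuous_on S h" unfolding h_def using S(2,3) by (intro continuous_intros) auto
    show "\<exists>e>0. \<forall>y. y \<in> S \<and> h y \<noteq> h x \<longrightarrow> e \<le> norm (h y - h x)" if x: "x \<in> S" for x
    proof (intro exI[of _ 1] conjI allI impI)
      fix y assume y: "y \<in> S \<and> h y \<noteq> h x"
      obtain a b :: int where ab: "h x = of_int a" "h y = of_int b" using h_int x y by metis
      then have "b - a \<noteq> 0" using y by auto
      then have "1 \<le> \<bar>b - a\<bar>" by linarith
      then have "1 \<le> norm (of_int (b - a) :: complex)"
        by (simp only: norm_of_int)
      then show "1 \<le> norm (h y - h x)" by (simp add: ab)
    qed simp
  qed
  then obtain c where c: "\<And>x. x \<in> S \<Longrightarrow> h x = c" unfolding constant_on_def by blast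
  obtain x0 where "x0 \<in> S" using False by blast
  then obtain m :: int where m: "c = of_int m" using h_int c by metis
  have "f x = g x + 2 * of_real pi * \<i> * of_int m" if "x \<in> S" for x
  proof -
    have "(f x - g x) / (2 * of_real pi * \<i>) = of_int m" using c[OF that] m by (simp add: h_def)
    then show ?thesis by (simp add: field_simps)
  qed
  then show ?thesis by blast
qed simp

text \<open>Some continuous logarithm has this increment, and any two along the same path differ by
  a constant.\<close>

lemma winding_number_eq_log_difference:
  assumes "path \<gamma>" "path l" and eq: "\<And>t. t \<in> {0..1} \<Longrightarrow> \<gamma> t = \<zeta> + exp (l t)"
  shows "pathfinish l - pathstart l = 2 * of_real pi * \<i> * winding_number \<gamma> \<zeta>"
proof -
  have "\<zeta> \<notin> path_image \<gamma>" using eq by (auto simp: path_image_def)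
  then obtain q where q: "path q"
    "pathfinish q - pathstart q = 2 * of_real pi * \<i> * winding_number \<gamma> \<zeta>"
    "\<And>t. t \<in> {0..1} \<Longrightarrow> \<gamma> t = \<zeta> + exp (q t)"
    using winding_number_as_continuous_log[OF assms(1)] by metis
  have "exp (l t) = exp (q t)" if "t \<in> {0..1}" for t
    using eq[OF that] q(3)[OF that] by simp
  moreover have "connected {0..1::real}" by simp
  ultimately obtain m :: int where "\<forall>t\<in>{0..1}. l t = q t + 2 * of_real pi * \<i> * of_int m"
    using exp_eq_imp_constant_difference[of "{0..1}" l q] assms(2) q(1) by (auto simp: path_def)
  then have "l 1 - l 0 = q 1 - q 0" by simp
  then show ?thesis using q(2) by (simp add: pathfinish_def pathstart_def)
qed

lemma continuous_on_holomorphic_wrt: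
  fixes U :: "'u::t2_space set"
  assumes A: "complex_atlas U A" and f: "holomorphic_wrt A f"
  shows "continuous_on U f"
proof -
  have "\<exists>N. openin (top_of_set U) N \<and> u \<in> N \<and> continuous_on N f" if u: "u \<in> U" for u
  proof -
    obtain V z where V: "(V, z) \<in> A" "u \<in> V" using A u unfolding complex_atlas_def by force
    then obtain w where w: "openin (top_of_set U) V" "homeomorphism V (z ` V) z w"
      using A unfolding complex_atlas_def by blast
    have "(f \<circ> inv_into V z) holomorphic_on z ` V"
      using f V(1) unfolding holomorphic_wrt_def by blast
    then have "continuous_on (z ` V) (f \<circ> inv_into V z)" by (rule holomorphic_on_imp_continuous_on)
    moreover have "continuous_on V z" using w(2) by (simp add: homeomorphism_def)
    ultimately have "continuous_on V ((f \<circ> inv_into V z) \<circ> z)" by (rule continuous_on_compose[rotated])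
    moreover have "inj_on z V" using w(2) unfolding homeomorphism_def by (metis inj_on_inverseI)
    then have "((f \<circ> inv_into V z) \<circ> z) v = f v" if "v \<in> V" for v using that by simp
    ultimately have "continuous_on V f" using continuous_on_cong[OF refl, of V "(f \<circ> inv_into V z) \<circ> z" f] by simp
    then show ?thesis using V(2) w(1) by blast
  qed
  then obtain N where N: "\<And>u. u \<in> U \<Longrightarrow> openin (top_of_set U) (N u) \<and> u \<in> N u \<and> continuous_on (N u) f"
    by metis
  show ?thesis
    unfolding continuous_on_eq_continuous_within
  proof
    fix u assume u: "u \<in> U"
    have "continuous (at u within N u) f"
      using N[OF u] by (simp add: continuous_on_eq_continuous_within)
    moreover obtain W where "open W" "N u = U \<inter> W" using N[OF u] openin_open by blast
    then have "at u within N u = at u within U"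
      using N[OF u] by (intro at_within_nhd[of u W]) auto
    ultimately show "continuous (at u within U) f" by (simp only:)
  qed
qed

lemma pathin_continuous_image:
  assumes "continuous_map (top_of_set U) X f" "path \<gamma>" "path_image \<gamma> \<subseteq> U"
  shows "pathin X (f \<circ> \<gamma>)"
proof -
  have "continuous_map (top_of_set {0..1}) (top_of_set U) \<gamma>"
    using assms(2,3) by (auto simp: path_def path_image_def)
  then show ?thesis unfolding pathin_def using assms(1) by (rule continuous_map_compose)
qed

lemma singular_relcycle_loop:
  assumes "pathin X \<gamma>" "\<gamma> 0 = \<gamma> 1"
  shows "singular_relcycle 1 X {} (path_chain \<gamma>)"
  unfolding singular_cycle boundary_path_chain
  using singular_chain_path_chain[OF assms(1)] assms(2) by simp

lemma exp_of_int_div_eq_1_iff: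
  assumes "0 < k"
  shows "exp (2 * of_real pi * \<i> * of_int m / of_nat k) = 1 \<longleftrightarrow> int k dvd m"
proof
  assume "exp (2 * of_real pi * \<i> * of_int m / of_nat k) = 1"
  then have "exp (2 * of_real pi * \<i> * of_int m / of_nat k) = exp 0" by simp
  then obtain j :: int where "2 * of_real pi * \<i> * of_int m / of_nat k = 0 + (of_int (2 * j) * pi) * \<i>"
    using exp_eq by blast
  then have "(of_int m :: complex) = of_int (int k * j)"
    using assms by (simp add: field_simps)
  then have "m = int k * j" by (simp only: of_int_eq_iff)
  then show "int k dvd m" by simp
next
  assume "int k dvd m"
  then obtain j where "m = int k * j" by (rule dvdE)
  then have "2 * of_real pi * \<i> * of_int m / of_nat k = 0 + (of_int (2 * j) * pi) * \<i>"
    using assms by (simp add: field_simps)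
  then have "exp (2 * of_real pi * \<i> * of_int m / of_nat k) = exp 0" using exp_eq by blast
  then show "exp (2 * of_real pi * \<i> * of_int m / of_nat k) = 1" by simp
qed

text \<open>The setting of \<open>corollary1\<close> in topological form: holomorphy is represented
  by the continuity it implies, and the conditions on \<open>lam\<close> by the distinctness of the
  branch points.\<close>

locale fermat_covering =
  fixes k n :: nat and lam :: "nat \<Rightarrow> complex" and U :: "'u::t2_space set"
    and p :: "'u \<Rightarrow> complex" and logp :: "nat \<Rightarrow> 'u \<Rightarrow> complex" and u\<^sub>0 :: 'u
    and path_to :: "('u \<Rightarrow> 'u) \<Rightarrow> real \<Rightarrow> 'u" and \<phi> :: "nat \<Rightarrow> 'u \<Rightarrow> 'u"
  assumes k: "0 < k" and n: "2 \<le> n" and inj: "inj_on (branch_pt lam) {1..n}"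
    and U: "simply_connected U" and p: "covering_space U p (- branch_set n lam)"
    and logp: "\<And>i. i \<in> {1..n} \<Longrightarrow> continuous_on U (logp i)"
      "\<And>i u. i \<in> {1..n} \<Longrightarrow> u \<in> U \<Longrightarrow> exp (logp i u) = branch_fun lam p i u"
    and u\<^sub>0: "u\<^sub>0 \<in> U"
    and path_to: "\<And>\<psi>. \<psi> \<in> carrier (deck_group U p) \<Longrightarrow>
      path (path_to \<psi>) \<and> path_image (path_to \<psi>) \<subseteq> U \<and>
      pathstart (path_to \<psi>) = u\<^sub>0 \<and> pathfinish (path_to \<psi>) = \<psi> u\<^sub>0"
    and gen: "\<phi> ` {1..n} \<subseteq> carrier (deck_group U p)"
      "generate (deck_group U p) (\<phi> ` {1..n}) = carrier (deck_group U p)"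
    and circle: "\<And>i. i \<in> {1..n} \<Longrightarrow>
      \<exists>\<epsilon>>0. cball (branch_pt lam i) \<epsilon> \<inter> branch_set n lam = {branch_pt lam i} \<and>
        homotopic_loops (- branch_set n lam) (p \<circ> path_to (\<phi> i)) (circlepath (branch_pt lam i) \<epsilon>)"
begin

abbreviation "Dp \<equiv> deck_group U p"
abbreviation "C \<equiv> fermat_curve k n lam"
abbreviation "C' \<equiv> fermat_curve' k n lam"
abbreviation "q \<equiv> fermat_cover k n logp"

lemma n1: "1 \<le> n" using n by simp

lemma open_complement: "open (- branch_set n lam)"
  by (intro open_Compl finite_imp_closed) (simp add: branch_set_def)

lemma connected_U: "connected U"
  using simply_connected_path_connected[OF U] by (rule path_connected_imp_connected)

lemma p_cont: "continuous_on U p" and p_image: "p ` U = - branch_set n lam"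
  using p by (simp_all add: covering_space_def)

lemma branch_fun_eq: "branch_fun lam p i u = branch_sign i * (p u - branch_pt lam i)"
  by (simp add: branch_fun_def branch_sign_def branch_pt_def)

lemma deck_carrier:
  assumes "\<psi> \<in> carrier Dp"
  shows deck_in: "\<And>u. u \<in> U \<Longrightarrow> \<psi> u \<in> U" and deck_p: "\<And>u. u \<in> U \<Longrightarrow> p (\<psi> u) = p u"
    and deck_cont: "continuous_on U \<psi>"
  using assms by (auto simp: deck_group_def homeomorphism_def)

lemma deck_mult: "u \<in> U \<Longrightarrow> \<psi> \<in> carrier Dp \<Longrightarrow> \<psi>' \<in> carrier Dp \<Longrightarrow> (\<psi> \<otimes>\<^bsub>Dp\<^esub> \<psi>') u = \<psi> (\<psi>' u)"
  by (simp add: deck_group_def BijGroup_def compose_def)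

definition L :: "nat \<Rightarrow> ('u \<Rightarrow> 'u) \<Rightarrow> int" where
  "L i \<psi> = (SOME m. \<forall>u\<in>U. logp i (\<psi> u) = logp i u + 2 * of_real pi * \<i> * of_int m)"

lemma L:
  assumes i: "i \<in> {1..n}" and \<psi>: "\<psi> \<in> carrier Dp" and u: "u \<in> U"
  shows "logp i (\<psi> u) = logp i u + 2 * of_real pi * \<i> * of_int (L i \<psi>)"
proof -
  have "continuous_on U (\<lambda>u. logp i (\<psi> u))"
    by (rule continuous_on_compose2[OF logp(1)[OF i] deck_cont[OF \<psi>]]) (use deck_in[OF \<psi>] in auto)
  moreover have "exp (logp i (\<psi> u)) = exp (logp i u)" if "u \<in> U" for u
    using logp(2)[OF i that] logp(2)[OF i deck_in[OF \<psi> that]] deck_p[OF \<psi> that]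
    by (simp add: branch_fun_eq)
  ultimately have "\<exists>m::int. \<forall>u\<in>U. logp i (\<psi> u) = logp i u + 2 * of_real pi * \<i> * of_int m"
    by (intro exp_eq_imp_constant_difference connected_U logp(1)[OF i])
  then have "\<forall>u\<in>U. logp i (\<psi> u) = logp i u + 2 * of_real pi * \<i> * of_int (L i \<psi>)"
    unfolding L_def by (rule someI_ex)
  then show ?thesis using u by blast
qed

lemma L_unique:
  assumes "i \<in> {1..n}" "\<psi> \<in> carrier Dp" "logp i (\<psi> u\<^sub>0) = logp i u\<^sub>0 + 2 * of_real pi * \<i> * of_int m"
  shows "L i \<psi> = m"
  using L[OF assms(1,2) u\<^sub>0] assms(3) by simp

lemma L_mult:
  assumes "i \<in> {1..n}" "\<psi> \<in> carrier Dp" "\<psi>' \<in> carrier Dp"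
  shows "L i (\<psi> \<otimes>\<^bsub>Dp\<^esub> \<psi>') = L i \<psi> + L i \<psi>'"
proof (rule L_unique[OF assms(1)])
  show "\<psi> \<otimes>\<^bsub>Dp\<^esub> \<psi>' \<in> carrier Dp"
    using assms group.is_monoid[OF group_deck_group] by (intro monoid.m_closed)
  show "logp i ((\<psi> \<otimes>\<^bsub>Dp\<^esub> \<psi>') u\<^sub>0) = logp i u\<^sub>0 + 2 * of_real pi * \<i> * of_int (L i \<psi> + L i \<psi>')"
    using deck_mult[OF u\<^sub>0 assms(2,3)] L[OF assms(1,2) deck_in[OF assms(3) u\<^sub>0]] L[OF assms(1,3) u\<^sub>0]
    by (simp add: algebra_simps)
qed

text \<open>The increment of the logarithm along \<open>path_to (\<phi> j)\<close> is a winding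
  number of the projected loop. This loop is freely homotopic, away from all branch points, to a
  circle around r_j that encloses no other branch point.\<close>

lemma L_generator:
  assumes i: "i \<in> {1..n}" and j: "j \<in> {1..n}"
  shows "L i (\<phi> j) = (if i = j then 1 else 0)"
proof -
  let ?g = "path_to (\<phi> j)" and ?r = "branch_pt lam"
  have \<phi>: "\<phi> j \<in> carrier Dp" using gen(1) j by blast
  have g: "path ?g" "path_image ?g \<subseteq> U" "?g 0 = u\<^sub>0" "?g 1 = \<phi> j u\<^sub>0"
    using path_to[OF \<phi>] by (auto simp: pathstart_def pathfinish_def)
  have gU: "?g t \<in> U" if "t \<in> {0..1}" for t using g(2) that by (auto simp: path_image_def)
  \<comment> \<open>\<open>logp 1\<close> is a logarithm of \<open>- p\<close>; adding pi \<i> turns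
    it into one of \<open>p\<close>, as the winding number around r_1 = 0 requires.\<close>
  define c where "c = (if i = 1 then of_real pi * \<i> else 0)"
  have c: "exp c = branch_sign i" by (simp add: c_def branch_sign_def)
  have "path (p \<circ> ?g)"
    using g(1,2) p_cont by (intro path_continuous_image) (auto intro: continuous_on_subset)
  moreover have "path (\<lambda>t. logp i (?g t) + c)"
    unfolding path_def
    by (intro continuous_intros continuous_on_compose2[OF logp(1)[OF i]])
       (use g(1) gU in \<open>auto simp: path_def\<close>)
  moreover have "(p \<circ> ?g) t = ?r i + exp (logp i (?g t) + c)" if "t \<in> {0..1}" for t
  proof -
    have "exp (logp i (?g t) + c) = branch_sign i * branch_sign i * (p (?g t) - ?r i)"
      using logp(2)[OF i gU[OF that]] c by (simp add: exp_add branch_fun_eq)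
    then show ?thesis by simp
  qed
  ultimately have w: "logp i (\<phi> j u\<^sub>0) - logp i u\<^sub>0 = 2 * of_real pi * \<i> * winding_number (p \<circ> ?g) (?r i)"
    using winding_number_eq_log_difference[of "p \<circ> ?g" "\<lambda>t. logp i (?g t) + c" "?r i"] g
    by (simp add: pathstart_def pathfinish_def)
  obtain \<epsilon> where \<epsilon>: "\<epsilon> > 0" "cball (?r j) \<epsilon> \<inter> branch_set n lam = {?r j}"
    and hom: "homotopic_loops (- branch_set n lam) (p \<circ> ?g) (circlepath (?r j) \<epsilon>)"
    using circle[OF j] by blast
  have "homotopic_loops (- {?r i}) (p \<circ> ?g) (circlepath (?r j) \<epsilon>)"
    by (rule homotopic_loops_subset[OF hom]) (use i in \<open>auto simp: branch_set_def\<close>)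
  then have "winding_number (p \<circ> ?g) (?r i) = winding_number (circlepath (?r j) \<epsilon>) (?r i)"
    by (rule winding_number_homotopic_loops)
  also have "\<dots> = (if i = j then 1 else 0)"
  proof (cases "i = j")
    case True
    then show ?thesis using winding_number_circlepath_centre[OF \<epsilon>(1)] by simp
  next
    case False
    then have "?r i \<noteq> ?r j" using inj_onD[OF inj, of i j] i j by blast
    moreover have "?r i \<in> branch_set n lam" using i by (simp add: branch_set_def)
    ultimately have "?r i \<notin> cball (?r j) \<epsilon>" using \<epsilon>(2) by blast
    then have "winding_number (circlepath (?r j) \<epsilon>) (?r i) = 0"
      by (intro winding_number_zero_outside[of _ "cball (?r j) \<epsilon>"])
         (use \<epsilon>(1) in \<open>auto simp: path_image_circlepath\<close>)
    then show ?thesis using False by simp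
  qed
  finally have "winding_number (p \<circ> ?g) (?r i) = of_int (if i = j then 1 else 0)" by simp
  with w have "logp i (\<phi> j u\<^sub>0) = logp i u\<^sub>0 + 2 * of_real pi * \<i> * of_int (if i = j then 1 else 0)"
    by (simp add: algebra_simps)
  then show ?thesis by (rule L_unique[OF i \<phi>])
qed

sublocale exponent_sum_group Dp n k \<phi> L
  unfolding exponent_sum_group_def exponent_sum_group_axioms_def
  using group_deck_group gen L_mult L_generator k by (auto simp: image_subset_iff)

section \<open>The coordinates of q, its fibres and its path lifting\<close>

definition root_fun :: "nat \<Rightarrow> 'u \<Rightarrow> complex" where
  "root_fun i u = (if i = 0 then 1 else exp (1 / of_nat k * logp i u))"

lemma q_eq: "q u = proj_point n (\<lambda>i. root_fun i u)"
  unfolding fermat_cover_def root_fun_def by (rule proj_point_restrict)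

lemma root_fun_nonzero [simp]: "root_fun i u \<noteq> 0" and root_fun_0 [simp]: "root_fun 0 u = 1"
  by (simp_all add: root_fun_def)

lemma root_fun_power:
  assumes "i \<in> {1..n}" "u \<in> U"
  shows "root_fun i u ^ k = branch_sign i * (p u - branch_pt lam i)"
proof -
  have "root_fun i u ^ k = exp (of_nat k * (1 / of_nat k * logp i u))"
    using assms(1) by (simp only: root_fun_def exp_of_nat_mult) simp
  also have "\<dots> = exp (logp i u)" using k by simp
  finally show ?thesis using logp(2)[OF assms] by (simp add: branch_fun_eq)
qed

lemma root_fun_cont: "i \<le> n \<Longrightarrow> continuous_on U (root_fun i)"
  unfolding root_fun_def by (cases "i = 0") (use k in \<open>auto intro!: continuous_intros logp(1)\<close>)

lemma ratio_q: "i \<le> n \<Longrightarrow> proj_ratio 0 i (q u) = root_fun i u"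
  unfolding q_eq by (simp add: proj_ratio_proj_point)

lemma q_eq_iff: "q u = q v \<longleftrightarrow> (\<forall>i\<le>n. root_fun i u = root_fun i v)"
proof
  assume "q u = q v"
  then show "\<forall>i\<le>n. root_fun i u = root_fun i v" using ratio_q by metis
next
  assume "\<forall>i\<le>n. root_fun i u = root_fun i v"
  then show "q u = q v" unfolding q_eq by (intro proj_point_cong) auto
qed

lemma q_in_C': assumes "u \<in> U" shows "q u \<in> topspace C'"
proof -
  have "fermat_solution k n lam (\<lambda>i. root_fun i u)"
    unfolding fermat_solution_iff[OF n1] using root_fun_power[OF _ assms] by (intro exI[of _ "p u"]) simp
  then have "q u \<in> topspace C"
    unfolding q_eq by (subst proj_point_in_fermat_curve[OF n1]) auto
  moreover have "proj_ratio j j (q u) \<noteq> 0" if "j \<le> n" for j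
    unfolding q_eq using that by (simp add: proj_ratio_proj_point)
  ultimately show ?thesis by (simp add: topspace_fermat_curve'[OF n1 k])
qed

lemma C'_subset: "topspace C' \<subseteq> topspace C"
  by (auto simp: topspace_fermat_curve'[OF n1 k])

lemma q_cont': "continuous_map (top_of_set U) C' q"
proof -
  have "continuous_map (top_of_set U) (proj_space n) (\<lambda>u. proj_point n (\<lambda>i. root_fun i u))"
    by (rule continuous_map_proj_point) (auto simp: root_fun_cont)
  then have "continuous_map (top_of_set U) (proj_space n) q" by (simp only: q_eq[abs_def])
  moreover have "C' = subtopology (proj_space n) (topspace C')"
    by (rule fermat_curve'_proj_space)
  ultimately show ?thesis
    using q_in_C' continuous_map_in_subtopology[of "top_of_set U" "proj_space n" "topspace C'" q] by auto
qed

lemma q_cont: "continuous_map (top_of_set U) C q"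
proof -
  have "continuous_map (top_of_set U) (subtopology C (topspace C')) q"
    using q_cont' by (subst fermat_curve'_subtopology[symmetric])
  then show ?thesis by (rule continuous_map_into_fulltopology)
qed

lemma root_fun_deck:
  assumes "i \<in> {1..n}" "\<psi> \<in> carrier Dp" "u \<in> U"
  shows "root_fun i (\<psi> u) = root_fun i u * exp (2 * of_real pi * \<i> * of_int (L i \<psi>) / of_nat k)"
proof -
  have "1 / of_nat k * logp i (\<psi> u) = 1 / of_nat k * logp i u + 2 * of_real pi * \<i> * of_int (L i \<psi>) / of_nat k"
    unfolding L[OF assms] by (simp add: algebra_simps)
  then show ?thesis using assms(1) by (simp only: root_fun_def exp_add) simp
qed

text \<open>\<psi> multiplies the i-th coordinate by exp(2 pi \<i> L(p_i, \<psi>) / k). This factor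
  is the same at every point, so preserving \<open>q\<close> at one point amounts to preserving it
  everywhere.\<close>

lemma q_deck_iff:
  assumes "\<psi> \<in> carrier Dp" "u \<in> U"
  shows "q (\<psi> u) = q u \<longleftrightarrow> \<psi> \<in> exponent_kernel"
proof -
  have "q (\<psi> u) = q u \<longleftrightarrow> (\<forall>i\<in>{1..n}. root_fun i (\<psi> u) = root_fun i u)"
    unfolding q_eq_iff by (metis atLeastAtMost_iff le0 less_one not_less root_fun_0)
  also have "\<dots> \<longleftrightarrow> (\<forall>i\<in>{1..n}. int k dvd L i \<psi>)"
    using root_fun_deck[OF _ assms] exp_of_int_div_eq_1_iff[OF k] by simp
  finally show ?thesis using assms(1) by (simp add: exponent_kernel_def)
qed

lemma q_eq_imp_p_eq:
  assumes "u \<in> U" "v \<in> U" "q u = q v"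
  shows "p u = p v"
proof -
  have "root_fun 1 u = root_fun 1 v" using assms(3) n1 by (simp add: q_eq_iff)
  then have "branch_sign 1 * (p u - branch_pt lam 1) = branch_sign 1 * (p v - branch_pt lam 1)"
    using root_fun_power[of 1] assms(1,2) n1 by (metis atLeastAtMost_iff order_refl)
  then show ?thesis by simp
qed

lemma carrier_deck_group_q: "carrier (deck_group U q) = exponent_kernel"
proof
  show "carrier (deck_group U q) \<subseteq> exponent_kernel"
  proof
    fix \<psi> assume \<psi>: "\<psi> \<in> carrier (deck_group U q)"
    then have \<psi>U: "\<psi> u \<in> U" "q (\<psi> u) = q u" if "u \<in> U" for u
      using that by (auto simp: deck_group_def homeomorphism_def)
    then have "\<psi> \<in> carrier Dp"
      using \<psi> q_eq_imp_p_eq[OF \<psi>U(1) _ \<psi>U(2)] by (auto simp: deck_group_def)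
    then show "\<psi> \<in> exponent_kernel" using q_deck_iff[OF _ u\<^sub>0] \<psi>U(2)[OF u\<^sub>0] by blast
  qed
  show "exponent_kernel \<subseteq> carrier (deck_group U q)"
  proof
    fix \<psi> assume \<psi>: "\<psi> \<in> exponent_kernel"
    then have "\<psi> \<in> carrier Dp" by (simp add: exponent_kernel_def)
    then show "\<psi> \<in> carrier (deck_group U q)"
      using \<psi> q_deck_iff[of \<psi>] by (auto simp: deck_group_def)
  qed
qed

text \<open>Choose a point \<open>v\<close> over the right value of \<open>p\<close>. The affine
  coordinates of \<open>P\<close> and \<open>q v\<close> have equal k-th powers, so they differ by
  roots of unity, and a deck transformation of \<open>p\<close> with suitable exponents removes
  these.\<close>

lemma q_surj:
  assumes P: "P \<in> topspace C'"
  shows "\<exists>u\<in>U. q u = P"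
proof -
  have PC: "P \<in> topspace C" "\<And>j. j \<le> n \<Longrightarrow> proj_ratio j j P \<noteq> 0"
    using P by (auto simp: topspace_fermat_curve'[OF n1 k])
  define x where "x j = proj_ratio 0 j P" for j
  have Px: "P = proj_point n x"
    unfolding x_def using proj_space_normalize[of P n 0] PC fermat_curve_subset_proj_space by blast
  have xnz: "x j \<noteq> 0" if "j \<le> n" for j
    using PC(2)[OF that] that unfolding Px by (simp add: proj_ratio_proj_point split: if_splits)
  have x0: "x 0 = 1"
    using proj_ratio_proj_point[of 0 n 0 x] xnz[of 0] Px[symmetric] by (simp add: x_def)
  have "fermat_solution k n lam x"
    using PC(1) xnz[of 0] proj_point_in_fermat_curve[OF n1, of x] unfolding Px by blast
  then obtain Y where Y: "\<And>i. i \<in> {1..n} \<Longrightarrow> x i ^ k = branch_sign i * (Y - branch_pt lam i)"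
    using fermat_solution_iff[OF n1] x0 by auto
  have "Y \<noteq> branch_pt lam i" if i: "i \<in> {1..n}" for i
    using Y[OF i] xnz[of i] i by auto
  then have "Y \<notin> branch_set n lam" unfolding branch_set_def by blast
  then have "Y \<in> p ` U" unfolding p_image by simp
  then obtain v where v: "v \<in> U" "p v = Y" by blast
  have "\<exists>g. x i = root_fun i v * exp (2 * of_real pi * \<i> * of_int (int g) / of_nat k)" if i: "i \<in> {1..n}" for i
  proof -
    have "(x i / root_fun i v) ^ k = 1"
    proof -
      have "x i ^ k = root_fun i v ^ k"
        using Y[OF i] root_fun_power[OF i v(1)] v(2) by simp
      then show ?thesis by (simp add: power_divide)
    qed
    then obtain g where "x i / root_fun i v = exp (2 * of_real pi * \<i> * of_nat g / of_nat k)"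
      using complex_roots_unity[of k] k by auto
    then show ?thesis by (intro exI[of _ g]) (simp add: field_simps)
  qed
  then obtain g where g: "\<And>i. i \<in> {1..n} \<Longrightarrow> x i = root_fun i v * exp (2 * of_real pi * \<i> * of_int (int (g i)) / of_nat k)"
    by metis
  let ?\<psi> = "power_product Dp n \<phi> g"
  have \<psi>: "?\<psi> \<in> carrier Dp" by (rule power_product_closed)
  have "root_fun i (?\<psi> v) = x i" if "i \<le> n" for i
  proof (cases "i = 0")
    case False
    then have "i \<in> {1..n}" using that by simp
    then show ?thesis using root_fun_deck[OF _ \<psi> v(1)] g ex_power_product by simp
  qed (simp add: x0)
  then have "q (?\<psi> v) = P" unfolding q_eq Px by (intro proj_point_cong)
  then show ?thesis using deck_in[OF \<psi> v(1)] by blast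
qed

lemma q_fibre:
  assumes "u \<in> U" "v \<in> U" "q u = q v"
  obtains \<psi> where "\<psi> \<in> exponent_kernel" "\<psi> u = v"
proof -
  obtain \<psi> where \<psi>: "\<psi> \<in> carrier Dp" "\<psi> u = v"
    using deck_group_transitive[OF p open_complement U assms(1,2)] q_eq_imp_p_eq[OF assms] by metis
  then show ?thesis using that q_deck_iff[OF \<psi>(1) assms(1)] assms(3) by simp
qed

text \<open>The path \<open>s\<close>, the image of \<alpha> under \<pi>, lifts through
  \<open>p\<close>. Along the lift the quotients \<open>y i t / root_fun i (\<beta> t)\<close> are
  continuous with values among the k-th roots of unity, hence constant, and they are 1 at t =
  0.\<close>

lemma q_lift:
  assumes \<alpha>: "pathin C' \<alpha>" and u: "u \<in> U" "q u = \<alpha> 0"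
  obtains \<beta> where "path \<beta>" "path_image \<beta> \<subseteq> U" "\<beta> 0 = u" "\<And>t. t \<in> {0..1} \<Longrightarrow> q (\<beta> t) = \<alpha> t"
proof -
  have \<alpha>C: "\<alpha> t \<in> topspace C'" if "t \<in> {0..1}" for t
    using continuous_map_funspace[OF \<alpha>[unfolded pathin_def]] that by auto
  define y where "y i t = proj_ratio 0 i (\<alpha> t)" for i t
  have y_cont: "continuous_on {0..1} (y i)" if i: "i \<le> n" for i
  proof -
    have "C' = subtopology (proj_space n) (topspace C')"
      by (rule fermat_curve'_proj_space)
    moreover have "continuous_map (subtopology (proj_space n) (topspace C')) euclidean (proj_ratio 0 i)"
      by (rule continuous_map_from_subtopology_mono[OF continuous_map_proj_ratio[OF _ i]])
         (auto simp: topspace_fermat_curve'[OF n1 k])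
    ultimately have "continuous_map C' euclidean (proj_ratio 0 i)" by simp
    then have "continuous_map (top_of_set {0..1}) euclidean (proj_ratio 0 i \<circ> \<alpha>)"
      using \<alpha> unfolding pathin_def by (rule continuous_map_compose[rotated])
    then show ?thesis by (simp add: y_def o_def)
  qed
  have \<alpha>q: "\<exists>v\<in>U. q v = \<alpha> t" if "t \<in> {0..1}" for t using q_surj[OF \<alpha>C[OF that]] .
  define s where "s t = - (y 1 t ^ k)" for t
  have y_root: "y i t ^ k = branch_sign i * (s t - branch_pt lam i)" "s t \<in> - branch_set n lam"
    if t: "t \<in> {0..1}" and i: "i \<in> {1..n}" for i t
  proof -
    obtain v where v: "v \<in> U" "q v = \<alpha> t" using \<alpha>q[OF t] by blast
    have yv: "y j t = root_fun j v" if "j \<le> n" for j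
      unfolding y_def v(2)[symmetric] using ratio_q[OF that] .
    have "s t = p v"
      unfolding s_def yv[OF n1] using root_fun_power[of 1 v] v(1) n1 by (simp add: branch_sign_def branch_pt_def)
    then show "y i t ^ k = branch_sign i * (s t - branch_pt lam i)" "s t \<in> - branch_set n lam"
      using yv[of i] i root_fun_power[OF i v(1)] p_image v(1) by auto
  qed
  have "path s" unfolding s_def path_def by (intro continuous_intros y_cont n1)
  moreover have "path_image s \<subseteq> - branch_set n lam"
    using y_root(2) n1 unfolding path_image_def by (metis atLeastAtMost_iff image_subsetI order_refl)
  moreover have yu: "y i 0 = root_fun i u" if "i \<le> n" for i
    unfolding y_def u(2)[symmetric] using ratio_q[OF that] .
  then have "p u = s 0"
    unfolding s_def using root_fun_power[of 1 u] u(1) n1 by (simp add: branch_sign_def branch_pt_def)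
  ultimately obtain \<beta> where \<beta>: "path \<beta>" "path_image \<beta> \<subseteq> U" "\<beta> 0 = u" "\<And>t. t \<in> {0..1} \<Longrightarrow> p (\<beta> t) = s t"
    using covering_path_lift[OF p _ _ u(1)] by metis
  have \<beta>U: "\<beta> t \<in> U" if "t \<in> {0..1}" for t using \<beta>(2) that by (auto simp: path_image_def)
  have y\<beta>: "y i t = root_fun i (\<beta> t)" if i: "i \<le> n" and t: "t \<in> {0..1}" for i t
  proof (cases "i = 0")
    case True
    obtain v where "q v = \<alpha> t" using \<alpha>q[OF t] by blast
    then show ?thesis using ratio_q[of 0 v] True by (simp add: y_def)
  next
    case False
    then have i1: "i \<in> {1..n}" using i by simp
    let ?z = "\<lambda>t. y i t / root_fun i (\<beta> t)"
    have "continuous_on {0..1} (\<lambda>t. root_fun i (\<beta> t))"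
      by (rule continuous_on_compose2[OF root_fun_cont[OF i]]) (use \<beta>(1) \<beta>U in \<open>auto simp: path_def\<close>)
    then have "continuous_on {0..1} ?z" by (intro continuous_intros y_cont[OF i]) auto
    moreover have "?z ` {0..1} \<subseteq> {z. z ^ k = 1}"
    proof
      fix w assume "w \<in> ?z ` {0..1}"
      then obtain t where t: "t \<in> {0..1}" "w = ?z t" by blast
      have "root_fun i (\<beta> t) ^ k \<noteq> 0" by simp
      then show "w \<in> {z. z ^ k = 1}"
        using y_root(1)[OF t(1) i1] root_fun_power[OF i1 \<beta>U[OF t(1)]] \<beta>(4)[OF t(1)]
        by (simp add: t(2) power_divide)
    qed
    then have "finite (?z ` {0..1})"
      using finite_roots_unity[of k, where 'a = complex] k finite_subset by auto
    ultimately have "?z constant_on {0..1}"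
      by (intro continuous_finite_range_constant) auto
    then obtain c where "\<And>t. t \<in> {0..1} \<Longrightarrow> ?z t = c" unfolding constant_on_def by blast
    then have "?z t = ?z 0" using t by simp
    also have "\<dots> = 1" using yu[OF i] \<beta>(3) by simp
    finally show ?thesis by simp
  qed
  have "q (\<beta> t) = \<alpha> t" if t: "t \<in> {0..1}" for t
  proof -
    have "\<alpha> t \<in> topspace (proj_space n)" "proj_ratio 0 0 (\<alpha> t) \<noteq> 0"
      using \<alpha>C[OF t] C'_subset fermat_curve_subset_proj_space[of k n lam]
      by (auto simp: topspace_fermat_curve'[OF n1 k])
    then have "\<alpha> t = proj_point n (\<lambda>i. y i t)" unfolding y_def by (intro proj_space_normalize) auto
    also have "\<dots> = q (\<beta> t)" unfolding q_eq by (rule proj_point_cong) (rule y\<beta>[OF _ t])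
    finally show ?thesis by simp
  qed
  then show ?thesis using that \<beta> by blast
qed

section \<open>Generation of the homology group\<close>

abbreviation "H1 \<equiv> homology_group 1 C"

definition deck_class :: "('u \<Rightarrow> 'u) \<Rightarrow> (nat \<Rightarrow> complex) set chain set" where
  "deck_class \<psi> = homologous_rel_set 1 C {} (path_chain (q \<circ> path_to \<psi>))"

lemma path_to_props:
  assumes "\<psi> \<in> carrier Dp"
  shows "path (path_to \<psi>)" "path_image (path_to \<psi>) \<subseteq> U" "path_to \<psi> 0 = u\<^sub>0" "path_to \<psi> 1 = \<psi> u\<^sub>0"
  using path_to[OF assms] by (auto simp: pathstart_def pathfinish_def)

lemma kernel_deck: "\<psi> \<in> exponent_kernel \<Longrightarrow> \<psi> \<in> carrier Dp"
  by (simp add: exponent_kernel_def)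

lemma deck_path:
  assumes "\<psi> \<in> carrier Dp" "path \<gamma>" "path_image \<gamma> \<subseteq> U"
  shows "path (\<psi> \<circ> \<gamma>)" "path_image (\<psi> \<circ> \<gamma>) \<subseteq> U"
  using assms deck_cont[OF assms(1)] deck_in[OF assms(1)]
  by (auto intro!: path_continuous_image intro: continuous_on_subset simp: path_image_compose)

lemma q_deck_path:
  assumes "\<psi> \<in> exponent_kernel" "path_image \<gamma> \<subseteq> U"
  shows "path_chain (q \<circ> (\<psi> \<circ> \<gamma>)) = path_chain (q \<circ> \<gamma>)"
proof (rule path_chain_cong)
  fix t :: real assume "t \<in> {0..1}"
  then have "\<gamma> t \<in> U" using assms(2) by (auto simp: path_image_def)
  then show "(q \<circ> (\<psi> \<circ> \<gamma>)) t = (q \<circ> \<gamma>) t"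
    using q_deck_iff[OF kernel_deck[OF assms(1)]] assms(1) by simp
qed

lemma triangle_q:
  assumes "path \<alpha>" "path_image \<alpha> \<subseteq> U" "path \<beta>" "path_image \<beta> \<subseteq> U" "path \<gamma>" "path_image \<gamma> \<subseteq> U"
    and "\<alpha> 1 = \<beta> 0" "\<alpha> 0 = \<gamma> 0" "\<beta> 1 = \<gamma> 1"
  shows "singular_relboundary 1 C {} (path_chain (q \<circ> \<alpha>) + path_chain (q \<circ> \<beta>) - path_chain (q \<circ> \<gamma>))"
  using assms by (intro triangle_boundary_image[OF U q_cont]) (auto simp: pathstart_def pathfinish_def)

lemma deck_loop:
  assumes "\<psi> \<in> exponent_kernel" "continuous_map (top_of_set U) X q"
  shows "singular_relcycle 1 X {} (path_chain (q \<circ> path_to \<psi>))"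
proof -
  note \<psi> = kernel_deck[OF assms(1)]
  have "q (\<psi> u\<^sub>0) = q u\<^sub>0" using q_deck_iff[OF \<psi> u\<^sub>0] assms(1) by simp
  then show ?thesis
    using path_to_props[OF \<psi>] by (intro singular_relcycle_loop pathin_continuous_image[OF assms(2)]) auto
qed

text \<open>In \<open>U\<close> the path for \<psi> followed by the \<psi>-translate of the path for
  \<psi>' ends where the path for the product ends. The three bound a triangle, and \<open>q\<close>
  does not see the translation.\<close>

lemma deck_class_hom: "deck_class \<in> hom (Dp\<lparr>carrier := exponent_kernel\<rparr>) H1"
proof (rule homI)
  fix \<psi> assume "\<psi> \<in> carrier (Dp\<lparr>carrier := exponent_kernel\<rparr>)"
  then have "singular_relcycle 1 C {} (path_chain (q \<circ> path_to \<psi>))"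
    using deck_loop[OF _ q_cont] by simp
  then show "deck_class \<psi> \<in> carrier H1"
    using carrier_relative_homology_group[of 1 C "{}"] unfolding deck_class_def by auto
next
  fix \<psi> \<psi>' assume "\<psi> \<in> carrier (Dp\<lparr>carrier := exponent_kernel\<rparr>)" "\<psi>' \<in> carrier (Dp\<lparr>carrier := exponent_kernel\<rparr>)"
  then have K: "\<psi> \<in> exponent_kernel" "\<psi>' \<in> exponent_kernel" by auto
  note D = K[THEN kernel_deck]
  let ?\<chi> = "\<psi> \<otimes>\<^bsub>Dp\<^esub> \<psi>'"
  have \<chi>: "?\<chi> \<in> carrier Dp" using D by simp
  note P = path_to_props[OF D(1)] and P' = path_to_props[OF D(2)] and P\<chi> = path_to_props[OF \<chi>]
  have "singular_relboundary 1 C {} (path_chain (q \<circ> path_to \<psi>) + path_chain (q \<circ> (\<psi> \<circ> path_to \<psi>'))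
      - path_chain (q \<circ> path_to ?\<chi>))"
    by (rule triangle_q) (use P P' P\<chi> deck_path[OF D(1) P'(1,2)] deck_mult[OF u\<^sub>0 D] in auto)
  then have "homologous_rel 1 C {} (path_chain (q \<circ> path_to \<psi>) + path_chain (q \<circ> path_to \<psi>'))
      (path_chain (q \<circ> path_to ?\<chi>))"
    unfolding homologous_rel_def q_deck_path[OF K(1) P'(2)] .
  then have "deck_class ?\<chi> = homologous_rel_set 1 C {} (path_chain (q \<circ> path_to \<psi>) + path_chain (q \<circ> path_to \<psi>'))"
    unfolding deck_class_def by (simp only: homologous_rel_set_eq homologous_rel_sym)
  also have "\<dots> = deck_class \<psi> \<otimes>\<^bsub>H1\<^esub> deck_class \<psi>'"
    unfolding deck_class_def by (rule mult_homology_class_1[symmetric]) (intro deck_loop[OF _ q_cont] K)+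
  finally show "deck_class (\<psi> \<otimes>\<^bsub>Dp\<lparr>carrier := exponent_kernel\<rparr>\<^esub> \<psi>') = deck_class \<psi> \<otimes>\<^bsub>H1\<^esub> deck_class \<psi>'"
    by simp
qed

definition loop_subgroup :: "(nat \<Rightarrow> complex) set chain set set" where
  "loop_subgroup = generate H1 (deck_class ` fermat_generators Dp k n \<phi>)"

lemma deck_class_in_loop_subgroup: "\<psi> \<in> exponent_kernel \<Longrightarrow> deck_class \<psi> \<in> loop_subgroup"
  unfolding loop_subgroup_def
  using hom_exponent_kernel_subset[OF abelian_homology_group deck_class_hom] by blast

lemma subgroup_loop_subgroup: "subgroup loop_subgroup H1"
proof -
  have "deck_class ` fermat_generators Dp k n \<phi> \<subseteq> carrier H1"
    using fermat_generators_subset hom_in_carrier[OF deck_class_hom] by auto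
  then show ?thesis
    unfolding loop_subgroup_def by (intro group.generate_is_subgroup group_relative_homology_group)
qed

section \<open>Classes of corrected paths in the punctured curve and in discs\<close>

lemmas loop_add = class_chains_add[OF subgroup_loop_subgroup]
  and loop_diff = class_chains_diff[OF subgroup_loop_subgroup]
  and loop_boundary = class_chains_boundary[OF subgroup_loop_subgroup]

text \<open>The path is chosen in \<open>U\<close>, where triangles bound, and its end may be any
  point of the fibre over \<open>P\<close>.\<close>

definition base_path :: "(nat \<Rightarrow> complex) set \<Rightarrow> real \<Rightarrow> 'u" where
  "base_path P = (SOME g. path g \<and> path_image g \<subseteq> U \<and> g 0 = u\<^sub>0 \<and> q (g 1) = P)"

lemma base_path:
  assumes "P \<in> topspace C'"
  shows "path (base_path P)" "path_image (base_path P) \<subseteq> U" "base_path P 0 = u\<^sub>0" "q (base_path P 1) = P"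
proof -
  obtain u where u: "u \<in> U" "q u = P" using q_surj[OF assms] by blast
  then obtain g where "path g" "path_image g \<subseteq> U" "g 0 = u\<^sub>0" "g 1 = u"
    using simply_connected_path_connected[OF U] u\<^sub>0 unfolding path_connected_def pathstart_def pathfinish_def by blast
  then have "\<exists>g. path g \<and> path_image g \<subseteq> U \<and> g 0 = u\<^sub>0 \<and> q (g 1) = P" using u(2) by blast
  then have "path (base_path P) \<and> path_image (base_path P) \<subseteq> U \<and> base_path P 0 = u\<^sub>0 \<and> q (base_path P 1) = P"
    unfolding base_path_def by (rule someI_ex)
  then show "path (base_path P)" "path_image (base_path P) \<subseteq> U" "base_path P 0 = u\<^sub>0" "q (base_path P 1) = P"
    by auto
qed

definition base_chain :: "(nat \<Rightarrow> complex) set \<Rightarrow> (nat \<Rightarrow> complex) set chain" where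
  "base_chain P = path_chain (q \<circ> base_path P)"

text \<open>The lift of \<alpha> continues the base path of \<open>\<alpha> 0\<close>, and some
  \<psi> in Deck(q) carries the end of the base path of \<open>\<alpha> 1\<close> to the end of this
  lift. Up to boundaries the corrected chain is the loop of \<psi>.\<close>

lemma unramified_path_class:
  assumes \<alpha>: "pathin C' \<alpha>"
  shows "path_chain \<alpha> + base_chain (\<alpha> 0) - base_chain (\<alpha> 1) \<in> class_chains C loop_subgroup"
proof -
  have "\<alpha> t \<in> topspace C'" if "t \<in> {0..1}" for t
    using continuous_map_funspace[OF \<alpha>[unfolded pathin_def]] that by auto
  then have \<alpha>C: "\<alpha> 0 \<in> topspace C'" "\<alpha> 1 \<in> topspace C'" by simp_all
  note d0 = base_path[OF \<alpha>C(1)] and d1 = base_path[OF \<alpha>C(2)]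
  let ?d0 = "base_path (\<alpha> 0)" and ?d1 = "base_path (\<alpha> 1)"
  have U01: "?d0 1 \<in> U" "?d1 1 \<in> U" using d0(2) d1(2) by (auto simp: path_image_def)
  obtain \<beta> where \<beta>: "path \<beta>" "path_image \<beta> \<subseteq> U" "\<beta> 0 = ?d0 1" "\<And>t. t \<in> {0..1} \<Longrightarrow> q (\<beta> t) = \<alpha> t"
    using q_lift[OF \<alpha> U01(1) d0(4)] by metis
  have \<beta>1: "\<beta> 1 \<in> U" using \<beta>(2) by (auto simp: path_image_def)
  have "q (?d1 1) = q (\<beta> 1)" using d1(4) \<beta>(4)[of 1] by simp
  then obtain \<psi> where \<psi>: "\<psi> \<in> exponent_kernel" "\<psi> (?d1 1) = \<beta> 1"
    using q_fibre[OF U01(2) \<beta>1] by metis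
  note \<psi>D = kernel_deck[OF \<psi>(1)]
  note P = path_to_props[OF \<psi>D]
  \<comment> \<open>The long side of two triangles, one with sides \<open>?d0\<close> and \<beta>,
    the other with sides \<open>path_to \<psi>\<close> and the \<psi>-translate of
    \<open>?d1\<close>; it cancels in their difference.\<close>
  let ?\<mu> = "?d0 +++ \<beta>"
  have j: "pathfinish ?d0 = pathstart \<beta>" using \<beta>(3) by (simp add: pathfinish_def pathstart_def)
  have \<mu>: "path ?\<mu>" "path_image ?\<mu> \<subseteq> U" using j d0 \<beta> by (simp_all add: path_image_join)
  have \<mu>e: "?\<mu> 0 = u\<^sub>0" "?\<mu> 1 = \<beta> 1" using d0(3) by (simp_all add: joinpaths_def)
  have 1: "singular_relboundary 1 C {} (path_chain (q \<circ> ?d0) + path_chain (q \<circ> \<beta>) - path_chain (q \<circ> ?\<mu>))"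
    by (rule triangle_q[OF d0(1,2) \<beta>(1,2) \<mu>]) (use \<beta>(3) d0(3) \<mu>e in auto)
  have "singular_relboundary 1 C {} (path_chain (q \<circ> path_to \<psi>) + path_chain (q \<circ> (\<psi> \<circ> ?d1)) - path_chain (q \<circ> ?\<mu>))"
    by (rule triangle_q[OF P(1,2) deck_path[OF \<psi>D d1(1,2)] \<mu>]) (use P(3,4) d1(3) \<psi>(2) \<mu>e in auto)
  then have 2: "singular_relboundary 1 C {} (path_chain (q \<circ> path_to \<psi>) + path_chain (q \<circ> ?d1) - path_chain (q \<circ> ?\<mu>))"
    unfolding q_deck_path[OF \<psi>(1) d1(2)] .
  have 3: "path_chain (q \<circ> path_to \<psi>) \<in> class_chains C loop_subgroup"
    using deck_loop[OF \<psi>(1) q_cont] deck_class_in_loop_subgroup[OF \<psi>(1)]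
    by (simp add: class_chains_def deck_class_def)
  have "path_chain \<alpha> = path_chain (q \<circ> \<beta>)"
    by (rule path_chain_cong) (simp add: \<beta>(4))
  then have "path_chain \<alpha> + base_chain (\<alpha> 0) - base_chain (\<alpha> 1) =
      (path_chain (q \<circ> ?d0) + path_chain (q \<circ> \<beta>) - path_chain (q \<circ> ?\<mu>))
      - (path_chain (q \<circ> path_to \<psi>) + path_chain (q \<circ> ?d1) - path_chain (q \<circ> ?\<mu>))
      + path_chain (q \<circ> path_to \<psi>)"
    by (simp add: base_chain_def)
  then show ?thesis
    using loop_add[OF loop_diff[OF loop_boundary[OF 1] loop_boundary[OF 2]] 3] by simp
qed

text \<open>
  Inside a disc a path is moved off the centre, its endpoints being first pushed away from the
  centre along radii.
\<close>

lemma disc_path_class: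
  assumes disc: "fermat_disc k n lam b \<epsilon> f g D" and s: "s \<in> ball 0 \<epsilon> - {0}"
    and e': "\<And>\<alpha>. pathin C' \<alpha> \<Longrightarrow> path_chain \<alpha> + e (\<alpha> 0) - e (\<alpha> 1) \<in> class_chains C loop_subgroup"
    and eb: "e b = e (f s) + path_chain (f \<circ> linepath s 0)"
    and \<sigma>: "pathin C \<sigma>" "\<sigma> ` {0..1} \<subseteq> D"
  shows "path_chain \<sigma> + e (\<sigma> 0) - e (\<sigma> 1) \<in> class_chains C loop_subgroup"
proof -
  let ?B = "ball (0::complex) \<epsilon>" and ?K = "class_chains C loop_subgroup"
  have f: "continuous_map (top_of_set ?B) C f" "f 0 = b" "f ` (?B - {0}) \<subseteq> topspace C'"
    and g: "continuous_map (subtopology C D) (top_of_set ?B) g" "\<And>P. P \<in> D \<Longrightarrow> f (g P) = P"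
    and \<epsilon>: "0 < \<epsilon>"
    using disc by (auto simp: fermat_disc_def)
  have "continuous_map (top_of_set {0..1}) (subtopology C D) \<sigma>"
    using \<sigma> by (auto simp: pathin_def continuous_map_in_subtopology)
  then have "continuous_map (top_of_set {0..1}) (top_of_set ?B) (g \<circ> \<sigma>)"
    using g(1) by (rule continuous_map_compose)
  then have \<tau>: "path (g \<circ> \<sigma>)" "path_image (g \<circ> \<sigma>) \<subseteq> ?B"
    by (auto simp: path_def path_image_def)
  define \<tau> where "\<tau> = g \<circ> \<sigma>"
  have f\<tau>: "f (\<tau> t) = \<sigma> t" if "t \<in> {0..1}" for t
  proof -
    have "\<sigma> t \<in> D" using \<sigma>(2) that by blast
    then show ?thesis using g(2) by (simp add: \<tau>_def)
  qed
  have \<tau>B: "\<tau> 0 \<in> ?B" "\<tau> 1 \<in> ?B" 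
    using \<tau>(2)[folded \<tau>_def] pathstart_in_path_image[of \<tau>] pathfinish_in_path_image[of \<tau>]
    by (auto simp only: pathstart_def pathfinish_def)
  \<comment> \<open>Only the centre is moved. So \<open>linepath (S t) t\<close> is a radius for t =
    0, where \<open>E\<close> is the hypothesis \<open>eb\<close>, and constant otherwise, where its
    chain bounds.\<close>
  define S where "S t = (if t = 0 then s else t)" for t :: complex
  have S: "S t \<in> ?B - {0}" if "t \<in> ?B" for t using that s by (auto simp: S_def)
  have E: "e (f t) - e (f (S t)) - path_chain (f \<circ> linepath (S t) t) \<in> ?K" if t: "t \<in> ?B" for t
  proof (cases "t = 0")
    case True
    then show ?thesis using eb f(2) loop_boundary[OF singular_relboundary_0] by (simp add: S_def)
  next
    case False
    have "f t \<in> topspace C" using f(1) t by (auto simp: continuous_map_def)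
    then have "singular_relboundary 1 C {} (path_chain (\<lambda>_. f t))" by (rule path_chain_const_boundary)
    moreover have "f \<circ> linepath (S t) t = (\<lambda>_. f t)"
      using False by (auto simp: S_def linepath_def algebra_simps simp flip: scaleR_add_left)
    ultimately show ?thesis
      using False loop_boundary[OF singular_relboundary_minus[THEN iffD2]] by (simp add: S_def)
  qed
  \<comment> \<open>Any path \<eta> off the centre between the moved endpoints will do: the
    quadrilateral between \<eta> and \<tau> is filled inside the full disc by the triangles
    \<open>T1\<close> and \<open>T2\<close>, which share a diagonal.\<close>
  have "path_connected (?B - {0})" by (rule path_connected_punctured_ball) simp
  then obtain \<eta> where \<eta>: "path \<eta>" "path_image \<eta> \<subseteq> ?B - {0}" "\<eta> 0 = S (\<tau> 0)" "\<eta> 1 = S (\<tau> 1)"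
    using S[OF \<tau>B(1)] S[OF \<tau>B(2)] unfolding path_connected_def pathstart_def pathfinish_def by meson
  have "continuous_map (top_of_set (?B - {0})) C f"
    using f(1) by (rule continuous_map_from_subtopology_mono) auto
  then have "continuous_map (top_of_set (?B - {0})) C' f"
    using f(3) by (subst fermat_curve'_subtopology) (auto simp: continuous_map_in_subtopology)
  then have "pathin C' (f \<circ> \<eta>)" by (rule pathin_continuous_image[OF _ \<eta>(1,2)])
  from e'[OF this] have A: "path_chain (f \<circ> \<eta>) + e (f (S (\<tau> 0))) - e (f (S (\<tau> 1))) \<in> ?K"
    by (simp add: \<eta>(3,4))
  have B: "simply_connected ?B" by (intro convex_imp_simply_connected) simp
  have seg: "path_image (linepath x y) \<subseteq> ?B" if "x \<in> ?B" "y \<in> ?B" for x y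
    using closed_segment_subset[OF that convex_ball] by simp
  have SB: "S (\<tau> 0) \<in> ?B" "S (\<tau> 1) \<in> ?B" using S \<tau>B by auto
  have T1: "singular_relboundary 1 C {} (path_chain (f \<circ> \<eta>) + path_chain (f \<circ> linepath (S (\<tau> 1)) (\<tau> 1))
      - path_chain (f \<circ> linepath (S (\<tau> 0)) (\<tau> 1)))"
    by (rule triangle_boundary_image[OF B f(1) \<eta>(1) _ path_linepath _ path_linepath])
       (use \<eta> seg SB \<tau>B in \<open>auto simp: pathstart_def pathfinish_def linepath_def\<close>)
  have T2: "singular_relboundary 1 C {} (path_chain (f \<circ> linepath (S (\<tau> 0)) (\<tau> 0)) + path_chain (f \<circ> \<tau>)
      - path_chain (f \<circ> linepath (S (\<tau> 0)) (\<tau> 1)))"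
    by (rule triangle_boundary_image[OF B f(1) path_linepath _ \<tau>[folded \<tau>_def] path_linepath])
       (use seg[OF SB(1) \<tau>B(1)] seg[OF SB(1) \<tau>B(2)] in \<open>auto simp: pathstart_def pathfinish_def linepath_def\<close>)
  have "path_chain \<sigma> = path_chain (f \<circ> \<tau>)" by (rule path_chain_cong) (simp add: f\<tau>)
  moreover have "\<sigma> 0 = f (\<tau> 0)" "\<sigma> 1 = f (\<tau> 1)" by (simp_all add: f\<tau>)
  ultimately have "path_chain \<sigma> + e (\<sigma> 0) - e (\<sigma> 1) =
      (path_chain (f \<circ> linepath (S (\<tau> 0)) (\<tau> 0)) + path_chain (f \<circ> \<tau>)
        - path_chain (f \<circ> linepath (S (\<tau> 0)) (\<tau> 1)))
      - (path_chain (f \<circ> \<eta>) + path_chain (f \<circ> linepath (S (\<tau> 1)) (\<tau> 1))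
        - path_chain (f \<circ> linepath (S (\<tau> 0)) (\<tau> 1)))
      + (path_chain (f \<circ> \<eta>) + e (f (S (\<tau> 0))) - e (f (S (\<tau> 1))))
      + (e (f (\<tau> 0)) - e (f (S (\<tau> 0))) - path_chain (f \<circ> linepath (S (\<tau> 0)) (\<tau> 0)))
      - (e (f (\<tau> 1)) - e (f (S (\<tau> 1))) - path_chain (f \<circ> linepath (S (\<tau> 1)) (\<tau> 1)))"
    by (simp add: algebra_simps)
  also have "\<dots> \<in> ?K"
    by (intro loop_diff loop_add A E \<tau>B loop_boundary T1 T2)
  finally show ?thesis .
qed

lemma loop_subgroup_eq: "loop_subgroup = carrier H1"
proof -
  let ?F = "topspace C - topspace C'"
  have "\<forall>P\<in>?F. \<exists>d. case d of (\<epsilon>, f, g, D) \<Rightarrow> fermat_disc k n lam P \<epsilon> f g D"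
    using fermat_disc_exists[OF k n1 inj] by fastforce
  then obtain d where d: "\<And>P. P \<in> ?F \<Longrightarrow> case d P of (\<epsilon>, f, g, D) \<Rightarrow> fermat_disc k n lam P \<epsilon> f g D"
    by metis
  define \<epsilon> where "\<epsilon> P = fst (d P)" for P
  define f where "f P = fst (snd (d P))" for P
  define g where "g P = fst (snd (snd (d P)))" for P
  define D where "D P = snd (snd (snd (d P)))" for P
  have disc: "fermat_disc k n lam P (\<epsilon> P) (f P) (g P) (D P)" if "P \<in> ?F" for P
    using d[OF that] by (simp add: \<epsilon>_def f_def g_def D_def case_prod_unfold)
  define s where "s P = complex_of_real (\<epsilon> P / 2)" for P
  have s: "s P \<in> ball 0 (\<epsilon> P) - {0}" if "P \<in> ?F" for P
    using disc[OF that] by (auto simp: s_def fermat_disc_def)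
  have fs: "f P (s P) \<in> topspace C'" if "P \<in> ?F" for P
    using disc[OF that] s[OF that] by (auto simp: fermat_disc_def)
  \<comment> \<open>A missing point has no preimage under \<open>q\<close>. Its correction runs to
    the nearby point \<open>f P (s P)\<close> of the punctured curve and then along a radius to the
    centre \<open>P\<close> of the disc.\<close>
  define e where "e P = (if P \<in> topspace C' then base_chain P
      else base_chain (f P (s P)) + path_chain (f P \<circ> linepath (s P) 0))" for P
  have e': "path_chain \<alpha> + e (\<alpha> 0) - e (\<alpha> 1) \<in> class_chains C loop_subgroup" if \<alpha>: "pathin C' \<alpha>" for \<alpha>
  proof -
    have "\<alpha> t \<in> topspace C'" if "t \<in> {0..1}" for t
      using continuous_map_funspace[OF \<alpha>[unfolded pathin_def]] that by auto
    then show ?thesis using unramified_path_class[OF \<alpha>] by (simp add: e_def)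
  qed
  have eb: "e P = e (f P (s P)) + path_chain (f P \<circ> linepath (s P) 0)" if "P \<in> ?F" for P
    using that fs[OF that] by (simp add: e_def)
  show ?thesis
  proof (rule homology_group_1_from_small_paths[OF subgroup_loop_subgroup, of "insert (topspace C') (D ` ?F)" e])
    fix V assume "V \<in> insert (topspace C') (D ` ?F)"
    then show "openin C V"
      using openin_fermat_curve'[OF n1 k] disc by (auto simp: fermat_disc_def)
  next
    have "P \<in> D P" if "P \<in> ?F" for P using disc[OF that] by (simp add: fermat_disc_def)
    then show "topspace C \<subseteq> \<Union> (insert (topspace C') (D ` ?F))" by blast
  next
    fix \<gamma> V assume V: "V \<in> insert (topspace C') (D ` ?F)" and \<gamma>: "pathin C \<gamma>" "\<gamma> ` {0..1} \<subseteq> V"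
    show "path_chain \<gamma> + e (\<gamma> 0) - e (\<gamma> 1) \<in> class_chains C loop_subgroup"
    proof (cases "V = topspace C'")
      case True
      then have "pathin C' \<gamma>"
        using \<gamma> by (subst fermat_curve'_subtopology) (auto simp: pathin_def continuous_map_in_subtopology)
      then show ?thesis by (rule e')
    next
      case False
      then obtain P where P: "P \<in> ?F" "V = D P" using V by blast
      show ?thesis
        by (rule disc_path_class[OF disc[OF P(1)] s[OF P(1)] e' eb[OF P(1)] \<gamma>(1)]) (use \<gamma>(2) P(2) in auto)
    qed
  qed
qed

text \<open>The loop is a cycle already in \<open>C'\<close>, and on chains the inclusion acts as
  \<open>chain_map 1 id\<close>, which leaves its path chain unchanged.\<close>

lemma hom_induced_deck_class:
  assumes "\<psi> \<in> exponent_kernel"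
  shows "hom_induced 1 C' {} C {} id (loop_class C' (q \<circ> path_to \<psi>)) = deck_class \<psi>"
proof -
  have "continuous_map C' C id"
    by (subst fermat_curve'_subtopology) (simp add: continuous_map_from_subtopology)
  then have "hom_induced (int 1) C' {} C {} id (homologous_rel_set 1 C' {} (path_chain (q \<circ> path_to \<psi>))) =
      homologous_rel_set 1 C {} (chain_map 1 id (path_chain (q \<circ> path_to \<psi>)))"
    using deck_loop[OF assms q_cont'] by (intro hom_induced_chain_map) auto
  then show ?thesis
    unfolding chain_map_path_chain id_comp loop_class_path_chain deck_class_def by (simp only: of_nat_1)
qed

theorem homology_generated:
  "generate H1 (hom_induced 1 C' {} C {} id ` (\<lambda>\<psi>. loop_class C' (q \<circ> path_to \<psi>)) ` fermat_generators Dp k n \<phi>)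
     = carrier H1"
proof -
  have "hom_induced 1 C' {} C {} id ` (\<lambda>\<psi>. loop_class C' (q \<circ> path_to \<psi>)) ` fermat_generators Dp k n \<phi> =
      deck_class ` fermat_generators Dp k n \<phi>"
    unfolding image_image using hom_induced_deck_class fermat_generators_subset by (intro image_cong) auto
  then show ?thesis using loop_subgroup_eq by (simp only: loop_subgroup_def)
qed

end

lemma inj_on_branch_pt:
  assumes "inj_on lam {1..n - 2}" "lam ` {1..n - 2} \<subseteq> - {0, 1}"
  shows "inj_on (branch_pt lam) {1..n}"
proof -
  have l: "lam (j - 2) \<noteq> 0 \<and> lam (j - 2) \<noteq> 1" if "j \<in> {3..n}" for j
  proof -
    have "j - 2 \<in> {1..n - 2}" using that by auto
    then have "lam (j - 2) \<in> - {0, 1}" using assms(2) by blast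
    then show ?thesis by simp
  qed
  show ?thesis
  proof (rule inj_onI)
    fix i j assume ij: "i \<in> {1..n}" "j \<in> {1..n}" "branch_pt lam i = branch_pt lam j"
    consider "i \<in> {1, 2}" "j \<in> {1, 2}" | "i \<in> {1, 2}" "j \<in> {3..n}" | "i \<in> {3..n}" "j \<in> {1, 2}"
      | "i \<in> {3..n}" "j \<in> {3..n}"
      using ij(1,2) by force
    then show "i = j"
    proof cases
      case 4
      then have "lam (i - 2) = lam (j - 2)" using ij(3) by (simp add: branch_pt_def)
      moreover have "i - 2 \<in> {1..n - 2}" "j - 2 \<in> {1..n - 2}" using 4 by auto
      ultimately have "i - 2 = j - 2" using assms(1) by (simp add: inj_on_def)
      moreover have "3 \<le> i" "3 \<le> j" using 4 by auto
      ultimately show ?thesis by linarith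
    qed (use ij(3) l in \<open>auto simp: branch_pt_def\<close>)
  qed
qed

theorem corollary1:
  fixes k n :: nat
    and lam :: "nat \<Rightarrow> complex"
    and U :: "'u::t2_space set"
    and A :: "('u set \<times> ('u \<Rightarrow> complex)) set"
    and p :: "'u \<Rightarrow> complex"
    and logp :: "nat \<Rightarrow> 'u \<Rightarrow> complex"
    and q :: "'u \<Rightarrow> (nat \<Rightarrow> complex) set"
    and u\<^sub>0 :: 'u
    and path_to :: "('u \<Rightarrow> 'u) \<Rightarrow> real \<Rightarrow> 'u"
    and \<phi> :: "nat \<Rightarrow> 'u \<Rightarrow> 'u"
  defines "R \<equiv> branch_set n lam"
    and "C \<equiv> fermat_curve k n lam"
    and "C' \<equiv> fermat_curve' k n lam"
    and "q \<equiv> fermat_cover k n logp"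
    and "D\<^sub>p \<equiv> deck_group U p"
    and "D\<^sub>q \<equiv> deck_group U q"
  assumes k: "2 \<le> k" and n: "2 \<le> n"
    and lam: "inj_on lam {1..n - 2}" "lam ` {1..n - 2} \<subseteq> - {0, 1}"
    and U: "riemann_surface U A" "simply_connected U"
    and p: "covering_space U p (- R)" "holomorphic_wrt A p"
    and logp: "\<And>i. i \<in> {1..n} \<Longrightarrow> holomorphic_wrt A (logp i)"
      "\<And>i u. i \<in> {1..n} \<Longrightarrow> u \<in> U \<Longrightarrow> exp (logp i u) = branch_fun lam p i u"
    and u\<^sub>0: "u\<^sub>0 \<in> U"
    and path_to: "\<And>\<psi>. \<psi> \<in> carrier D\<^sub>p \<Longrightarrow>
      path (path_to \<psi>) \<and> path_image (path_to \<psi>) \<subseteq> U \<and>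
      pathstart (path_to \<psi>) = u\<^sub>0 \<and> pathfinish (path_to \<psi>) = \<psi> u\<^sub>0"
    and free: "free_generators D\<^sub>p {1..n} \<phi>"
    and circle: "\<And>i. i \<in> {1..n} \<Longrightarrow>
      \<exists>\<epsilon>>0. cball (branch_pt lam i) \<epsilon> \<inter> R = {branch_pt lam i} \<and>
        homotopic_loops (- R) (p \<circ> path_to (\<phi> i)) (circlepath (branch_pt lam i) \<epsilon>)"
  shows "fermat_generators D\<^sub>p k n \<phi> \<subseteq> carrier D\<^sub>q \<and>
    generate (homology_group 1 C)
      (hom_induced 1 C' {} C {} id `
        (\<lambda>\<psi>. loop_class C' (q \<circ> path_to \<psi>)) ` fermat_generators D\<^sub>p k n \<phi>) =
    carrier (homology_group 1 C)"
proof -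
  have atlas: "complex_atlas U A" using U(1) by (simp add: riemann_surface_def)
  interpret fermat_covering k n lam U p logp u\<^sub>0 path_to \<phi>
  proof
    show "0 < k" using k by simp
    show "inj_on (branch_pt lam) {1..n}" by (rule inj_on_branch_pt[OF lam])
    show "covering_space U p (- branch_set n lam)" using p(1) by (simp only: R_def)
    show "continuous_on U (logp i)" if "i \<in> {1..n}" for i
      by (rule continuous_on_holomorphic_wrt[OF atlas logp(1)[OF that]])
    show "path (path_to \<psi>) \<and> path_image (path_to \<psi>) \<subseteq> U \<and>
      pathstart (path_to \<psi>) = u\<^sub>0 \<and> pathfinish (path_to \<psi>) = \<psi> u\<^sub>0" if "\<psi> \<in> carrier (deck_group U p)" for \<psi>
      using path_to that by (simp only: D\<^sub>p_def)
    show "\<phi> ` {1..n} \<subseteq> carrier (deck_group U p)"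
      "generate (deck_group U p) (\<phi> ` {1..n}) = carrier (deck_group U p)"
      using free by (simp_all only: free_generators_def D\<^sub>p_def)
    show "\<exists>\<epsilon>>0. cball (branch_pt lam i) \<epsilon> \<inter> branch_set n lam = {branch_pt lam i} \<and>
        homotopic_loops (- branch_set n lam) (p \<circ> path_to (\<phi> i)) (circlepath (branch_pt lam i) \<epsilon>)"
      if "i \<in> {1..n}" for i
      using circle[OF that] by (simp only: R_def)
  qed (use n U(2) logp(2) u\<^sub>0 in auto)
  show ?thesis
    unfolding C_def C'_def q_def D\<^sub>p_def D\<^sub>q_def carrier_deck_group_q
    using fermat_generators_subset homology_generated by blast
qed

end
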